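(* The Yoshikawa move $\Omega_8$ cannot be realized by a finite sequence of Yoshikawa moves of the other nine types $\Omega_1,\Omega_2,\Omega_3,\Omega_4,\Omega_4',\Omega_5,\Omega_6,\Omega_6',\Omega_7$. That is, there exist two admissible marked graph diagrams $D_1,D_2$ that differ by a single move $\Omega_8$ such that $D_1$ cannot be transformed into $D_2$ by any finite sequence of moves of the nine types $\Omega_1,\Omega_2,\Omega_3,\Omega_4,\Omega_4',\Omega_5,\Omega_6,\Omega_6',\Omega_7$ and ambient isotopies of $\mathbb{R}^2$.
   Context: Marked graph diagrams. A marked graph diagram $D$ is a link diagram in $\mathbb{R}^2$ (unoriented) that, besides classical over/under crossings, may have finitely many $4$-valent vertices, each equipped with a marker, i.e. a choice of one of the two pairs of opposite local regions at the vertex. The positive resolution $L_+(D)$ is the classical link diagram obtained by smoothing every vertex so that the two regions of the chosen pair are merged; the negative resolution $L_-(D)$ is obtained by using the other smoothing at every vertex. $D$ is admissible (a ch-diagram) if $L_+(D)$ and $L_-(D)$ are both diagrams of trivial links. Yoshikawa moves. Each move is a local replacement inside a disk in $\mathbb{R}^2$, the diagram being unchanged outside; it may be used in both directions and after any isotopy of $\mathbb{R}^2$. - $\Omega_1,\Omega_2,\Omega_3$: the classical Reidemeister moves I, II, III (all versions), involving no marked vertices. - $\Omega_4$ (resp. $\Omega_4'$): an arc which passes over (resp. under) two adjacent edges at a marked vertex is moved across the vertex so that it passes over (resp. under) the other two edges; the marker is unchanged. - $\Omega_5$: a classical crossing between two adjacent edges at a marked vertex, next to the vertex, is moved to the opposite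 side of the vertex, becoming a crossing between the other two edges, by rotating the vertex by $180^\circ$ in $3$-space about the axis in the projection plane that passes through the two opposite regions separating these two pairs of edges (a flype); the marker is carried along. - $\Omega_6$: a simple arc is replaced by an arc with a curl (one loop) whose only double point is a marked vertex, marked so that locally $L_-$ is an arc and $L_+$ is an arc together with a disjoint circle. - $\Omega_6'$: the same as $\Omega_6$ with the other marker, so that locally $L_+$ is an arc and $L_-$ is an arc together with a disjoint circle. - $\Omega_7$: take a disk with boundary points $1,\dots,6$ in cyclic order and three disjoint arcs $A,B,C$ in the disk, with $A$ joining $1,2$, $B$ joining $3,4$, $C$ joining $5,6$. For a pair of these arcs, joining them by a marked vertex means bringing them together along a planar arc between them (disjoint from everything else) until they touch at a $4$-valent vertex, marked so that the negative resolution recovers the two arcs. The move replaces the local diagram in which $A,B$ are joined by a marked vertex and $A,C$ are joined by a marked vertex by the local diagram in which $A,B$ are joined by a marked vertex and $B,C$ are joined by a marked vertex. Each side has two marked vertices, no classical crossings and six boundary points; on both sides $L_-$ is $A\cup B\cup C$ and $L_+$ joins $2,3$ and $4,5$ and $6,1$. - $\Omega_8$: take a square with two marked vertices: $v_1$ near the east side and $v_2$ near the north side. The two east edges of $v_1$ go to the east side of the square and its two west edges run as parallel horizontal strands to the west side. The two north edges of $v_2$ go to the north side and its two south edges run as parallel vertical strands to the south side. The two horizontal strands meet the two vertical strands in four classical crossings. The markers are such that in $L_-$ the two west edges of $v_1$ are joined to each other (and so are its two east edges), while each south edge of $v_2$ is joined to a north edge; in $L_+$ each west edge of $v_1$ is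 joined to an east edge, while the two south edges of $v_2$ are joined to each other (and so are its two north edges). The move replaces the diagram in which the horizontal strands pass over the vertical strands at all four crossings by the diagram in which they pass under at all four crossings. *)

theory Defs
  imports "HOL-Analysis.Analysis"
begin

definition ambient_isotopy :: "(real \<Rightarrow> 'a \<Rightarrow> 'a::topological_space) \<Rightarrow> bool" where
  "ambient_isotopy H \<longleftrightarrow>
     continuous_on ({0..1} \<times> UNIV) (\<lambda>(t, x). H t x) \<and>
     (\<forall>t\<in>{0..1}. \<exists>g. homeomorphism UNIV UNIV (H t) g) \<and>
     (\<forall>x. H 0 x = x)"

type_synonym plane = "real \<times> real"

text \<open>
  Crossing information and markers are germs of subsets of the plane. The germ of a set
  \<open>S\<close> at \<open>p\<close> is encoded by the filter \<open>at p within S\<close>, which depends only on the points of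
  \<open>S\<close> near \<open>p\<close> and different from \<open>p\<close>. At a crossing \<open>p\<close>, \<open>over D p\<close> is the germ of the over
  strand; at a marked vertex \<open>p\<close>, \<open>mark D p\<close> is the germ of the union of the two opposite
  regions chosen by the marker. At all other points these filters are \<open>bot\<close>.
\<close>

record diagram =
  curve :: "plane set"
  over :: "plane \<Rightarrow> plane filter"
  mark :: "plane \<Rightarrow> plane filter"

definition crossings :: "diagram \<Rightarrow> plane set" where
  "crossings D = {p. over D p \<noteq> bot}"

definition vertices :: "diagram \<Rightarrow> plane set" where
  "vertices D = {p. mark D p \<noteq> bot}"

definition chart_at :: "plane \<Rightarrow> plane set \<Rightarrow> plane set \<Rightarrow> (plane \<Rightarrow> plane) \<Rightarrow> (plane \<Rightarrow> plane) \<Rightarrow> bool" where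
  "chart_at p U W h g \<longleftrightarrow> open U \<and> open W \<and> p \<in> U \<and> homeomorphism U W h g \<and> h p = (0, 0)"

definition arc_point :: "diagram \<Rightarrow> plane \<Rightarrow> bool" where
  "arc_point D p \<longleftrightarrow> over D p = bot \<and> mark D p = bot \<and>
     (\<exists>U W h g. chart_at p U W h g \<and> h ` (curve D \<inter> U) = {(x, y) \<in> W. y = 0})"

definition crossing_point :: "diagram \<Rightarrow> plane \<Rightarrow> bool" where
  "crossing_point D p \<longleftrightarrow> mark D p = bot \<and>
     (\<exists>U W h g. chart_at p U W h g \<and> h ` (curve D \<inter> U) = {(x, y) \<in> W. x = 0 \<or> y = 0} \<and>
        over D p = at p within g ` {(x, y) \<in> W. y = 0})"

definition vertex_point :: "diagram \<Rightarrow> plane \<Rightarrow> bool" where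
  "vertex_point D p \<longleftrightarrow> over D p = bot \<and>
     (\<exists>U W h g. chart_at p U W h g \<and> h ` (curve D \<inter> U) = {(x, y) \<in> W. x = 0 \<or> y = 0} \<and>
        mark D p = at p within g ` {(x, y) \<in> W. x * y > 0})"

definition marked_graph_diagram :: "diagram \<Rightarrow> bool" where
  "marked_graph_diagram D \<longleftrightarrow>
     compact (curve D) \<and> finite (crossings D) \<and> finite (vertices D) \<and>
     (\<forall>p\<in>curve D. arc_point D p \<or> crossing_point D p \<or> vertex_point D p) \<and>
     (\<forall>p. p \<notin> curve D \<longrightarrow> over D p = bot \<and> mark D p = bot)"

definition transform :: "(plane \<Rightarrow> plane) \<Rightarrow> diagram \<Rightarrow> diagram" where
  "transform f D = \<lparr>curve = f ` curve D,
     over = (\<lambda>p. filtermap f (over D (inv f p))),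
     mark = (\<lambda>p. filtermap f (mark D (inv f p)))\<rparr>"

definition isotopic :: "diagram \<Rightarrow> diagram \<Rightarrow> bool" where
  "isotopic D D' \<longleftrightarrow> (\<exists>H. ambient_isotopy H \<and> D' = transform (H 1) D)"

definition restrict_to :: "plane set \<Rightarrow> diagram \<Rightarrow> diagram" where
  "restrict_to A D = \<lparr>curve = curve D \<inter> A,
     over = (\<lambda>p. if p \<in> A then over D p else bot),
     mark = (\<lambda>p. if p \<in> A then mark D p else bot)\<rparr>"

definition square :: "plane set" where
  "square = {-4..4} \<times> {-4..4}"

definition replaced_via :: "(plane \<Rightarrow> plane) \<Rightarrow> diagram \<Rightarrow> diagram \<Rightarrow> diagram \<Rightarrow> diagram \<Rightarrow> bool" where
  "replaced_via f T T' D D' \<longleftrightarrow>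
     restrict_to square (transform f D) = T \<and>
     restrict_to square (transform f D') = T' \<and>
     restrict_to (- square) (transform f D) = restrict_to (- square) (transform f D')"

definition local_move :: "diagram \<Rightarrow> diagram \<Rightarrow> diagram \<Rightarrow> diagram \<Rightarrow> bool" where
  "local_move T T' D D' \<longleftrightarrow> (\<exists>H. ambient_isotopy H \<and> replaced_via (H 1) T T' D D')"

fun polyline :: "plane list \<Rightarrow> plane set" where
  "polyline [] = {}"
| "polyline [p] = {p}"
| "polyline (p # q # ps) = closed_segment p q \<union> polyline (q # ps)"

text \<open>
  \<open>picture ls xs vs\<close> is the union of the polygonal lines \<open>ls\<close>. An entry \<open>(p, d)\<close> of \<open>xs\<close>
  is a crossing \<open>p\<close> whose over strand has direction \<open>d\<close>. An entry \<open>(p, d, e)\<close> of \<open>vs\<close> is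
  a marked vertex \<open>p\<close> with consecutive edges in directions \<open>d\<close> and \<open>e\<close>; its marker is the
  region between these two edges together with the opposite region. All pictures below
  are straight near their crossings and vertices.
\<close>

definition picture :: "plane list list \<Rightarrow> (plane \<times> plane) list \<Rightarrow> (plane \<times> plane \<times> plane) list \<Rightarrow> diagram" where
  "picture ls xs vs = \<lparr>curve = (\<Union>l\<in>set ls. polyline l),
     over = (\<lambda>p. case map_of xs p of None \<Rightarrow> bot
                 | Some d \<Rightarrow> at p within {p + t *\<^sub>R d |t. True}),
     mark = (\<lambda>p. case map_of vs p of None \<Rightarrow> bot
                 | Some (d, e) \<Rightarrow> at p within {p + s *\<^sub>R d + t *\<^sub>R e |s t. s * t > 0})\<rparr>"

datatype resolution = Positive | Negative

text \<open>The marker of \<open>vertex_picture\<close> chooses the west and the east region.\<close>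

definition vertex_picture :: diagram where
  "vertex_picture = picture [[(-4, -4), (4, 4)], [(-4, 4), (4, -4)]] [] [((0, 0), (1, 1), (1, -1))]"

fun smoothing_picture :: "resolution \<Rightarrow> diagram" where
  "smoothing_picture Positive =
     picture [[(-4, 4), (0, 2), (4, 4)], [(-4, -4), (0, -2), (4, -4)]] [] []"
| "smoothing_picture Negative =
     picture [[(-4, 4), (-2, 0), (-4, -4)], [(4, 4), (2, 0), (4, -4)]] [] []"

definition smoothed_at_vertex :: "resolution \<Rightarrow> diagram \<Rightarrow> diagram \<Rightarrow> bool" where
  "smoothed_at_vertex r D D' \<longleftrightarrow>
     (\<exists>f g. homeomorphism UNIV UNIV f g \<and>
        replaced_via f vertex_picture (smoothing_picture r) D D')"

text \<open>
  The vertices are smoothed one after the other; the result is determined only up to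
  isotopy of the plane.
\<close>

inductive resolves_to :: "resolution \<Rightarrow> diagram \<Rightarrow> diagram \<Rightarrow> bool" for r where
  "vertices D = {} \<Longrightarrow> resolves_to r D D"
| "smoothed_at_vertex r D D' \<Longrightarrow> resolves_to r D' L \<Longrightarrow> resolves_to r D L"

text \<open>
  A link in space with diagram \<open>D\<close>: \<open>h p\<close> is the height of the (upper) point over \<open>p\<close>,
  and \<open>l p\<close> is the height of the lower point over a crossing \<open>p\<close>.
\<close>

definition link_over :: "diagram \<Rightarrow> (plane \<times> real) set \<Rightarrow> bool" where
  "link_over D S \<longleftrightarrow>
     (\<exists>h l. S = {(p, h p) |p. p \<in> curve D} \<union> {(p, l p) |p. p \<in> crossings D} \<and>
        continuous_on (curve D - crossings D) h \<and>
        (\<forall>p\<in>crossings D. l p < h p \<and> (h \<longlongrightarrow> h p) (over D p) \<and>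
           (\<exists>A. over D p = at p within A \<and> (h \<longlongrightarrow> l p) (at p within (curve D - A)))))"

text \<open>A link that lies in a plane is a disjoint union of simple closed curves of that plane.\<close>

definition trivial_link :: "(plane \<times> real) set \<Rightarrow> bool" where
  "trivial_link S \<longleftrightarrow> (\<exists>H. ambient_isotopy H \<and> H 1 ` S \<subseteq> UNIV \<times> {0})"

definition trivial_link_diagram :: "diagram \<Rightarrow> bool" where
  "trivial_link_diagram L \<longleftrightarrow> vertices L = {} \<and> (\<exists>S. link_over L S \<and> trivial_link S)"

definition admissible :: "diagram \<Rightarrow> bool" where
  "admissible D \<longleftrightarrow> marked_graph_diagram D \<and>
     (\<forall>r. \<exists>L. resolves_to r D L \<and> trivial_link_diagram L)"

datatype move_type =
  Omega1 | Omega2 | Omega3 | Omega4 | Omega4' | Omega5 | Omega6 | Omega6' | Omega7 | Omega8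

text \<open>
  Isotopies of the plane preserve orientation, so versions that differ by a planar
  reflection are listed separately unless a rotation or an exchange of the two sides
  relates them. In \<open>Omega3\<close>, \<open>Omega4\<close> and \<open>Omega4'\<close> the moving arc passes from the
  north to the south of the centre. In \<open>Omega5\<close> the half twist keeps its handedness, so
  the over strand has the same slope on both sides.
\<close>

fun sides :: "move_type \<Rightarrow> (diagram \<times> diagram) set" where
  "sides Omega1 =
     {(picture [[(-4, -4), (0, 0), (4, -4)]] [] [],
       picture [[(-4, -4), (2, 2), (-2, 2), (4, -4)]] [((0, 0), d)] [])
      |d. d \<in> {(1, 1), (1, -1)}}"
| "sides Omega2 =
     {(picture [[(-2, -4), (-2, 4)], [(2, -4), (2, 4)]] [] [],
       picture [[(-2, -4), (2, 0), (-2, 4)], [(2, -4), (-2, 0), (2, 4)]]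
         [((0, -2), (1, 1)), ((0, 2), (-1, 1))] [])}"
| "sides Omega3 =
     {(picture [[(-4, -4), (4, 4)], [(-4, 4), (4, -4)], [(-4, 0), (-3, 2), (3, 2), (4, 0)]]
         [((0, 0), d), ((-2, 2), (1, 0)), ((2, 2), (1, 0))] [],
       picture [[(-4, -4), (4, 4)], [(-4, 4), (4, -4)], [(-4, 0), (-3, -2), (3, -2), (4, 0)]]
         [((0, 0), d), ((-2, -2), (1, 0)), ((2, -2), (1, 0))] [])
      |d. d \<in> {(1, 1), (1, -1)}}"
| "sides Omega4 =
     {(picture [[(-4, -4), (4, 4)], [(-4, 4), (4, -4)], [(-4, 0), (-3, 2), (3, 2), (4, 0)]]
         [((-2, 2), (1, 0)), ((2, 2), (1, 0))] [((0, 0), (1, 1), e)],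
       picture [[(-4, -4), (4, 4)], [(-4, 4), (4, -4)], [(-4, 0), (-3, -2), (3, -2), (4, 0)]]
         [((-2, -2), (1, 0)), ((2, -2), (1, 0))] [((0, 0), (1, 1), e)])
      |e. e \<in> {(1, -1), (-1, 1)}}"
| "sides Omega4' =
     {(picture [[(-4, -4), (4, 4)], [(-4, 4), (4, -4)], [(-4, 0), (-3, 2), (3, 2), (4, 0)]]
         [((-2, 2), (1, -1)), ((2, 2), (1, 1))] [((0, 0), (1, 1), e)],
       picture [[(-4, -4), (4, 4)], [(-4, 4), (4, -4)], [(-4, 0), (-3, -2), (3, -2), (4, 0)]]
         [((-2, -2), (1, 1)), ((2, -2), (1, -1))] [((0, 0), (1, 1), e)])
      |e. e \<in> {(1, -1), (-1, 1)}}"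
| "sides Omega5 =
     {(picture [[(-4, 2), (0, -2), (4, 2)], [(-4, -2), (0, 2), (4, -2)]]
         [((-2, 0), d)] [((2, 0), (1, 1), e)],
       picture [[(-4, 2), (0, -2), (4, 2)], [(-4, -2), (0, 2), (4, -2)]]
         [((2, 0), d)] [((-2, 0), (1, 1), e)])
      |d e. d \<in> {(1, 1), (1, -1)} \<and> e \<in> {(1, -1), (-1, 1)}}"
| "sides Omega6 =
     {(picture [[(-4, -4), (0, 0), (4, -4)]] [] [],
       picture [[(-4, -4), (2, 2), (-2, 2), (4, -4)]] [] [((0, 0), (1, 1), (1, -1))])}"
| "sides Omega6' =
     {(picture [[(-4, -4), (0, 0), (4, -4)]] [] [],
       picture [[(-4, -4), (2, 2), (-2, 2), (4, -4)]] [] [((0, 0), (1, 1), (-1, 1))])}"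
| (* The boundary points 1, ..., 6 are (-2,4), (2,4), (4,0), (2,-4), (-2,-4), (-4,0). *)
  "sides Omega7 =
     {(picture [[(-4, 0), (4, 0)], [(-2, -4), (-2, 4)], [(2, -4), (2, 4)]] []
         [((-2, 0), (1, 0), (0, 1)), ((2, 0), (-1, 0), (0, 1))],
       picture [[(-2, -4), (2, 4)], [(-2, 4), (4, 0)], [(-4, 0), (2, -4)]] []
         [((1, 2), (1, 2), (-3, 2)), ((-1, -2), (1, 2), (3, -2))])}"
| (* The vertices v1 and v2 are (3,0) and (0,3). *)
  "sides Omega8 =
     {(picture [[(-4, 1), (2, 1), (4, -1)], [(-4, -1), (2, -1), (4, 1)],
                [(-1, -4), (-1, 2), (1, 4)], [(1, -4), (1, 2), (-1, 4)]]
         [((-1, -1), (1, 0)), ((-1, 1), (1, 0)), ((1, -1), (1, 0)), ((1, 1), (1, 0))]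
         [((3, 0), (1, 1), (1, -1)), ((0, 3), (1, 1), (1, -1))],
       picture [[(-4, 1), (2, 1), (4, -1)], [(-4, -1), (2, -1), (4, 1)],
                [(-1, -4), (-1, 2), (1, 4)], [(1, -4), (1, 2), (-1, 4)]]
         [((-1, -1), (0, 1)), ((-1, 1), (0, 1)), ((1, -1), (0, 1)), ((1, 1), (0, 1))]
         [((3, 0), (1, 1), (1, -1)), ((0, 3), (1, 1), (1, -1))])}"

definition yoshikawa_move :: "move_type \<Rightarrow> diagram \<Rightarrow> diagram \<Rightarrow> bool" where
  "yoshikawa_move m D D' \<longleftrightarrow> marked_graph_diagram D \<and> marked_graph_diagram D' \<and>
     (\<exists>(T, T')\<in>sides m. local_move T T' D D' \<or> local_move T' T D D')"

definition transformable :: "move_type set \<Rightarrow> diagram \<Rightarrow> diagram \<Rightarrow> bool" where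
  "transformable M = (\<lambda>D D'. isotopic D D' \<or> (\<exists>m\<in>M. yoshikawa_move m D D'))\<^sup>*\<^sup>*"

end

theory Submission
  imports Defs
begin

text \<open>
  View a marked graph diagram as a spatial graph and let the moves act on the first homology of
  its connected components. The moves other than \<open>\<Omega>\<^sub>8\<close> replace trees by trees inside a disk or
  add unlinked circles, so they preserve whether two cycles in different components of the graph
  have odd linking number. Modulo 2 a pair of such cycles is a colouring of the edges: one bit
  distinguishes two unions of components, the other bit is a cycle, that is, it has even sum at
  every vertex; the linking number counts the crossings of the first cycle over the second. Two
  bands, each closed up to a figure eight, are unlinked if one of them lies over the other, and
  \<open>\<Omega>\<^sub>8\<close> reverses four of their eight crossings, one for every pair of a loop of the first band
  and a loop of the second.
\<close>

section \<open>Colourings of diagrams\<close>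

text \<open>The two cycles have to lie in different components, not merely be disjoint:
  \<open>Omega7\<close> distributes its six ends differently over its two vertices, so that two
  disjoint arcs on one side may both be forced through the middle edge of the other side. This is
  why the first bit is constant across every vertex.

  Diagrams are topological curves that come without a list of edges, so colours are attached to
  germs. This has a price: the four edges at a vertex must be recovered from an arbitrary chart, and
  each polygonal picture must be shown to have the same colourings as a finite list of pieces. After
  that every move is a Boolean check.

  In the example the closing arcs of the horizontal band are on top in both diagrams, so reversing
  the inner crossings makes pairs of loops oddly linked. The resolutions do not see this: each of
  them fuses the two loops of one band into a single circle with a finger across the other band, and
  this finger can be pulled out.\<close>

declare split_paired_All [simp del] split_paired_Ex [simp del]

definition axes :: "plane set" where
  "axes = {(1, 0), (-1, 0), (0, 1), (0, -1)}"

definition ray :: "plane \<Rightarrow> plane set" where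
  "ray d = {t *\<^sub>R d |t. 0 < t}"

type_synonym colour = "bool \<times> bool"

definition balanced :: "(plane \<Rightarrow> colour) \<Rightarrow> bool" where
  "balanced k \<longleftrightarrow> (\<forall>d\<in>axes. \<forall>e\<in>axes. fst (k d) = fst (k e)) \<and> even (card {d \<in> axes. snd (k d)})"

definition cross_chart ::
  "plane \<Rightarrow> plane set \<Rightarrow> plane set \<Rightarrow> plane set \<Rightarrow> (plane \<Rightarrow> plane) \<Rightarrow> (plane \<Rightarrow> plane) \<Rightarrow> bool" where
  "cross_chart p C U W h g \<longleftrightarrow>
     chart_at p U W h g \<and> h ` (C \<inter> U) = {(x, y) \<in> W. x = 0 \<or> y = 0}"

text \<open>One chart is asked for, which makes colourings easy to build;
  \<open>vertex_colouring_any_chart\<close> shows that every other chart then works too, which makes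
  them easy to use.\<close>

definition vertex_colouring :: "plane set \<Rightarrow> plane \<Rightarrow> (plane \<Rightarrow> colour) \<Rightarrow> bool" where
  "vertex_colouring C p c \<longleftrightarrow> (\<exists>U W h g k. cross_chart p C U W h g \<and> balanced k \<and>
     (\<forall>d\<in>axes. \<forall>\<^sub>F q in at p within C. h q \<in> ray d \<longrightarrow> c q = k d))"

text \<open>At a crossing two strands share a point, hence two functions: \<open>c\<close> is the
  colour of the upper strand and \<open>u\<close> that of the lower one. The upper strand is known
  only as a germ, so the lower one is described as the curve minus a representative \<open>A\<close>
  of that germ. At a vertex only the germs of the four edges are constrained.\<close>

definition coloured_at :: "diagram \<Rightarrow> (plane \<Rightarrow> colour) \<Rightarrow> (plane \<Rightarrow> colour) \<Rightarrow> plane \<Rightarrow> bool" where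
  "coloured_at D c u p \<longleftrightarrow>
     (p \<in> curve D - crossings D - vertices D \<longrightarrow> (\<forall>\<^sub>F q in at p within curve D. c q = c p)) \<and>
     (p \<in> crossings D \<longrightarrow> (\<forall>\<^sub>F q in over D p. c q = c p) \<and>
        (\<exists>A. over D p = at p within A \<and> (\<forall>\<^sub>F q in at p within (curve D - A). c q = u p))) \<and>
     (p \<in> vertices D \<longrightarrow> vertex_colouring (curve D) p c)"

definition colouring :: "diagram \<Rightarrow> (plane \<Rightarrow> colour) \<Rightarrow> (plane \<Rightarrow> colour) \<Rightarrow> bool" where
  "colouring D c u \<longleftrightarrow> (\<forall>p. coloured_at D c u p)"

definition linking_crossings ::
  "diagram \<Rightarrow> (plane \<Rightarrow> colour) \<Rightarrow> (plane \<Rightarrow> colour) \<Rightarrow> plane set" where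
  "linking_crossings D c u = {p \<in> crossings D. c p = (True, True) \<and> u p = (False, True)}"

definition linked :: "diagram \<Rightarrow> bool" where
  "linked D \<longleftrightarrow> (\<exists>c u. colouring D c u \<and> odd (card (linking_crossings D c u)))"

lemma balanced_iff:
  "balanced k \<longleftrightarrow> fst (k (-1, 0)) = fst (k (1, 0)) \<and> fst (k (0, 1)) = fst (k (1, 0)) \<and>
     fst (k (0, -1)) = fst (k (1, 0)) \<and>
     ((snd (k (1, 0)) = snd (k (-1, 0))) = (snd (k (0, 1)) = snd (k (0, -1))))"
proof -
  have "card {d \<in> axes. snd (k d)} = (\<Sum>d\<in>axes. of_bool (snd (k d)))"
    by (simp add: axes_def of_bool_def sum.If_cases Int_def)
  also have "\<dots> = of_bool (snd (k (1, 0))) + of_bool (snd (k (-1, 0))) +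
      of_bool (snd (k (0, 1))) + of_bool (snd (k (0, -1)))"
    by (simp add: axes_def)
  finally show ?thesis
    unfolding balanced_def by (auto simp: axes_def)
qed

section \<open>Germs of sets as filters\<close>

lemma at_within_eq_bot: "closed S \<Longrightarrow> p \<notin> S \<Longrightarrow> at p within S = bot"
  for S :: "'a::t1_space set"
  using trivial_limit_within islimpt_subset closed_limpt by metis

lemma eventually_in_at_within: "\<forall>\<^sub>F q in at p within A. q \<in> A"
  by (simp add: eventually_at_filter)

lemma germ_eqD:
  assumes "at p within A = at p within B"
  shows "\<forall>\<^sub>F q in nhds p. q \<noteq> p \<longrightarrow> (q \<in> A \<longleftrightarrow> q \<in> B)"
proof -
  have "\<forall>\<^sub>F q in at p within A. q \<in> B" "\<forall>\<^sub>F q in at p within B. q \<in> A"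
    using assms eventually_in_at_within by metis+
  then show ?thesis
    unfolding eventually_at_filter by eventually_elim auto
qed

lemma germ_eqI:
  assumes "\<forall>\<^sub>F q in nhds p. q \<noteq> p \<longrightarrow> (q \<in> A \<longleftrightarrow> q \<in> B)"
  shows "at p within A = at p within B"
proof (rule filter_eqI)
  fix P
  show "eventually P (at p within A) = eventually P (at p within B)"
    unfolding eventually_at_filter
  proof
    assume "\<forall>\<^sub>F x in nhds p. x \<noteq> p \<longrightarrow> x \<in> A \<longrightarrow> P x"
    with assms show "\<forall>\<^sub>F x in nhds p. x \<noteq> p \<longrightarrow> x \<in> B \<longrightarrow> P x" by eventually_elim auto
  next
    assume "\<forall>\<^sub>F x in nhds p. x \<noteq> p \<longrightarrow> x \<in> B \<longrightarrow> P x"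
    with assms show "\<forall>\<^sub>F x in nhds p. x \<noteq> p \<longrightarrow> x \<in> A \<longrightarrow> P x" by eventually_elim auto
  qed
qed

lemma germ_Diff_cong:
  assumes "at p within A = at p within B"
  shows "at p within (C - A) = at p within (C - B)"
  by (rule germ_eqI, rule eventually_mono[OF germ_eqD[OF assms]]) auto

lemma germ_local:
  assumes "open N" "p \<in> N" "A \<inter> N = B \<inter> N"
  shows "at p within A = at p within B"
  using assms by (intro at_within_nhd[of p N]) auto

lemma eventually_at_within_UN:
  assumes "finite I"
  shows "eventually P (at p within (\<Union>i\<in>I. S i)) \<longleftrightarrow> (\<forall>i\<in>I. eventually P (at p within S i))"
  using assms by (induction I) (auto simp: at_within_union eventually_sup)

text \<open>A continuous injection maps the germ of \<open>A\<close> into the germ of the image; the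
  same bound for the inverse gives the opposite inequality.\<close>

lemma filtermap_at_within_homeomorphism:
  fixes f :: "'a::topological_space \<Rightarrow> 'b::topological_space"
  assumes "homeomorphism UNIV UNIV f g"
  shows "filtermap f (at p within A) = at (f p) within (f ` A)"
proof -
  have fg: "f (g y) = y" "g (f x) = x" for x y
    using assms by (auto simp: homeomorphism_def)
  have cont: "continuous_on UNIV f" "continuous_on UNIV g"
    using assms by (auto simp: homeomorphism_def)
  have le: "filtermap f' (at x within B) \<le> at (f' x) within (f' ` B)"
    if "continuous_on UNIV f'" "inj f'" for f' :: "'c::topological_space \<Rightarrow> 'd::topological_space" and x B
  proof -
    have "(f' \<longlongrightarrow> f' x) (at x within B)"
      using that(1) continuous_on_subset tendsto_within_subset unfolding continuous_on_def
      by (metis UNIV_I top_greatest)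
    moreover have "\<forall>\<^sub>F y in at x within B. f' y \<in> f' ` B \<and> f' y \<noteq> f' x"
      using that(2) by (auto simp: eventually_at_filter inj_def intro!: always_eventually)
    ultimately have "filterlim f' (at (f' x) within (f' ` B)) (at x within B)"
      by (simp add: filterlim_at)
    then show ?thesis by (simp add: filterlim_def)
  qed
  have inj: "inj f" "inj g" using fg by (metis injI)+
  have "at (f p) within (f ` A) = filtermap f (filtermap g (at (f p) within (f ` A)))"
    by (simp add: filtermap_filtermap fg)
  also have "\<dots> \<le> filtermap f (at (g (f p)) within (g ` f ` A))"
    by (intro filtermap_mono le cont inj)
  also have "\<dots> = filtermap f (at p within A)"
    by (simp add: fg image_image)
  finally show ?thesis
    using le[OF cont(1) inj(1)] by (simp add: antisym)
qed

section \<open>The four edges at a point with a cross-shaped chart\<close>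

lemma cross_chart_local:
  assumes "cross_chart p C U W h g" "open N" "p \<in> N" "C \<inter> N = C' \<inter> N"
  shows "cross_chart p C' (U \<inter> N) (h ` (U \<inter> N)) h g"
proof -
  have ch: "open U" "open W" "p \<in> U" "homeomorphism U W h g" "h p = (0, 0)"
      "h ` (C \<inter> U) = {(x, y) \<in> W. x = 0 \<or> y = 0}"
    using assms(1) by (auto simp: cross_chart_def chart_at_def)
  have "h ` (U \<inter> N) = W \<inter> g -` N"
  proof
    show "h ` (U \<inter> N) \<subseteq> W \<inter> g -` N"
      using ch(4) by (auto simp: homeomorphism_def)
    show "W \<inter> g -` N \<subseteq> h ` (U \<inter> N)"
    proof
      fix w assume "w \<in> W \<inter> g -` N"
      then have "w = h (g w)" "g w \<in> U \<inter> N"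
        using ch(4) by (auto simp: homeomorphism_def)
      then show "w \<in> h ` (U \<inter> N)" by (rule image_eqI)
    qed
  qed
  then have "open (h ` (U \<inter> N))"
    using ch(2,4) assms(2) by (auto simp: homeomorphism_def intro!: continuous_open_preimage)
  moreover have "homeomorphism (U \<inter> N) (h ` (U \<inter> N)) h g"
    by (rule homeomorphism_of_subsets[OF ch(4)]) auto
  moreover have "h ` (C' \<inter> (U \<inter> N)) = {(x, y) \<in> h ` (U \<inter> N). x = 0 \<or> y = 0}"
  proof -
    have inj: "inj_on h U" using ch(4) by (auto simp: homeomorphism_def intro: inj_on_inverseI)
    have "C' \<inter> (U \<inter> N) = (C \<inter> U) \<inter> (U \<inter> N)" using assms(4) by auto
    then have "h ` (C' \<inter> (U \<inter> N)) = h ` (C \<inter> U) \<inter> h ` (U \<inter> N)"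
      using inj_on_image_Int[OF inj, of "C \<inter> U" "U \<inter> N"] by simp
    also have "\<dots> = {(x, y) \<in> h ` (U \<inter> N). x = 0 \<or> y = 0}"
      unfolding ch(6) using ch(4) by (auto simp: homeomorphism_def)
    finally show ?thesis .
  qed
  ultimately show ?thesis
    using ch assms(2,3) by (auto simp: cross_chart_def chart_at_def)
qed

text \<open>On the two coordinate axes lying on a given ray becomes an open condition of the plane.
  This prepares the connectedness argument in \<open>connected_in_ray\<close>.\<close>

lemma ray_axes_iff:
  assumes "e \<in> axes" "fst v = 0 \<or> snd v = 0"
  shows "v \<in> ray e \<longleftrightarrow> inner v e > 0"
proof
  assume "v \<in> ray e"
  then show "inner v e > 0" using assms(1) by (auto simp: ray_def axes_def)
next
  assume "inner v e > 0"
  then have "v = inner v e *\<^sub>R e"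
    using assms by (cases v) (auto simp: axes_def)
  with \<open>inner v e > 0\<close> show "v \<in> ray e" unfolding ray_def by blast
qed

lemma ray_cover:
  assumes "fst v = 0 \<or> snd v = 0" "v \<noteq> 0"
  shows "\<exists>e\<in>axes. v \<in> ray e"
proof -
  have "\<exists>e\<in>axes. inner v e > 0"
    using assms by (cases v) (auto simp: axes_def zero_prod_def)
  then show ?thesis using ray_axes_iff assms(1) by blast
qed

lemma ray_disjoint:
  assumes "d \<in> axes" "e \<in> axes" "v \<in> ray d" "v \<in> ray e"
  shows "d = e"
  using assms by (auto simp: axes_def ray_def)

lemma ray_cross: "d \<in> axes \<Longrightarrow> v \<in> ray d \<Longrightarrow> (fst v = 0 \<or> snd v = 0) \<and> v \<noteq> 0"
  by (auto simp: axes_def ray_def zero_prod_def)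

text \<open>The cross without its centre is the disjoint union of four relatively open rays, so a
  connected subset cannot meet two of them.\<close>

lemma connected_in_ray:
  assumes "connected X" "X \<noteq> {}" "\<forall>v\<in>X. (fst v = 0 \<or> snd v = 0) \<and> v \<noteq> 0"
  shows "\<exists>e\<in>axes. X \<subseteq> ray e"
proof -
  obtain v where v: "v \<in> X" using assms(2) by auto
  then obtain e where e: "e \<in> axes" "v \<in> ray e" using ray_cover assms(3) by metis
  define A where "A = {w. inner w e > 0}"
  define B where "B = (\<Union>e'\<in>axes - {e}. {w::plane. inner w e' > 0})"
  have op: "open A" "open B" unfolding A_def B_def
    by (auto intro!: open_Collect_less continuous_intros open_UN)
  have AB: "w \<in> A \<union> B \<and> (w \<in> A \<longleftrightarrow> w \<in> ray e) \<and> \<not> (w \<in> A \<and> w \<in> B)" if "w \<in> X" for w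
  proof -
    have w: "fst w = 0 \<or> snd w = 0" "w \<noteq> 0" using that assms(3) by auto
    have "w \<in> A \<longleftrightarrow> w \<in> ray e" unfolding A_def using ray_axes_iff[OF e(1) w(1)] by simp
    moreover have "w \<in> B \<longleftrightarrow> (\<exists>e'\<in>axes - {e}. w \<in> ray e')"
      unfolding B_def using ray_axes_iff[OF _ w(1)] by auto
    ultimately show ?thesis using ray_cover[OF w] ray_disjoint e(1) by blast
  qed
  have "X \<inter> B = {}"
    using connectedD[OF assms(1) op] AB v e(2) by blast
  then have "X \<subseteq> ray e" using AB by blast
  with e(1) show ?thesis by blast
qed

text \<open>Charts are only homeomorphisms, so edges cannot be compared by tangent directions.
  Instead a short initial segment of a ray of the second chart is connected, and its image in the
  first chart lies in the cross without its centre, hence in one ray.\<close>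

lemma cross_chart_ray_into_ray:
  assumes c1: "cross_chart p C U W h g" and c2: "cross_chart p C U2 W2 h2 g2" and d: "d \<in> axes"
  shows "\<exists>e\<in>axes. \<forall>\<^sub>F q in at p within C. h2 q \<in> ray d \<longrightarrow> h q \<in> ray e"
proof -
  have ch1: "open U" "open W" "p \<in> U" "homeomorphism U W h g" "h p = 0"
      "h ` (C \<inter> U) = {(x, y) \<in> W. x = 0 \<or> y = 0}"
    using c1 by (auto simp: cross_chart_def chart_at_def zero_prod_def)
  have ch2: "open U2" "open W2" "p \<in> U2" "homeomorphism U2 W2 h2 g2" "h2 p = 0"
      "h2 ` (C \<inter> U2) = {(x, y) \<in> W2. x = 0 \<or> y = 0}"
    using c2 by (auto simp: cross_chart_def chart_at_def zero_prod_def)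
  have g20: "g2 0 = p" "0 \<in> W2" using ch2(3,4,5) by (auto simp: homeomorphism_def) 
  have "open (W2 \<inter> g2 -` U)"
    using ch2(2,4) ch1(1) by (auto simp: homeomorphism_def intro!: continuous_open_preimage)
  moreover have "0 \<in> W2 \<inter> g2 -` U" using g20 ch1(3) by auto
  ultimately obtain r where r: "r > 0" "ball 0 r \<subseteq> W2 \<inter> g2 -` U"
    by (metis open_contains_ball)
  define R where "R = ray d \<inter> ball 0 r"
  have "convex (ray d)"
  proof -
    have "ray d = (\<lambda>t. t *\<^sub>R d) ` {0<..}" by (auto simp: ray_def)
    then show ?thesis by (simp add: convex_scaled convex_linear_image linear_scaleR_left)
  qed
  then have R: "connected R" unfolding R_def by (intro convex_connected convex_Int convex_ball)
  have Rne: "R \<noteq> {}"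
  proof -
    have "(r/2) *\<^sub>R d \<in> ball 0 r" using r(1) d by (auto simp: axes_def norm_Pair)
    moreover have "(r/2) *\<^sub>R d \<in> ray d" unfolding ray_def using r(1) half_gt_zero by blast
    ultimately have "(r/2) *\<^sub>R d \<in> R" unfolding R_def by simp
    then show ?thesis by auto
  qed
  define X where "X = h ` g2 ` R"
  have RW: "R \<subseteq> W2" "g2 ` R \<subseteq> U" using r(2) R_def by auto
  have "connected X" unfolding X_def
    using R RW ch1(4) ch2(4)
    by (intro connected_continuous_image) (auto simp: homeomorphism_def intro: continuous_on_subset)
  moreover have "X \<noteq> {}" using Rne X_def by auto
  moreover have "(fst v = 0 \<or> snd v = 0) \<and> v \<noteq> 0" if "v \<in> X" for v
  proof -
    obtain w where w: "w \<in> R" "v = h (g2 w)" using \<open>v \<in> X\<close> X_def by auto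
    have w': "fst w = 0 \<or> snd w = 0" "w \<noteq> 0" using w ray_cross[OF d] R_def by auto
    have "w \<in> h2 ` (C \<inter> U2)" unfolding ch2(6) using w' w RW by (auto simp: case_prod_beta)
    then have gw: "g2 w \<in> C" using ch2(4) by (auto simp: homeomorphism_def)
    then have "v \<in> h ` (C \<inter> U)" using w RW by auto
    then have "fst v = 0 \<or> snd v = 0" unfolding ch1(6) by auto
    moreover have "v \<noteq> 0"
    proof
      assume "v = 0"
      then have "g2 w = p" using w RW ch1(3,4,5)
        by (metis homeomorphism_def image_subset_iff)
      then have "w = 0" using ch2(3,4,5) w RW by (metis homeomorphism_apply2 subsetD)
      then show False using w' by simp
    qed
    ultimately show ?thesis by simp
  qed
  ultimately obtain e where e: "e \<in> axes" "X \<subseteq> ray e" using connected_in_ray by metis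
  have "\<forall>\<^sub>F q in nhds p. q \<in> U2 \<and> h2 q \<in> ball 0 r"
  proof -
    have "open (U2 \<inter> h2 -` ball 0 r)"
      using ch2(1,4) by (auto simp: homeomorphism_def intro!: continuous_open_preimage)
    moreover have "p \<in> U2 \<inter> h2 -` ball 0 r" using ch2 r by auto
    ultimately show ?thesis by (auto simp: eventually_nhds)
  qed
  then have "\<forall>\<^sub>F q in at p within C. h2 q \<in> ray d \<longrightarrow> h q \<in> ray e"
    unfolding eventually_at_filter
  proof eventually_elim
    case (elim q)
    have "h q \<in> ray e" if "h2 q \<in> ray d"
    proof -
      have "h2 q \<in> R" using elim that R_def by auto
      moreover have "g2 (h2 q) = q" using elim ch2(4) by (auto simp: homeomorphism_def)
      ultimately have "h q \<in> X" unfolding X_def by force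
      then show ?thesis using e by auto
    qed
    then show ?case by blast
  qed
  with e(1) show ?thesis by blast
qed

text \<open>Guards against vacuity: each ray contains points of the curve arbitrarily near
  \<open>p\<close>, so the ray assigned to it by a change of chart is unique.\<close>

lemma cross_chart_ray_frequently:
  assumes c2: "cross_chart p C U W h g" and d: "d \<in> axes"
  shows "\<exists>\<^sub>F q in at p within C. h q \<in> ray d"
proof -
  have ch2: "open U" "open W" "p \<in> U" "homeomorphism U W h g" "h p = 0"
      "h ` (C \<inter> U) = {(x, y) \<in> W. x = 0 \<or> y = 0}"
    using c2 by (auto simp: cross_chart_def chart_at_def zero_prod_def)
  have g0: "g 0 = p" "0 \<in> W" using ch2(3,4,5) by (auto simp: homeomorphism_def)
  define F where "F = filtermap (\<lambda>t. g (t *\<^sub>R d)) (at_right (0::real))"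
  have t0: "((\<lambda>t. t *\<^sub>R d) \<longlongrightarrow> 0) (at_right (0::real))"
    by (auto intro!: tendsto_eq_intros)
  have ev: "\<forall>\<^sub>F t in at_right (0::real). t *\<^sub>R d \<in> W"
    using t0 ch2(2) g0(2) by (simp add: topological_tendstoD)
  have "isCont g 0" using ch2(2,4) g0(2) by (auto simp: homeomorphism_def continuous_on_eq_continuous_at)
  then have "(g \<longlongrightarrow> p) (nhds 0)" using g0 by (metis tendsto_at_iff_tendsto_nhds isCont_def)
  then have "((\<lambda>t. g (t *\<^sub>R d)) \<longlongrightarrow> p) (at_right (0::real))"
    using t0 by (rule filterlim_compose)
  moreover have ev2: "\<forall>\<^sub>F t in at_right (0::real). g (t *\<^sub>R d) \<in> C \<and> g (t *\<^sub>R d) \<noteq> p \<and> h (g (t *\<^sub>R d)) \<in> ray d"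
    using ev eventually_at_right_less[of "0::real"]
  proof eventually_elim
    case (elim t)
    have hg: "h (g (t *\<^sub>R d)) = t *\<^sub>R d" using ch2(4) elim(1) by (auto simp: homeomorphism_def)
    have r: "t *\<^sub>R d \<in> ray d" using elim(2) ray_def by blast
    then have "t *\<^sub>R d \<in> h ` (C \<inter> U)"
      unfolding ch2(6) using ray_cross[OF d r] elim(1) by (cases "t *\<^sub>R d") auto
    then have "g (t *\<^sub>R d) \<in> C" using ch2(4) by (auto simp: homeomorphism_def)
    moreover have "g (t *\<^sub>R d) \<noteq> p" using hg ch2(5) ray_cross[OF d r] by metis
    ultimately show ?case using hg r by auto
  qed
  ultimately have "filterlim (\<lambda>t. g (t *\<^sub>R d)) (at p within C) (at_right (0::real))"
    by (auto simp: filterlim_at elim: eventually_mono)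
  moreover have "\<exists>\<^sub>F t in at_right (0::real). h (g (t *\<^sub>R d)) \<in> ray d"
    using ev2 by (intro eventually_frequently) (auto elim: eventually_mono)
  ultimately show ?thesis
    unfolding frequently_def filterlim_iff by blast
qed

text \<open>The changes of chart in both directions induce maps \<open>f\<close> and
  \<open>f'\<close> of \<open>axes\<close> with \<open>f'\<close> undoing \<open>f\<close>. Hence
  \<open>f\<close> is a permutation of the four axes, and both clauses of \<open>balanced\<close>
  are invariant under permutations.\<close>

lemma vertex_colouring_any_chart:
  assumes "vertex_colouring C p c" and c2: "cross_chart p C U2 W2 h2 g2"
  shows "\<exists>k. balanced k \<and> (\<forall>d\<in>axes. \<forall>\<^sub>F q in at p within C. h2 q \<in> ray d \<longrightarrow> c q = k d)"
proof -
  obtain U W h g k where c1: "cross_chart p C U W h g" and k: "balanced k"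
    "\<And>d. d \<in> axes \<Longrightarrow> \<forall>\<^sub>F q in at p within C. h q \<in> ray d \<longrightarrow> c q = k d"
    using assms(1) by (auto simp: vertex_colouring_def)
  obtain f where f: "\<And>d. d \<in> axes \<Longrightarrow> f d \<in> axes"
    "\<And>d. d \<in> axes \<Longrightarrow> \<forall>\<^sub>F q in at p within C. h2 q \<in> ray d \<longrightarrow> h q \<in> ray (f d)"
    using bchoice[of axes "\<lambda>d e. e \<in> axes \<and> (\<forall>\<^sub>F q in at p within C. h2 q \<in> ray d \<longrightarrow> h q \<in> ray e)"]
      cross_chart_ray_into_ray[OF c1 c2] by blast
  obtain f' where f': "\<And>d. d \<in> axes \<Longrightarrow> f' d \<in> axes"
    "\<And>d. d \<in> axes \<Longrightarrow> \<forall>\<^sub>F q in at p within C. h q \<in> ray d \<longrightarrow> h2 q \<in> ray (f' d)"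
    using bchoice[of axes "\<lambda>d e. e \<in> axes \<and> (\<forall>\<^sub>F q in at p within C. h q \<in> ray d \<longrightarrow> h2 q \<in> ray e)"]
      cross_chart_ray_into_ray[OF c2 c1] by blast
  have ff: "f' (f d) = d" if d: "d \<in> axes" for d
  proof -
    have "\<forall>\<^sub>F q in at p within C. h2 q \<in> ray d \<longrightarrow> h2 q \<in> ray (f' (f d))"
      using f(2)[OF d] f'(2)[OF f(1)[OF d]] by eventually_elim auto
    then have "\<exists>q. h2 q \<in> ray d \<and> h2 q \<in> ray (f' (f d))"
      using frequently_ex[OF frequently_eventually_conj[OF cross_chart_ray_frequently[OF c2 d]]]
      by blast
    then show ?thesis using ray_disjoint f f' d by metis
  qed
  have inj: "inj_on f axes" using ff by (metis inj_onI)
  have fin: "finite axes" by (simp add: axes_def)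
  have bij: "f ` axes = axes" using endo_inj_surj[OF fin _ inj] f(1) by blast
  have "card {d \<in> axes. snd (k (f d))} = card (f ` {d \<in> axes. snd (k (f d))})"
    by (rule card_image[symmetric]) (use inj in \<open>auto simp: inj_on_def\<close>)
  also have "f ` {d \<in> axes. snd (k (f d))} = {d \<in> f ` axes. snd (k d)}"
    by auto
  also have "\<dots> = {d \<in> axes. snd (k d)}"
    unfolding bij ..
  finally have card_eq: "card {d \<in> axes. snd (k (f d))} = card {d \<in> axes. snd (k d)}" .
  have "balanced (k \<circ> f)"
    unfolding balanced_def o_def card_eq
  proof (intro conjI ballI)
    show "fst (k (f d)) = fst (k (f e))" if "d \<in> axes" "e \<in> axes" for d e
      using k(1) f(1) that unfolding balanced_def by blast
    show "even (card {d \<in> axes. snd (k d)})"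
      using k(1) unfolding balanced_def by blast
  qed
  moreover have "\<forall>\<^sub>F q in at p within C. h2 q \<in> ray d \<longrightarrow> c q = (k \<circ> f) d" if "d \<in> axes" for d
    using f(2)[OF that] k(2)[OF f(1)[OF that]] by eventually_elim auto
  ultimately show ?thesis by blast
qed

section \<open>Invariance under homeomorphisms of the plane\<close>

lemma curve_transform [simp]: "curve (transform f D) = f ` curve D"
  by (simp add: transform_def)

lemma over_transform: "over (transform f D) p = filtermap f (over D (inv f p))"
  by (simp add: transform_def)

lemma mark_transform: "mark (transform f D) p = filtermap f (mark D (inv f p))"
  by (simp add: transform_def)

context
  fixes f g :: "plane \<Rightarrow> plane"
  assumes hom: "homeomorphism UNIV UNIV f g"
begin

lemma homeo_simps [simp]: "f (g y) = y" "g (f x) = x" "inv f = g" "inv g = f"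
proof -
  have fg: "f (g y) = y" "g (f x) = x" for x y
    using hom by (auto simp: homeomorphism_def)
  then show "f (g y) = y" "g (f x) = x" by auto
  show "inv f = g" "inv g = f" using fg by (auto intro: inv_equality)
qed

lemma crossings_transform: "crossings (transform f D) = f ` crossings D"
proof -
  have "p \<in> f ` A \<longleftrightarrow> g p \<in> A" for p A by (metis homeo_simps(1,2) image_iff)
  then show ?thesis
    by (auto simp: crossings_def over_transform filtermap_bot_iff)
qed

lemma vertices_transform: "vertices (transform f D) = f ` vertices D"
proof -
  have "p \<in> f ` A \<longleftrightarrow> g p \<in> A" for p A by (metis homeo_simps(1,2) image_iff)
  then show ?thesis
    by (auto simp: vertices_def mark_transform filtermap_bot_iff)
qed

lemma transform_inverse: "transform g (transform f D) = D"
  by (cases D) (simp add: transform_def image_image filtermap_filtermap)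

lemma vertex_colouring_transform:
  assumes "vertex_colouring C p c"
  shows "vertex_colouring (f ` C) (f p) (c \<circ> g)"
proof -
  obtain U W h h' k where ch: "cross_chart p C U W h h'" and k: "balanced k"
    "\<And>d. d \<in> axes \<Longrightarrow> \<forall>\<^sub>F q in at p within C. h q \<in> ray d \<longrightarrow> c q = k d"
    using assms by (auto simp: vertex_colouring_def)
  have cf: "continuous_on A f" "continuous_on A g" for A
    using hom by (auto simp: homeomorphism_def intro: continuous_on_subset)
  have "open (f ` U)" if "open U"
    using homeomorphism_imp_open_map[OF hom, of U] that by simp
  moreover have "homeomorphism (f ` U) W (h \<circ> g) (f \<circ> h')" if "homeomorphism U W h h'"
    using that by (rule homeomorphism_compose[rotated]) (use cf in \<open>auto simp: homeomorphism_def image_image\<close>)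
  moreover have "(h \<circ> g) ` (f ` C \<inter> f ` U) = h ` (C \<inter> U)"
  proof -
    have "inj f" by (metis homeo_simps(2) injI)
    then have "f ` C \<inter> f ` U = f ` (C \<inter> U)" by (simp add: image_Int)
    then show ?thesis by (simp add: image_image)
  qed
  ultimately have "cross_chart (f p) (f ` C) (f ` U) W (h \<circ> g) (f \<circ> h')"
    using ch by (auto simp: cross_chart_def chart_at_def)
  moreover have "\<forall>\<^sub>F q in at (f p) within f ` C. (h \<circ> g) q \<in> ray d \<longrightarrow> (c \<circ> g) q = k d" if "d \<in> axes" for d
    using k(2)[OF that]
    by (simp add: filtermap_at_within_homeomorphism[OF hom, symmetric] eventually_filtermap)
  ultimately show ?thesis using k(1) unfolding vertex_colouring_def by blast
qed

lemma colouring_transform: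
  assumes "colouring D c u"
  shows "colouring (transform f D) (c \<circ> g) (u \<circ> g)"
  unfolding colouring_def
proof
  fix q
  define p where "p = g q"
  have q: "q = f p" by (simp add: p_def)
  have inj: "inj f" by (metis homeo_simps(2) injI)
  have col: "coloured_at D c u p" using assms by (simp add: colouring_def)
  have mem: "f p \<in> f ` A \<longleftrightarrow> p \<in> A" for A using inj by (simp add: inj_image_mem_iff)
  show "coloured_at (transform f D) (c \<circ> g) (u \<circ> g) q"
    unfolding coloured_at_def
  proof (intro conjI impI)
    assume "q \<in> curve (transform f D) - crossings (transform f D) - vertices (transform f D)"
    then have "p \<in> curve D - crossings D - vertices D"
      using mem by (simp add: crossings_transform vertices_transform q)
    then have "\<forall>\<^sub>F q in at p within curve D. c q = c p" using col by (simp add: coloured_at_def)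
    then show "\<forall>\<^sub>F qa in at q within curve (transform f D). (c \<circ> g) qa = (c \<circ> g) q"
      by (simp add: q filtermap_at_within_homeomorphism[OF hom, symmetric] eventually_filtermap)
  next
    assume "q \<in> crossings (transform f D)"
    then have "p \<in> crossings D" using mem by (simp add: crossings_transform q)
    then obtain A where A: "\<forall>\<^sub>F q in over D p. c q = c p" "over D p = at p within A"
      "\<forall>\<^sub>F q in at p within (curve D - A). c q = u p"
      using col by (auto simp: coloured_at_def)
    show "\<forall>\<^sub>F qa in over (transform f D) q. (c \<circ> g) qa = (c \<circ> g) q"
      using A by (simp add: over_transform q eventually_filtermap)
    have "f ` curve D - f ` A = f ` (curve D - A)" using inj by (simp add: image_set_diff)
    then have "\<forall>\<^sub>F qa in at q within curve (transform f D) - f ` A. (c \<circ> g) qa = (u \<circ> g) q"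
      using A by (simp add: q filtermap_at_within_homeomorphism[OF hom, symmetric] eventually_filtermap)
    moreover have "over (transform f D) q = at q within f ` A"
      using A by (simp add: over_transform q filtermap_at_within_homeomorphism[OF hom])
    ultimately show "\<exists>A. over (transform f D) q = at q within A \<and>
        (\<forall>\<^sub>F qa in at q within curve (transform f D) - A. (c \<circ> g) qa = (u \<circ> g) q)" by blast
  next
    assume "q \<in> vertices (transform f D)"
    then have "p \<in> vertices D" using mem by (simp add: vertices_transform q)
    then have "vertex_colouring (curve D) p c" using col by (simp add: coloured_at_def)
    then show "vertex_colouring (curve (transform f D)) q (c \<circ> g)"
      using vertex_colouring_transform by (simp add: q)
  qed
qed

lemma linked_transform:
  assumes "linked D"
  shows "linked (transform f D)"
proof -
  obtain c u where cu: "colouring D c u" "odd (card (linking_crossings D c u))"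
    using assms by (auto simp: linked_def)
  have "linking_crossings (transform f D) (c \<circ> g) (u \<circ> g) = f ` linking_crossings D c u"
    by (auto simp: linking_crossings_def crossings_transform)
  moreover have "inj f" by (metis homeo_simps(2) injI)
  ultimately have "odd (card (linking_crossings (transform f D) (c \<circ> g) (u \<circ> g)))"
    using cu(2) by (simp add: card_image inj_on_subset)
  with colouring_transform[OF cu(1)] show ?thesis by (auto simp: linked_def)
qed

end

lemma linked_transform_iff:
  assumes "homeomorphism UNIV UNIV f g"
  shows "linked (transform f D) \<longleftrightarrow> linked D"
  using linked_transform[OF assms, of D] linked_transform[OF homeomorphism_symD[OF assms], of "transform f D"]
  by (auto simp: transform_inverse[OF assms])

lemma ambient_isotopy_homeomorphism:
  assumes "ambient_isotopy H"
  obtains g where "homeomorphism UNIV UNIV (H 1) g"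
  using assms unfolding ambient_isotopy_def by (metis atLeastAtMost_iff order_refl zero_le_one)

lemma isotopic_linked:
  assumes "isotopic D D'"
  shows "linked D' \<longleftrightarrow> linked D"
  using assms linked_transform_iff by (auto simp: isotopic_def elim!: ambient_isotopy_homeomorphism)

section \<open>Cutting and gluing colourings along the square\<close>

text \<open>The colour condition at a point is determined by the diagram and the colours near that
  point. Thus it carries over verbatim at interior points of the square and at points outside, and
  only the frontier needs an argument of its own.\<close>

lemma coloured_at_local:
  assumes N: "open N" "p \<in> N" "curve D \<inter> N = curve D' \<inter> N" "over D p = over D' p" "mark D p = mark D' p"
    "\<And>q. q \<in> N \<Longrightarrow> c q = c' q" "u p = u' p"
    and col: "coloured_at D c u p"
  shows "coloured_at D' c' u' p"
proof -
  have evN: "\<forall>\<^sub>F q in at p within A. q \<in> N" for A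
    using N(1,2) by (auto simp: eventually_at_filter eventually_nhds)
  have germ: "at p within (curve D - A) = at p within (curve D' - A)" for A
    using N by (intro germ_local[of N]) auto
  have germ0: "at p within curve D = at p within curve D'"
    using N by (intro germ_local[of N]) auto
  have sw: "\<forall>\<^sub>F q in at p within A. c' q = x" if "\<forall>\<^sub>F q in at p within A. c q = x" for A x
    using that evN[of A] by eventually_elim (use N in auto)
  have mem: "p \<in> crossings D' \<longleftrightarrow> p \<in> crossings D" "p \<in> vertices D' \<longleftrightarrow> p \<in> vertices D"
      "p \<in> curve D' \<longleftrightarrow> p \<in> curve D"
    using N by (auto simp: crossings_def vertices_def)
  have cp: "c' p = c p" using N by auto
  show ?thesis
    unfolding coloured_at_def
  proof (intro conjI impI)
    assume "p \<in> curve D' - crossings D' - vertices D'"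
    then have "\<forall>\<^sub>F q in at p within curve D. c q = c p"
      using col mem by (simp add: coloured_at_def)
    then show "\<forall>\<^sub>F q in at p within curve D'. c' q = c' p"
      using sw unfolding germ0 cp by simp
  next
    assume "p \<in> crossings D'"
    then obtain A where A: "\<forall>\<^sub>F q in over D p. c q = c p" "over D p = at p within A"
      "\<forall>\<^sub>F q in at p within (curve D - A). c q = u p"
      using col mem by (auto simp: coloured_at_def)
    show "\<forall>\<^sub>F q in over D' p. c' q = c' p"
      using A N(4) sw cp by simp
    show "\<exists>A. over D' p = at p within A \<and> (\<forall>\<^sub>F q in at p within curve D' - A. c' q = u' p)"
      using A N sw germ by (intro exI[of _ A]) simp
  next
    assume "p \<in> vertices D'"
    then have "vertex_colouring (curve D) p c" using col mem by (simp add: coloured_at_def)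
    then obtain U W h g k where ch: "cross_chart p (curve D) U W h g" and k: "balanced k"
      "\<And>d. d \<in> axes \<Longrightarrow> \<forall>\<^sub>F q in at p within curve D. h q \<in> ray d \<longrightarrow> c q = k d"
      by (auto simp: vertex_colouring_def)
    have "\<forall>\<^sub>F q in at p within curve D'. h q \<in> ray d \<longrightarrow> c' q = k d" if "d \<in> axes" for d
      using k(2)[OF that] evN[of "curve D"] unfolding germ0 by eventually_elim (use N in auto)
    with cross_chart_local[OF ch N(1,2,3)] k(1) show "vertex_colouring (curve D') p c'"
      unfolding vertex_colouring_def by blast
  qed
qed

lemma curve_restrict_to [simp]: "curve (restrict_to A D) = curve D \<inter> A"
  by (simp add: restrict_to_def)

lemma over_restrict_to: "over (restrict_to A D) p = (if p \<in> A then over D p else bot)"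
  by (simp add: restrict_to_def)

lemma mark_restrict_to: "mark (restrict_to A D) p = (if p \<in> A then mark D p else bot)"
  by (simp add: restrict_to_def)

lemma crossings_restrict_to: "crossings (restrict_to A D) = crossings D \<inter> A"
  by (auto simp: crossings_def over_restrict_to)

lemma vertices_restrict_to: "vertices (restrict_to A D) = vertices D \<inter> A"
  by (auto simp: vertices_def mark_restrict_to)

text \<open>A one-sided relation, to be used in both directions. It asks for some new colouring with
  the same boundary values instead of a bijection, since the two sides of a move may have different
  edges inside. Keeping crossings and vertices in the interior makes every frontier point of the
  curve a plain arc point.\<close>

definition transfers :: "diagram \<Rightarrow> diagram \<Rightarrow> bool" where
  "transfers T T' \<longleftrightarrow>
     crossings T \<union> vertices T \<union> crossings T' \<union> vertices T' \<subseteq> interior square \<and>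
     curve T' \<inter> frontier square \<subseteq> curve T \<and>
     (\<forall>c u. colouring T c u \<longrightarrow> (\<exists>c' u'. colouring T' c' u' \<and>
        (\<forall>p\<in>curve T' \<inter> frontier square. c' p = c p) \<and>
        (even (card (linking_crossings T' c' u')) \<longleftrightarrow> even (card (linking_crossings T c u)))))"

lemma closed_square: "closed square"
  by (simp add: square_def closed_Times)

lemma interior_square: "interior square = {-4<..<4} \<times> {-4<..<4}"
  by (simp add: square_def interior_Times)

lemma square_cases:
  obtains "p \<in> interior square" | "p \<in> frontier square" "p \<in> square" "p \<notin> interior square" | "p \<in> - square"
  using closed_square by (auto simp: frontier_def)

text \<open>At frontier points restriction only shrinks the germ of the curve, and by the hypotheses
  no crossing or vertex of the square lies there.\<close>

lemma colouring_restrict: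
  assumes "colouring D c u" "crossings D \<inter> square \<subseteq> interior square" "vertices D \<inter> square \<subseteq> interior square"
  shows "colouring (restrict_to square D) c u"
  unfolding colouring_def
proof
  fix p
  have col: "coloured_at D c u p" using assms by (simp add: colouring_def)
  show "coloured_at (restrict_to square D) c u p"
  proof (cases "p \<in> interior square")
    case True
    then show ?thesis
      using interior_subset
      by (intro coloured_at_local[OF open_interior True _ _ _ _ _ col])
        (auto simp: over_restrict_to mark_restrict_to)
  next
    case False
    then have "p \<notin> crossings (restrict_to square D)" "p \<notin> vertices (restrict_to square D)"
      using assms by (auto simp: crossings_restrict_to vertices_restrict_to)
    moreover have "\<forall>\<^sub>F q in at p within curve (restrict_to square D). c q = c p"
      if "p \<in> curve (restrict_to square D)"
    proof -
      have "p \<in> curve D - crossings D - vertices D"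
        using that calculation by (auto simp: crossings_restrict_to vertices_restrict_to)
      then have "\<forall>\<^sub>F q in at p within curve D. c q = c p" using col by (simp add: coloured_at_def)
      then show ?thesis by (rule filter_leD[rotated]) (auto intro: at_le)
    qed
    ultimately show ?thesis by (auto simp: coloured_at_def)
  qed
qed

text \<open>The new colouring is \<open>c1\<close> on the square and the old \<open>c\<close>
  outside. At a frontier point the germ of the curve is the join of an inner and an outer germ,
  whose colours agree because \<open>c1\<close> and \<open>c\<close> do. The crossings outside form
  the same set \<open>X\<close> in both counts, so only the parity inside matters.\<close>

lemma transfers_linked:
  assumes tr: "transfers T T'"
    and T: "restrict_to square D = T" "restrict_to square D' = T'"
    and out: "restrict_to (- square) D = restrict_to (- square) D'"
    and fin: "finite (crossings D)" "finite (crossings D')"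
    and "linked D"
  shows "linked D'"
proof -
  obtain c u where cu: "colouring D c u" "odd (card (linking_crossings D c u))"
    using \<open>linked D\<close> by (auto simp: linked_def)
  have spec: "crossings T = crossings D \<inter> square" "vertices T = vertices D \<inter> square"
     "crossings T' = crossings D' \<inter> square" "vertices T' = vertices D' \<inter> square"
    using T by (auto simp: crossings_restrict_to vertices_restrict_to)
  have int: "crossings T \<subseteq> interior square" "vertices T \<subseteq> interior square"
      "crossings T' \<subseteq> interior square" "vertices T' \<subseteq> interior square"
    using tr by (auto simp: transfers_def)
  have "colouring T c u"
    using colouring_restrict[OF cu(1)] int spec T by simp
  then obtain c1 u1 where c1: "colouring T' c1 u1"
      "\<And>p. p \<in> curve T' \<Longrightarrow> p \<in> frontier square \<Longrightarrow> c1 p = c p"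
      "even (card (linking_crossings T' c1 u1)) \<longleftrightarrow> even (card (linking_crossings T c u))"
    using tr unfolding transfers_def by blast
  have cT: "curve T = curve D \<inter> square" "curve T' = curve D' \<inter> square" using T by auto
  have cout: "curve D - square = curve D' - square"
    using arg_cong[OF out, of curve] by auto
  have oin: "over T' p = over D' p" "mark T' p = mark D' p"
      "over T p = over D p" "mark T p = mark D p" if "p \<in> square" for p
    using that T by (auto simp: over_restrict_to mark_restrict_to)
  have oout: "over D p = over D' p" "mark D p = mark D' p" if "p \<notin> square" for p
    using fun_cong[OF arg_cong[OF out, of over], of p] fun_cong[OF arg_cong[OF out, of mark], of p] that
    by (auto simp: over_restrict_to mark_restrict_to)
  define c' where "c' p = (if p \<in> square then c1 p else c p)" for p
  define u' where "u' p = (if p \<in> square then u1 p else u p)" for p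
  have "coloured_at D' c' u' p" for p
  proof (cases p rule: square_cases)
    case 1
    then have "p \<in> square" using interior_subset by auto
    with 1 show ?thesis
      using interior_subset c1(1) oin
      by (intro coloured_at_local[of "interior square" p T' D' c1 c' u1 u'])
        (auto simp: c'_def u'_def cT colouring_def)
  next
    case 3
    then show ?thesis
      using cu(1) oout cout closed_square
      by (intro coloured_at_local[of "- square" p D D' c c' u u'])
        (auto simp: c'_def u'_def colouring_def)
  next
    case 2
    have nx: "p \<notin> crossings D'" "p \<notin> vertices D'" "p \<notin> crossings D" "p \<notin> vertices D"
      using 2 int spec by auto
    have "\<forall>\<^sub>F q in at p within curve D'. c' q = c' p" if "p \<in> curve D'"
    proof -
      have pT': "p \<in> curve T'" using that 2 cT by auto
      \<comment> \<open>The point also lies on the old curve, so the old colouring is locally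
        constant there and gives the outer germ the colour \<open>c p\<close>.\<close>
      then have pT: "p \<in> curve T" using tr 2 unfolding transfers_def by blast
      have "\<forall>\<^sub>F q in at p within curve T'. c1 q = c1 p"
        using c1(1) nx spec pT' by (auto simp: colouring_def coloured_at_def)
      then have 1: "\<forall>\<^sub>F q in at p within curve T'. c' q = c' p"
        using eventually_in_at_within[of "curve T'" p]
        by eventually_elim (use 2 cT in \<open>auto simp: c'_def\<close>)
      have "\<forall>\<^sub>F q in at p within curve D. c q = c p"
        using cu(1) nx pT cT by (auto simp: colouring_def coloured_at_def)
      then have "\<forall>\<^sub>F q in at p within (curve D' - square). c q = c p"
        by (rule filter_leD[rotated]) (use cout in \<open>auto intro: at_le\<close>)
      then have 2: "\<forall>\<^sub>F q in at p within (curve D' - square). c' q = c' p"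
        using eventually_in_at_within[of "curve D' - square" p]
        by eventually_elim (use 2 c1(2)[OF pT' 2(1)] in \<open>auto simp: c'_def\<close>)
      have "curve D' = curve T' \<union> (curve D' - square)" using cT by auto
      then have "at p within curve D' = sup (at p within curve T') (at p within (curve D' - square))"
        using at_within_union by metis
      with 1 2 show ?thesis by (simp add: eventually_sup)
    qed
    with nx show ?thesis by (auto simp: coloured_at_def)
  qed
  then have col': "colouring D' c' u'" by (simp add: colouring_def)
  define X where "X = linking_crossings D c u - square"
  have finX: "finite X" "finite (linking_crossings T c u)" "finite (linking_crossings T' c1 u1)"
    using fin spec by (auto simp: X_def linking_crossings_def)
  have dis: "linking_crossings T c u \<inter> X = {}" "linking_crossings T' c1 u1 \<inter> X = {}"
    using spec by (auto simp: X_def linking_crossings_def)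
  have "linking_crossings D c u = linking_crossings T c u \<union> X"
    using spec by (auto simp: X_def linking_crossings_def)
  then have n1: "card (linking_crossings D c u) = card (linking_crossings T c u) + card X"
    using finX dis(1) by (simp add: card_Un_disjoint)
  have "linking_crossings D' c' u' = linking_crossings T' c1 u1 \<union> X"
    using spec oout by (auto simp: X_def linking_crossings_def c'_def u'_def crossings_def)
  then have n2: "card (linking_crossings D' c' u') = card (linking_crossings T' c1 u1) + card X"
    using finX dis(2) by (simp add: card_Un_disjoint)
  have "odd (card (linking_crossings D' c' u'))"
    using cu(2) c1(3) unfolding n1 n2 by simp
  with col' show ?thesis unfolding linked_def by blast
qed

lemma transfers_move:
  assumes "transfers T T'" "transfers T' T"
    and "local_move T T' D D'" "marked_graph_diagram D" "marked_graph_diagram D'"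
  shows "linked D' \<longleftrightarrow> linked D"
proof -
  obtain H g where H: "homeomorphism UNIV UNIV (H 1) g" "replaced_via (H 1) T T' D D'"
    using assms(3) by (auto simp: local_move_def elim!: ambient_isotopy_homeomorphism)
  have fin: "finite (crossings (transform (H 1) D))" "finite (crossings (transform (H 1) D'))"
    using assms(4,5) by (auto simp: crossings_transform[OF H(1)] marked_graph_diagram_def)
  show ?thesis
    using transfers_linked[OF assms(1), of "transform (H 1) D" "transform (H 1) D'"]
      transfers_linked[OF assms(2), of "transform (H 1) D'" "transform (H 1) D"] H(2) fin
    unfolding replaced_via_def linked_transform_iff[OF H(1)] by metis
qed

section \<open>Colourings of a curve cut into polygonal pieces\<close>

lemma closed_polyline: "closed (polyline l)"
  by (induction l rule: polyline.induct) auto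

lemma hd_in_polyline: "l \<noteq> [] \<Longrightarrow> hd l \<in> polyline l"
  by (induction l rule: polyline.induct) auto

lemma connected_polyline: "connected (polyline l)"
proof (induction l rule: polyline.induct)
  case (3 p q ps)
  have "q \<in> closed_segment p q \<inter> polyline (q # ps)"
    using hd_in_polyline[of "q # ps"] by auto
  then show ?case using 3 by (auto intro!: connected_Un)
qed auto

lemma polyline_islimpt:
  assumes "p \<in> polyline (a # b # l)" "a \<noteq> b"
  shows "p islimpt polyline (a # b # l)"
proof (rule connected_imp_perfect[OF connected_polyline assms(1)])
  have "a \<in> polyline (a # b # l)" "b \<in> polyline (a # b # l)" by auto
  with assms(2) show "polyline (a # b # l) \<noteq> {x}" for x by (metis singletonD)
qed

lemma eventually_within_unique:
  assumes "p islimpt S" "\<forall>\<^sub>F q in at p within S. f q = a" "\<forall>\<^sub>F q in at p within S. f q = b"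
  shows "a = b"
proof -
  have "\<forall>\<^sub>F q in at p within S. a = b" using assms(2,3) by eventually_elim simp
  then show ?thesis using assms(1) by (simp add: trivial_limit_within eventually_const_iff)
qed

text \<open>The value of \<open>c\<close> at a point says nothing about the germ there, so the
  limiting colours \<open>k p\<close> are compared instead. At a point \<open>q\<close> near
  \<open>p\<close> the colour is \<open>k p\<close> on a whole punctured neighbourhood, and since
  \<open>q\<close> is not isolated this forces \<open>k q = k p\<close>. Connectedness finishes the
  argument.\<close>

lemma germwise_constant_imp_constant:
  fixes S :: "'a::t1_space set"
  assumes S: "connected S" "\<And>p. p \<in> S \<Longrightarrow> p islimpt S"
    and c: "\<And>p. p \<in> S \<Longrightarrow> \<exists>k. \<forall>\<^sub>F q in at p within S. c q = k"
  shows "\<exists>k. \<forall>p\<in>S. \<forall>\<^sub>F q in at p within S. c q = k"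
proof (cases "S = {}")
  case False
  define k where "k p = (SOME k. \<forall>\<^sub>F q in at p within S. c q = k)" for p
  have k: "\<forall>\<^sub>F q in at p within S. c q = k p" if "p \<in> S" for p
    unfolding k_def by (rule someI_ex[OF c[OF that]])
  have loc: "\<forall>\<^sub>F q in at p within S. k p = k q" if p: "p \<in> S" for p
  proof -
    obtain N where N: "open N" "p \<in> N" "\<And>q. q \<in> N \<Longrightarrow> q \<noteq> p \<Longrightarrow> q \<in> S \<Longrightarrow> c q = k p"
      using k[OF p] unfolding eventually_at_topological by blast
    have "k p = k q" if q: "q \<in> N" "q \<noteq> p" "q \<in> S" for q
    proof -
      have "open (N - {p})" "q \<in> N - {p}" using N(1) q by auto
      moreover have "\<forall>r\<in>N - {p}. r \<noteq> q \<longrightarrow> r \<in> S \<longrightarrow> c r = k p" using N(3) by auto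
      ultimately have "\<forall>\<^sub>F r in at q within S. c r = k p"
        unfolding eventually_at_topological by blast
      then show ?thesis using eventually_within_unique[OF S(2)[OF q(3)] _ k[OF q(3)]] by blast
    qed
    then show ?thesis using N(1,2) unfolding eventually_at_topological by blast
  qed
  obtain a where a: "a \<in> S" using False by auto
  have "k a = k p" if "p \<in> S" for p
    using connected_local_const[OF S(1) a that] loc by blast
  then show ?thesis using k by (intro exI[of _ "k a"]) auto
qed auto

lemma colouringD:
  assumes "colouring D c u"
  shows colouring_regular:
      "p \<in> curve D - crossings D - vertices D \<Longrightarrow> \<forall>\<^sub>F q in at p within curve D. c q = c p"
    and colouring_over: "p \<in> crossings D \<Longrightarrow> \<forall>\<^sub>F q in over D p. c q = c p"
    and colouring_under: "p \<in> crossings D \<Longrightarrow>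
      \<exists>A. over D p = at p within A \<and> (\<forall>\<^sub>F q in at p within (curve D - A). c q = u p)"
    and colouring_vertex: "p \<in> vertices D \<Longrightarrow> vertex_colouring (curve D) p c"
proof -
  have "coloured_at D c u p" using assms unfolding colouring_def by blast
  then show "p \<in> curve D - crossings D - vertices D \<Longrightarrow> \<forall>\<^sub>F q in at p within curve D. c q = c p"
    "p \<in> crossings D \<Longrightarrow> \<forall>\<^sub>F q in over D p. c q = c p"
    "p \<in> crossings D \<Longrightarrow>
      \<exists>A. over D p = at p within A \<and> (\<forall>\<^sub>F q in at p within (curve D - A). c q = u p)"
    "p \<in> vertices D \<Longrightarrow> vertex_colouring (curve D) p c"
    unfolding coloured_at_def by blast+
qed

text \<open>A piece may run through crossings but must stop at vertices. The finite set
  \<open>N\<close> contains all points that pieces share. The two strands of a crossing are required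
  to be different pieces, and the four ends at a vertex are different as well because the rays are
  disjoint, so a loop based at such a point has to be cut at an auxiliary point of
  \<open>N\<close>.\<close>

locale tangle =
  fixes T :: diagram and ps :: "plane list list" and N :: "plane set"
    and ov un :: "plane \<Rightarrow> nat" and jn :: "plane \<Rightarrow> plane \<Rightarrow> nat"
  assumes curve_eq: "curve T = (\<Union>i<length ps. polyline (ps ! i))"
    and proper: "\<And>i. i < length ps \<Longrightarrow> \<exists>a b l. ps ! i = a # b # l \<and> a \<noteq> b"
    and meet: "\<And>i j. i < length ps \<Longrightarrow> j < i \<Longrightarrow> polyline (ps ! i) \<inter> polyline (ps ! j) \<subseteq> N"
    and finite_N: "finite N"
    and special: "crossings T \<subseteq> N" "vertices T \<subseteq> N" "crossings T \<inter> vertices T = {}"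
    and crossing: "\<And>p. p \<in> crossings T \<Longrightarrow> ov p < length ps \<and> un p < length ps \<and> ov p \<noteq> un p \<and>
        (\<forall>i<length ps. p \<in> polyline (ps ! i) \<longleftrightarrow> i = ov p \<or> i = un p) \<and>
        over T p = at p within polyline (ps ! ov p)"
    and vertex: "\<And>p. p \<in> vertices T \<Longrightarrow>
        (\<forall>d\<in>axes. jn p d < length ps) \<and> (\<forall>i<length ps. p \<in> polyline (ps ! i) \<longleftrightarrow> i \<in> jn p ` axes) \<and>
        (\<exists>U W h g. cross_chart p (curve T) U W h g \<and>
           (\<forall>d\<in>axes. \<forall>\<^sub>F q in at p within polyline (ps ! jn p d). h q \<in> ray d))"
begin

definition consistent :: "(nat \<Rightarrow> colour) \<Rightarrow> bool" where
  "consistent k \<longleftrightarrow>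
     (\<forall>p\<in>N - crossings T - vertices T. \<forall>i<length ps. \<forall>j<length ps.
        p \<in> polyline (ps ! i) \<longrightarrow> p \<in> polyline (ps ! j) \<longrightarrow> k i = k j) \<and>
     (\<forall>p\<in>vertices T. balanced (\<lambda>d. k (jn p d)))"

definition represents :: "(plane \<Rightarrow> colour) \<Rightarrow> (plane \<Rightarrow> colour) \<Rightarrow> (nat \<Rightarrow> colour) \<Rightarrow> bool" where
  "represents c u k \<longleftrightarrow>
     (\<forall>i<length ps. \<forall>p\<in>polyline (ps ! i) - crossings T - vertices T. c p = k i) \<and>
     (\<forall>p\<in>crossings T. c p = k (ov p) \<and> u p = k (un p))"

lemma piece_islimpt: "i < length ps \<Longrightarrow> p \<in> polyline (ps ! i) \<Longrightarrow> p islimpt polyline (ps ! i)"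
  using proper[of i] polyline_islimpt by metis

lemma piece_germ_le: "i < length ps \<Longrightarrow> at p within polyline (ps ! i) \<le> at p within curve T"
  unfolding curve_eq by (intro at_le) auto

lemma piece_crossing: "p \<in> crossings T \<Longrightarrow> p \<in> polyline (ps ! ov p) \<and> p \<in> polyline (ps ! un p)"
  using crossing by blast

lemma piece_vertex: "p \<in> vertices T \<Longrightarrow> d \<in> axes \<Longrightarrow> p \<in> polyline (ps ! jn p d)"
  using vertex by blast

lemma eventually_not_special: "\<forall>\<^sub>F q in at p within A. q \<notin> N"
proof -
  have "\<forall>\<^sub>F q in at p within A. q \<notin> N - {p}"
    using finite_N finite_imp_closed[of "N - {p}"]
    by (intro eventually_at_topological[THEN iffD2] exI[of _ "- (N - {p})"])
      (auto simp del: Compl_Diff_eq simp: open_Compl)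
  moreover have "\<forall>\<^sub>F q in at p within A. q \<noteq> p" by (simp add: eventually_at_filter)
  ultimately show ?thesis by eventually_elim auto
qed

text \<open>The two pieces through the crossing meet only in the finite set \<open>N\<close>, so
  close to \<open>p\<close> the under piece avoids the over piece. This identifies the colour
  \<open>u p\<close>, which is defined by a complement, with the colour of a piece.\<close>

lemma under_germ_le:
  assumes "p \<in> crossings T"
  shows "at p within polyline (ps ! un p) \<le> at p within (curve T - polyline (ps ! ov p))"
proof -
  have ij: "ov p < length ps" "un p < length ps" "ov p \<noteq> un p" using crossing[OF assms] by auto
  then have sub: "polyline (ps ! ov p) \<inter> polyline (ps ! un p) \<subseteq> N"
    using meet[of "ov p" "un p"] meet[of "un p" "ov p"] by (cases "ov p" "un p" rule: linorder_cases) auto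
  have "\<forall>\<^sub>F q in at p within polyline (ps ! un p). q \<in> curve T - polyline (ps ! ov p)"
    using eventually_conj[OF eventually_not_special[of p "polyline (ps ! un p)"]
        eventually_in_at_within[of "polyline (ps ! un p)" p]]
    unfolding curve_eq by (rule eventually_mono) (use ij sub in auto)
  then have "\<forall>\<^sub>F q in nhds p. q \<noteq> p \<longrightarrow> q \<in> polyline (ps ! un p) \<longrightarrow> q \<in> curve T - polyline (ps ! ov p)"
    by (simp add: eventually_at_filter)
  then show ?thesis
    unfolding le_filter_def eventually_at_filter
    by (auto elim: eventually_elim2)
qed

text \<open>At regular points, crossings and vertices alike the colour has a constant germ along
  each piece through the point, so it is constant along the piece. Uniqueness of that constant then
  turns the local conditions into equations between the colours of the pieces.\<close>

lemma colouring_imp_represented: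
  assumes col: "colouring T c u"
  shows "\<exists>k. consistent k \<and> represents c u k"
proof -
  have "\<exists>\<kappa>. \<forall>\<^sub>F q in at p within polyline (ps ! i). c q = \<kappa>"
    if i: "i < length ps" and p: "p \<in> polyline (ps ! i)" for i p
  proof -
    consider "p \<in> crossings T" | "p \<in> vertices T" | "p \<in> curve T - crossings T - vertices T"
      using i p curve_eq by blast
    then show ?thesis
    proof cases
      case 1
      obtain A where A: "\<forall>\<^sub>F q in over T p. c q = c p" "over T p = at p within A"
          "\<forall>\<^sub>F q in at p within (curve T - A). c q = u p"
        using colouring_over[OF col 1] colouring_under[OF col 1] by blast
      have ov: "over T p = at p within polyline (ps ! ov p)" "i = ov p \<or> i = un p"
        using crossing[OF 1] i p by blast+
      then have "at p within (curve T - A) = at p within (curve T - polyline (ps ! ov p))"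
        using A(2) by (intro germ_Diff_cong) simp
      then have "\<forall>\<^sub>F q in at p within polyline (ps ! un p). c q = u p"
        using A(3) under_germ_le[OF 1] by (simp add: filter_leD)
      with ov A(1) show ?thesis by auto
    next
      case 2
      obtain U W h g where ch: "cross_chart p (curve T) U W h g"
          "\<forall>d\<in>axes. \<forall>\<^sub>F q in at p within polyline (ps ! jn p d). h q \<in> ray d"
        using vertex[OF 2] by blast
      obtain k where k: "\<forall>d\<in>axes. \<forall>\<^sub>F q in at p within curve T. h q \<in> ray d \<longrightarrow> c q = k d"
        using vertex_colouring_any_chart[OF colouring_vertex[OF col 2] ch(1)] by blast
      obtain d where d: "d \<in> axes" "i = jn p d" using vertex[OF 2] i p by blast
      have "\<forall>\<^sub>F q in at p within polyline (ps ! i). h q \<in> ray d \<longrightarrow> c q = k d"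
        using k d filter_leD[OF piece_germ_le[OF i]] by blast
      moreover have "\<forall>\<^sub>F q in at p within polyline (ps ! i). h q \<in> ray d" using ch(2) d by auto
      ultimately have "\<forall>\<^sub>F q in at p within polyline (ps ! i). c q = k d"
        by eventually_elim auto
      then show ?thesis by blast
    next
      case 3
      then have "\<forall>\<^sub>F q in at p within polyline (ps ! i). c q = c p"
        by (intro filter_leD[OF piece_germ_le[OF i]] colouring_regular[OF col])
      then show ?thesis by blast
    qed
  qed
  then have "\<forall>i\<in>{..<length ps}. \<exists>\<kappa>. \<forall>p\<in>polyline (ps ! i). \<forall>\<^sub>F q in at p within polyline (ps ! i). c q = \<kappa>"
    using germwise_constant_imp_constant[OF connected_polyline piece_islimpt] by blast
  then obtain k where k: "\<And>i p. i < length ps \<Longrightarrow> p \<in> polyline (ps ! i) \<Longrightarrow>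
      \<forall>\<^sub>F q in at p within polyline (ps ! i). c q = k i"
    using bchoice by (metis lessThan_iff)
  have uniq: "\<kappa> = k i" if "i < length ps" "p \<in> polyline (ps ! i)"
      "\<forall>\<^sub>F q in at p within polyline (ps ! i). c q = \<kappa>" for i p \<kappa>
    by (rule eventually_within_unique[OF piece_islimpt[OF that(1,2)] that(3) k[OF that(1,2)]])
  have reg: "c p = k i" if "i < length ps" "p \<in> polyline (ps ! i) - crossings T - vertices T" for i p
  proof -
    have "p \<in> curve T - crossings T - vertices T" using that curve_eq by blast
    then have "\<forall>\<^sub>F q in at p within curve T. c q = c p"
      by (rule colouring_regular[OF col])
    then have "\<forall>\<^sub>F q in at p within polyline (ps ! i). c q = c p"
      by (rule filter_leD[OF piece_germ_le[OF that(1)]])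
    then show ?thesis using that by (intro uniq) auto
  qed
  have cr: "c p = k (ov p) \<and> u p = k (un p)" if p: "p \<in> crossings T" for p
  proof -
    obtain A where A: "\<forall>\<^sub>F q in over T p. c q = c p" "over T p = at p within A"
        "\<forall>\<^sub>F q in at p within (curve T - A). c q = u p"
      using colouring_over[OF col p] colouring_under[OF col p] by blast
    have ov: "over T p = at p within polyline (ps ! ov p)" using crossing[OF p] by blast
    then have "at p within (curve T - A) = at p within (curve T - polyline (ps ! ov p))"
      using A(2) by (intro germ_Diff_cong) simp
    then have "\<forall>\<^sub>F q in at p within polyline (ps ! un p). c q = u p"
      using A(3) under_germ_le[OF p] by (simp add: filter_leD)
    then show ?thesis
      using uniq[of "ov p" p "c p"] uniq[of "un p" p "u p"] A(1) ov crossing[OF p] piece_crossing[OF p] by auto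
  qed
  have vt: "balanced (\<lambda>d. k (jn p d))" if p: "p \<in> vertices T" for p
  proof -
    obtain U W h g where ch: "cross_chart p (curve T) U W h g"
        "\<forall>d\<in>axes. \<forall>\<^sub>F q in at p within polyline (ps ! jn p d). h q \<in> ray d"
      using vertex[OF p] by blast
    obtain k' where k': "balanced k'" "\<forall>d\<in>axes. \<forall>\<^sub>F q in at p within curve T. h q \<in> ray d \<longrightarrow> c q = k' d"
      using vertex_colouring_any_chart[OF colouring_vertex[OF col p] ch(1)] by blast
    have "k' d = k (jn p d)" if d: "d \<in> axes" for d
    proof -
      have i: "jn p d < length ps" using vertex[OF p] d by blast
      have "\<forall>\<^sub>F q in at p within polyline (ps ! jn p d). h q \<in> ray d \<longrightarrow> c q = k' d"
        using k' d filter_leD[OF piece_germ_le[OF i]] by blast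
      moreover have "\<forall>\<^sub>F q in at p within polyline (ps ! jn p d). h q \<in> ray d" using ch(2) d by auto
      ultimately have "\<forall>\<^sub>F q in at p within polyline (ps ! jn p d). c q = k' d"
        by eventually_elim auto
      then show ?thesis by (rule uniq[OF i piece_vertex[OF p d]])
    qed
    then show ?thesis using k'(1) by (simp add: balanced_iff axes_def)
  qed
  have "consistent k"
    unfolding consistent_def
  proof (intro conjI ballI allI impI)
    fix p i j
    assume *: "p \<in> N - crossings T - vertices T" "i < length ps" "j < length ps"
      "p \<in> polyline (ps ! i)" "p \<in> polyline (ps ! j)"
    have "c p = k i" "c p = k j" using * by (auto intro!: reg)
    then show "k i = k j" by simp
  qed (rule vt)
  moreover have "represents c u k"
    unfolding represents_def
  proof (intro conjI allI ballI impI)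
    show "c p = k i" if "i < length ps" "p \<in> polyline (ps ! i) - crossings T - vertices T" for i p
      using that by (rule reg)
  qed (simp_all add: cr)
  ultimately show ?thesis by blast
qed

lemma represented_colouring:
  assumes k: "consistent k"
  shows "\<exists>c u. colouring T c u \<and> represents c u k"
proof -
  \<comment> \<open>Away from crossings and vertices the chosen piece does not affect the value: two
    pieces through such a point meet there in \<open>N\<close> and have the same colour by
    \<open>consistent\<close>.\<close>
  define c where "c p = (if p \<in> crossings T then k (ov p)
    else k (SOME i. i < length ps \<and> p \<in> polyline (ps ! i)))" for p
  define u where "u p = k (un p)" for p
  have reg: "c p = k i" if i: "i < length ps" and p: "p \<in> polyline (ps ! i)" "p \<notin> crossings T" "p \<notin> vertices T" for i p
  proof -
    define j where "j = (SOME i. i < length ps \<and> p \<in> polyline (ps ! i))"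
    have j: "j < length ps \<and> p \<in> polyline (ps ! j)"
      unfolding j_def by (rule someI_ex) (use i p in blast)
    have "k j = k i"
    proof (cases "i = j")
      case False
      then have "p \<in> N" using meet[of i j] meet[of j i] i j p by (cases i j rule: linorder_cases) auto
      then show ?thesis using k i j p unfolding consistent_def by blast
    qed auto
    then show ?thesis using p by (simp add: c_def j_def)
  qed
  have ev: "\<forall>\<^sub>F q in at p within polyline (ps ! i). c q = k i" if "i < length ps" for p i
    using eventually_not_special[of p "polyline (ps ! i)"] eventually_in_at_within[of "polyline (ps ! i)" p]
    by eventually_elim (use reg special that in blast)
  have evC: "\<forall>\<^sub>F q in at p within curve T. P q"
    if "\<And>i. i < length ps \<Longrightarrow> p \<in> polyline (ps ! i) \<Longrightarrow> \<forall>\<^sub>F q in at p within polyline (ps ! i). P q" for p P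
    unfolding curve_eq eventually_at_within_UN[OF finite_lessThan]
    using that at_within_eq_bot[OF closed_polyline] by (metis eventually_bot lessThan_iff)
  have "coloured_at T c u p" for p
    unfolding coloured_at_def
  proof (intro conjI impI)
    assume p: "p \<in> curve T - crossings T - vertices T"
    show "\<forall>\<^sub>F q in at p within curve T. c q = c p"
      by (rule evC) (use p reg ev in auto)
  next
    assume p: "p \<in> crossings T"
    have cr: "ov p < length ps" "un p < length ps" "over T p = at p within polyline (ps ! ov p)"
       "\<And>i. i < length ps \<Longrightarrow> p \<in> polyline (ps ! i) \<Longrightarrow> i = ov p \<or> i = un p"
      using crossing[OF p] by auto
    show "\<forall>\<^sub>F q in over T p. c q = c p"
      using cr(3) ev[OF cr(1)] p by (simp add: c_def)
    have "\<forall>\<^sub>F q in at p within curve T. q \<notin> polyline (ps ! ov p) \<longrightarrow> c q = u p"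
    proof (rule evC)
      fix i assume "i < length ps" "p \<in> polyline (ps ! i)"
      then have "i = ov p \<or> i = un p" using cr(4) by blast
      then show "\<forall>\<^sub>F q in at p within polyline (ps ! i). q \<notin> polyline (ps ! ov p) \<longrightarrow> c q = u p"
      proof
        assume "i = un p"
        then show ?thesis using ev[OF cr(2), of p] by (auto simp: u_def elim: eventually_mono)
      next
        assume "i = ov p"
        then show ?thesis using eventually_in_at_within[of "polyline (ps ! i)" p] by (auto elim: eventually_mono)
      qed
    qed
    then have "\<forall>\<^sub>F q in at p within (curve T - polyline (ps ! ov p)). c q = u p"
      by (auto simp: eventually_at_filter elim: eventually_mono)
    with cr(3) show "\<exists>A. over T p = at p within A \<and> (\<forall>\<^sub>F q in at p within curve T - A. c q = u p)"
      by blast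
  next
    assume p: "p \<in> vertices T"
    obtain U W h g where ch: "cross_chart p (curve T) U W h g"
        "\<forall>d\<in>axes. \<forall>\<^sub>F q in at p within polyline (ps ! jn p d). h q \<in> ray d"
      using vertex[OF p] by blast
    have "\<forall>\<^sub>F q in at p within curve T. h q \<in> ray d \<longrightarrow> c q = k (jn p d)" if d: "d \<in> axes" for d
    proof (rule evC)
      fix i assume i: "i < length ps" "p \<in> polyline (ps ! i)"
      then obtain e where e: "e \<in> axes" "i = jn p e" using vertex[OF p] by blast
      have "\<forall>\<^sub>F q in at p within polyline (ps ! i). h q \<in> ray e" using ch(2) e by blast
      then show "\<forall>\<^sub>F q in at p within polyline (ps ! i). h q \<in> ray d \<longrightarrow> c q = k (jn p d)"
        using ev[OF i(1), of p] by eventually_elim (use e d ray_disjoint in blast)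
    qed
    then show "vertex_colouring (curve T) p c"
      using ch(1) k p unfolding vertex_colouring_def consistent_def by blast
  qed
  moreover have "represents c u k"
    unfolding represents_def using reg by (auto simp: c_def u_def)
  ultimately show ?thesis unfolding colouring_def by blast
qed

definition weight :: "(nat \<Rightarrow> colour) \<Rightarrow> nat" where
  "weight k = card {p \<in> crossings T. k (ov p) = (True, True) \<and> k (un p) = (False, True)}"

lemma weight_eq:
  assumes "represents c u k"
  shows "card (linking_crossings T c u) = weight k"
proof -
  have "linking_crossings T c u = {p \<in> crossings T. k (ov p) = (True, True) \<and> k (un p) = (False, True)}"
    using assms by (auto simp: linking_crossings_def represents_def)
  then show ?thesis by (simp add: weight_def)
qed

lemma linked_iff: "linked T \<longleftrightarrow> (\<exists>k. consistent k \<and> odd (weight k))"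
  unfolding linked_def using colouring_imp_represented represented_colouring weight_eq by metis

end

text \<open>The last clause of the hypothesis compares boundary colours piece by piece, which
  suffices because off crossings and vertices a represented colouring takes the colour of any piece
  through the point.\<close>

lemma transfersI:
  assumes "tangle T ps N ov un jn" "tangle T' ps' N' ov' un' jn'"
    and N: "crossings T \<union> vertices T \<union> crossings T' \<union> vertices T' \<subseteq> interior square"
    and k: "\<And>k. tangle.consistent T ps N jn k \<Longrightarrow> \<exists>k'. tangle.consistent T' ps' N' jn' k' \<and>
      (even (tangle.weight T' ov' un' k') \<longleftrightarrow> even (tangle.weight T ov un k)) \<and>
      (\<forall>i<length ps'. \<forall>p\<in>polyline (ps' ! i) \<inter> frontier square.
          \<exists>j<length ps. p \<in> polyline (ps ! j) \<and> k' i = k j)"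
  shows "transfers T T'"
proof -
  interpret A: tangle T ps N ov un jn by fact
  interpret B: tangle T' ps' N' ov' un' jn' by fact
  have fr: "p \<notin> crossings T" "p \<notin> vertices T" "p \<notin> crossings T'" "p \<notin> vertices T'" if "p \<in> frontier square" for p
    using N that by (auto simp: frontier_def)
  have "curve T' \<inter> frontier square \<subseteq> curve T"
  proof
    fix p assume p: "p \<in> curve T' \<inter> frontier square"
    \<comment> \<open>The zero colouring is always consistent; applying the hypothesis to it
      extracts the geometric content of the boundary clause.\<close>
    have "A.consistent (\<lambda>_. (False, False))" by (auto simp: A.consistent_def balanced_iff)
    from k[OF this] p show "p \<in> curve T"
      unfolding A.curve_eq B.curve_eq by blast
  qed
  moreover have "\<exists>c' u'. colouring T' c' u' \<and>
        (\<forall>p\<in>curve T' \<inter> frontier square. c' p = c p) \<and>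
        (even (card (linking_crossings T' c' u')) \<longleftrightarrow> even (card (linking_crossings T c u)))"
    if col: "colouring T c u" for c u
  proof -
    obtain \<kappa> where \<kappa>: "A.consistent \<kappa>" "A.represents c u \<kappa>"
      using A.colouring_imp_represented[OF col] by blast
    obtain \<kappa>' where \<kappa>': "B.consistent \<kappa>'" "even (B.weight \<kappa>') \<longleftrightarrow> even (A.weight \<kappa>)"
      "\<And>i p. i < length ps' \<Longrightarrow> p \<in> polyline (ps' ! i) \<inter> frontier square \<Longrightarrow>
          \<exists>j<length ps. p \<in> polyline (ps ! j) \<and> \<kappa>' i = \<kappa> j"
      using k[OF \<kappa>(1)] by blast
    obtain c' u' where c': "colouring T' c' u'" "B.represents c' u' \<kappa>'"
      using B.represented_colouring[OF \<kappa>'(1)] by blast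
    have "c' p = c p" if p: "p \<in> curve T' \<inter> frontier square" for p
    proof -
      obtain i where i: "i < length ps'" "p \<in> polyline (ps' ! i)" using p B.curve_eq by auto
      then obtain j where j: "j < length ps" "p \<in> polyline (ps ! j)" "\<kappa>' i = \<kappa> j"
        using \<kappa>'(3)[of i p] p by auto
      have "c' p = \<kappa>' i" using c'(2) i fr p unfolding B.represents_def by blast
      moreover have "c p = \<kappa> j" using \<kappa>(2) j fr p unfolding A.represents_def by blast
      ultimately show ?thesis using j by simp
    qed
    with c' \<kappa>'(2) show ?thesis
      using A.weight_eq[OF \<kappa>(2)] B.weight_eq[OF c'(2)] by (intro exI[of _ c'] exI[of _ u']) simp
  qed
  ultimately show ?thesis using N unfolding transfers_def by blast
qed

section \<open>Polygonal pictures\<close>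

definition line :: "plane \<Rightarrow> plane \<Rightarrow> plane set" where
  "line p d = {p + t *\<^sub>R d |t. True}"

definition half_line :: "plane \<Rightarrow> plane \<Rightarrow> plane set" where
  "half_line p d = {p + t *\<^sub>R d |t. 0 < t}"

definition indep :: "plane \<Rightarrow> plane \<Rightarrow> bool" where
  "indep d e \<longleftrightarrow> fst d * snd e \<noteq> snd d * fst e"

text \<open>Cramer's rule for the coordinates of \<open>q - p\<close> in the basis \<open>d\<close>,
  \<open>e\<close>.\<close>

definition coords :: "plane \<Rightarrow> plane \<Rightarrow> plane \<Rightarrow> plane \<Rightarrow> plane" where
  "coords p d e q = (let v = q - p; D = fst d * snd e - snd d * fst e in
     ((fst v * snd e - snd v * fst e) / D, (fst d * snd v - snd d * fst v) / D))"

text \<open>Collinearity together with the bounding box. For numerical end points all these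
  conditions are linear in \<open>x\<close> and \<open>y\<close>, so that inclusions and
  intersections of explicit polygons become linear arithmetic.\<close>

lemma mem_closed_segment_plane:
  "(x, y) \<in> closed_segment (a, b) (c, d) \<longleftrightarrow>
     (x - a) * (d - b) = (y - b) * (c - a) \<and> min a c \<le> x \<and> x \<le> max a c \<and> min b d \<le> y \<and> y \<le> max b d"
  for x y a b c d :: real
proof
  assume "(x, y) \<in> closed_segment (a, b) (c, d)"
  then obtain u where u: "0 \<le> u" "u \<le> 1" "x = (1 - u) * a + u * c" "y = (1 - u) * b + u * d"
    by (auto simp: in_segment)
  have x: "x \<in> closed_segment a c" and y: "y \<in> closed_segment b d"
    using u by (auto simp: in_segment)
  have "(x - a) * (d - b) = (y - b) * (c - a)" unfolding u by algebra
  with x y show "(x - a) * (d - b) = (y - b) * (c - a) \<and>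
      min a c \<le> x \<and> x \<le> max a c \<and> min b d \<le> y \<and> y \<le> max b d"
    by (auto simp: closed_segment_eq_real_ivl split: if_splits)
next
  assume *: "(x - a) * (d - b) = (y - b) * (c - a) \<and>
      min a c \<le> x \<and> x \<le> max a c \<and> min b d \<le> y \<and> y \<le> max b d"
  have xs: "x \<in> closed_segment a c" and ys: "y \<in> closed_segment b d"
    using * by (auto simp: closed_segment_eq_real_ivl min_def max_def split: if_splits)
  show "(x, y) \<in> closed_segment (a, b) (c, d)"
  proof (cases "a = c")
    case True
    from ys obtain u where "0 \<le> u" "u \<le> 1" "y = (1 - u) * b + u * d" by (auto simp: in_segment)
    moreover have "x = a" using xs True by simp
    ultimately show ?thesis using True by (auto simp: in_segment algebra_simps intro!: exI[of _ u])
  next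
    case False
    from xs obtain u where u: "0 \<le> u" "u \<le> 1" "x = (1 - u) * a + u * c" by (auto simp: in_segment)
    have "(c - a) * (y - ((1 - u) * b + u * d)) = 0"
      using * unfolding u(3) by (simp add: algebra_simps)
    then have "y = (1 - u) * b + u * d" using False by simp
    then show ?thesis using u by (auto simp: in_segment)
  qed
qed

lemma half_line_islimpt:
  assumes "d \<noteq> 0"
  shows "p islimpt half_line p d"
  unfolding islimpt_approachable
proof (intro allI impI)
  fix e :: real assume "e > 0"
  define q where "q = p + (e / (2 * norm d)) *\<^sub>R d"
  have "q \<in> half_line p d" using \<open>e > 0\<close> assms unfolding half_line_def q_def
    by (auto intro!: exI[of _ "e / (2 * norm d)"])
  moreover have "q \<noteq> p" "dist q p < e" using \<open>e > 0\<close> assms by (auto simp: q_def dist_norm)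
  ultimately show "\<exists>x'\<in>half_line p d. x' \<noteq> p \<and> dist x' p < e" by blast
qed

lemma half_line_germ_neq_bot: "d \<noteq> 0 \<Longrightarrow> at p within half_line p d \<noteq> bot"
  using half_line_islimpt trivial_limit_within by blast

lemma half_line_subset_line: "half_line p d \<subseteq> line p d"
  by (auto simp: half_line_def line_def)

lemma line_germ_neq_bot: "d \<noteq> 0 \<Longrightarrow> at p within line p d \<noteq> bot"
  using half_line_germ_neq_bot at_le[OF half_line_subset_line] bot.extremum_uniqueI by metis

lemma line_germ_split: "at p within line p d = at p within (half_line p d \<union> half_line p (- d))"
proof (rule germ_eqI, rule always_eventually, intro allI impI)
  fix q assume "q \<noteq> p"
  show "q \<in> line p d \<longleftrightarrow> q \<in> half_line p d \<union> half_line p (- d)"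
  proof
    assume "q \<in> line p d"
    then obtain t where t: "q = p + t *\<^sub>R d" by (auto simp: line_def)
    then have "t \<noteq> 0" using \<open>q \<noteq> p\<close> by auto
    then consider "t > 0" | "- t > 0" by linarith
    then show "q \<in> half_line p d \<union> half_line p (- d)"
    proof cases
      case 1
      then show ?thesis using t unfolding half_line_def by blast
    next
      case 2
      moreover have "q = p + (- t) *\<^sub>R (- d)" using t by simp
      ultimately show ?thesis unfolding half_line_def by blast
    qed
  next
    assume "q \<in> half_line p d \<union> half_line p (- d)"
    then show "q \<in> line p d"
      by (auto simp: half_line_def line_def) (metis scaleR_minus_left uminus_add_conv_diff add.commute)
  qed
qed

lemma half_line_scale:
  assumes "0 < s"
  shows "half_line p (s *\<^sub>R d) = half_line p d"
proof
  show "half_line p (s *\<^sub>R d) \<subseteq> half_line p d"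
  proof
    fix q assume "q \<in> half_line p (s *\<^sub>R d)"
    then obtain t where "0 < t" "q = p + (t * s) *\<^sub>R d" by (auto simp: half_line_def)
    moreover have "0 < t * s" using \<open>0 < t\<close> assms by simp
    ultimately show "q \<in> half_line p d" unfolding half_line_def by blast
  qed
  show "half_line p d \<subseteq> half_line p (s *\<^sub>R d)"
  proof
    fix q assume "q \<in> half_line p d"
    then obtain t where "0 < t" "q = p + (t / s) *\<^sub>R s *\<^sub>R d" using assms by (auto simp: half_line_def)
    moreover have "0 < t / s" using \<open>0 < t\<close> assms by simp
    ultimately show "q \<in> half_line p (s *\<^sub>R d)" unfolding half_line_def by blast
  qed
qed

lemma half_line_eq:
  assumes "a * d = b * c" "a * c + b * d > 0"
  shows "half_line p (a, b) = half_line p (c, d)"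
proof -
  \<comment> \<open>The ratio of the two parallel vectors, computed by projecting the first onto the
    second.\<close>
  define s where "s = (a * c + b * d) / (c * c + d * d)"
  have nz: "c * c + d * d > 0" using assms(2) by (smt (verit, best) mult_eq_0_iff not_sum_squares_lt_zero sum_squares_eq_zero_iff)
  have "(a * c + b * d) * c = a * (c * c + d * d)" "(a * c + b * d) * d = b * (c * c + d * d)"
    using assms(1) by algebra+
  then have "s * c = a" "s * d = b" using nz unfolding s_def by (auto simp: divide_simps)
  then have "(a, b) = s *\<^sub>R (c, d)" by simp
  moreover have "s > 0" using assms(2) nz by (simp add: s_def)
  ultimately show ?thesis using half_line_scale by metis
qed

lemma line_germ_eq:
  assumes "a * d = b * c" "(a, b) \<noteq> 0" "(c, d) \<noteq> 0"
  shows "at p within line p (a, b) = at p within line p (c, d)"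
proof -
  have "a * c + b * d \<noteq> 0"
  proof
    assume 0: "a * c + b * d = 0"
    \<comment> \<open>Lagrange's identity: two nonzero vectors cannot be both parallel and
      orthogonal.\<close>
    have "(a * a + b * b) * (c * c + d * d) = (a * c + b * d)\<^sup>2 + (a * d - b * c)\<^sup>2"
      by (simp add: power2_eq_square algebra_simps)
    then have "(a * a + b * b) * (c * c + d * d) = 0" using 0 assms(1) by simp
    then show False using assms(2,3) by (auto simp: zero_prod_def)
  qed
  then consider "a * c + b * d > 0" | "a * (- c) + b * (- d) > 0" by fastforce
  then show ?thesis
  proof cases
    case 1
    then have "half_line p (a, b) = half_line p (c, d)" "half_line p (- a, - b) = half_line p (- c, - d)"
      using assms(1) by (auto intro!: half_line_eq)
    then show ?thesis by (simp add: line_germ_split)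
  next
    case 2
    then have "half_line p (a, b) = half_line p (- c, - d)" "half_line p (- a, - b) = half_line p (c, d)"
      using assms(1) by (auto intro!: half_line_eq)
    then show ?thesis by (simp add: line_germ_split Un_commute)
  qed
qed

lemma segment_germ_left:
  assumes "a \<noteq> b"
  shows "at a within closed_segment a b = at a within half_line a (b - a)"
proof (rule at_within_nhd[of a "ball a (norm (b - a))"])
  show "closed_segment a b \<inter> ball a (norm (b - a)) - {a} = half_line a (b - a) \<inter> ball a (norm (b - a)) - {a}"
    (is "?L = ?R")
  proof
    show "?L \<subseteq> ?R"
    proof
      fix q assume q: "q \<in> ?L"
      then obtain u where "0 \<le> u" "q = a + u *\<^sub>R (b - a)" by (auto simp: in_segment algebra_simps)
      moreover then have "u \<noteq> 0" using q by auto
      ultimately show "q \<in> ?R" using q by (auto simp: half_line_def)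
    qed
    show "?R \<subseteq> ?L"
    proof
      fix q assume q: "q \<in> ?R"
      then obtain t where t: "0 < t" "q = a + t *\<^sub>R (b - a)" by (auto simp: half_line_def)
      moreover have "t < 1" using q assms t by (auto simp: dist_norm)
      ultimately have "q \<in> closed_segment a b"
        by (auto simp: in_segment algebra_simps intro!: exI[of _ t])
      then show "q \<in> ?L" using q by auto
    qed
  qed
qed (use assms in auto)

lemma segment_germ_interior:
  assumes "a \<noteq> b" "p \<in> closed_segment a b" "p \<noteq> a" "p \<noteq> b"
  shows "at p within closed_segment a b = at p within line p (b - a)"
proof -
  obtain s where s: "0 \<le> s" "s \<le> 1" "p = a + s *\<^sub>R (b - a)"
    using assms by (auto simp: in_segment algebra_simps)
  have s': "s \<noteq> 0" "s \<noteq> 1" using s assms by (auto simp: algebra_simps)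
  have ab: "a - p = s *\<^sub>R - (b - a)" "b - p = (1 - s) *\<^sub>R (b - a)"
    using s by (auto simp: algebra_simps)
  have "closed_segment a b = closed_segment p a \<union> closed_segment p b"
    using Un_closed_segment[OF assms(2)] closed_segment_commute by metis
  then have "at p within closed_segment a b =
      sup (at p within half_line p (a - p)) (at p within half_line p (b - p))"
    using assms by (simp add: at_within_union segment_germ_left)
  also have "\<dots> = sup (at p within half_line p (- (b - a))) (at p within half_line p (b - a))"
    unfolding ab using s s' by (simp only: half_line_scale less_le diff_ge_0_iff_ge) (simp add: half_line_scale)
  finally show ?thesis by (simp add: line_germ_split at_within_union sup_commute)
qed

text \<open>The four possible germs of a segment in one equation, by which the germ of an explicit
  polygon at an explicit point is found by rewriting.\<close>

lemma segment_germ: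
  assumes "a \<noteq> b"
  shows "at p within closed_segment a b =
    (if p = a then at p within half_line p (b - a) else if p = b then at p within half_line p (a - b)
     else if p \<in> closed_segment a b then at p within line p (b - a) else bot)"
  using assms segment_germ_left[OF assms] segment_germ_left[of b a] segment_germ_interior[OF assms]
    at_within_eq_bot[of "closed_segment a b" p]
  by (auto simp: closed_segment_commute)

lemma coords_linear:
  assumes "indep d e"
  shows "coords p d e (p + x *\<^sub>R d + y *\<^sub>R e) = (x, y)"
    and "q = p + fst (coords p d e q) *\<^sub>R d + snd (coords p d e q) *\<^sub>R e"
proof -
  obtain d1 d2 e1 e2 p1 p2 q1 q2 where [simp]: "d = (d1, d2)" "e = (e1, e2)" "p = (p1, p2)" "q = (q1, q2)"
    by (cases d, cases e, cases p, cases q) auto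
  define D where "D = d1 * e2 - d2 * e1"
  have D: "D \<noteq> 0" using assms by (simp add: indep_def D_def)
  show "coords p d e (p + x *\<^sub>R d + y *\<^sub>R e) = (x, y)"
    using D by (auto simp: coords_def Let_def D_def[symmetric] divide_simps) (auto simp: D_def algebra_simps)
  show "q = p + fst (coords p d e q) *\<^sub>R d + snd (coords p d e q) *\<^sub>R e"
    using D by (auto simp: coords_def Let_def D_def[symmetric] divide_simps) (auto simp: D_def algebra_simps)
qed

lemma coords_homeomorphism:
  assumes "indep d e"
  shows "homeomorphism UNIV UNIV (coords p d e) (\<lambda>(x, y). p + x *\<^sub>R d + y *\<^sub>R e)"
proof (rule homeomorphismI)
  show "continuous_on UNIV (coords p d e)"
    unfolding coords_def Let_def using assms
    by (intro continuous_intros) (auto simp: indep_def)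
  show "continuous_on UNIV (\<lambda>(x, y). p + x *\<^sub>R d + y *\<^sub>R e)"
    unfolding case_prod_beta by (intro continuous_intros)
  show "(case coords p d e x of (x, y) \<Rightarrow> p + x *\<^sub>R d + y *\<^sub>R e) = x" for x
    using coords_linear(2)[OF assms, of x p] by (simp add: case_prod_beta)
  show "coords p d e (case y of (x, y) \<Rightarrow> p + x *\<^sub>R d + y *\<^sub>R e) = y" for y
    using coords_linear(1)[OF assms] by (simp add: case_prod_beta)
qed auto

lemma coords_half_line:
  assumes "indep d e"
  shows "coords p d e q \<in> ray (1, 0) \<longleftrightarrow> q \<in> half_line p d"
    "coords p d e q \<in> ray (-1, 0) \<longleftrightarrow> q \<in> half_line p (- d)"
    "coords p d e q \<in> ray (0, 1) \<longleftrightarrow> q \<in> half_line p e"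
    "coords p d e q \<in> ray (0, -1) \<longleftrightarrow> q \<in> half_line p (- e)"
proof -
  define x y where "x = fst (coords p d e q)" and "y = snd (coords p d e q)"
  have c: "coords p d e q = (x, y)" by (simp add: x_def y_def)
  have q: "q = p + x *\<^sub>R d + y *\<^sub>R e" using coords_linear(2)[OF assms] by (simp add: x_def y_def)
  have *: "q = p + s *\<^sub>R d + t *\<^sub>R e \<longleftrightarrow> x = s \<and> y = t" for s t
    using q c coords_linear(1)[OF assms] by (metis prod.inject)
  show "coords p d e q \<in> ray (1, 0) \<longleftrightarrow> q \<in> half_line p d"
    using *[of _ 0] by (auto simp: c ray_def half_line_def)
  show "coords p d e q \<in> ray (0, 1) \<longleftrightarrow> q \<in> half_line p e"
    using *[of 0] by (auto simp: c ray_def half_line_def)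
  show "coords p d e q \<in> ray (-1, 0) \<longleftrightarrow> q \<in> half_line p (- d)"
    using *[of "- _" 0] by (auto simp: c ray_def half_line_def)
  show "coords p d e q \<in> ray (0, -1) \<longleftrightarrow> q \<in> half_line p (- e)"
    using *[of 0 "- _"] by (auto simp: c ray_def half_line_def)
qed

lemma linear_cross_chart:
  assumes "indep d e"
  shows "cross_chart p (line p d \<union> line p e) UNIV UNIV (coords p d e) (\<lambda>(x, y). p + x *\<^sub>R d + y *\<^sub>R e)"
proof -
  have hom: "homeomorphism UNIV UNIV (coords p d e) (\<lambda>(x, y). p + x *\<^sub>R d + y *\<^sub>R e)"
    by (rule coords_homeomorphism[OF assms])
  have "coords p d e p = (0, 0)" using coords_linear(1)[OF assms, of p 0 0] by simp
  moreover have "coords p d e ` ((line p d \<union> line p e) \<inter> UNIV) = {(x, y) \<in> UNIV. x = 0 \<or> y = 0}"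
  proof -
    have "coords p d e ` line p d = {(x, y). y = 0}"
      using coords_linear(1)[OF assms, of p _ 0] by (auto simp: line_def image_iff intro!: exI)
    moreover have "coords p d e ` line p e = {(x, y). x = 0}"
      using coords_linear(1)[OF assms, of p 0] by (auto simp: line_def image_iff intro!: exI)
    ultimately show ?thesis by (auto simp: image_Un)
  qed
  ultimately show ?thesis using hom by (simp add: cross_chart_def chart_at_def)
qed

lemma germ_cross_chart:
  assumes "indep d e" and p: "p \<in> C" and germ: "at p within C = at p within (line p d \<union> line p e)"
  obtains N where "open N" "p \<in> N" "cross_chart p C N (coords p d e ` N) (coords p d e) (\<lambda>(x, y). p + x *\<^sub>R d + y *\<^sub>R e)"
    "C \<inter> N = (line p d \<union> line p e) \<inter> N"
proof -
  obtain N where N: "open N" "p \<in> N" "\<And>q. q \<in> N \<Longrightarrow> q \<noteq> p \<Longrightarrow> q \<in> C \<longleftrightarrow> q \<in> line p d \<union> line p e"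
    using germ_eqD[OF germ] unfolding eventually_nhds by blast
  have "p \<in> line p d" by (auto simp: line_def intro!: exI[of _ 0])
  then have eq: "(line p d \<union> line p e) \<inter> N = C \<inter> N" using N p by blast
  have "cross_chart p C (UNIV \<inter> N) (coords p d e ` (UNIV \<inter> N)) (coords p d e) (\<lambda>(x, y). p + x *\<^sub>R d + y *\<^sub>R e)"
    by (rule cross_chart_local[OF linear_cross_chart[OF assms(1)] N(1,2) eq])
  then show ?thesis using that[OF N(1,2)] eq by simp
qed

lemma cone_germ_neq_bot:
  assumes "indep d e"
  shows "at p within {p + s *\<^sub>R d + t *\<^sub>R e |s t. s * t > 0} \<noteq> bot"
proof -
  have ne: "d + e \<noteq> 0"
  proof
    assume "d + e = 0"
    then have "e = - d" by (simp add: add_eq_0_iff)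
    then show False using assms by (simp add: indep_def)
  qed
  have sub: "half_line p (d + e) \<subseteq> {p + s *\<^sub>R d + t *\<^sub>R e |s t. s * t > 0}"
  proof
    fix q assume "q \<in> half_line p (d + e)"
    then obtain t where "0 < t" "q = p + t *\<^sub>R d + t *\<^sub>R e"
      by (auto simp: half_line_def scaleR_add_right add.assoc)
    moreover have "0 < t * t" using \<open>0 < t\<close> by simp
    ultimately show "q \<in> {p + s *\<^sub>R d + t *\<^sub>R e |s t. s * t > 0}" by blast
  qed
  show ?thesis
    using at_le[OF sub, of p] half_line_germ_neq_bot[OF ne, of p] by (auto simp: bot.extremum_unique)
qed

lemma curve_picture [simp]: "curve (picture ls xs vs) = (\<Union>l\<in>set ls. polyline l)"
  by (simp add: picture_def)

lemma over_picture: "over (picture ls xs vs) p = (case map_of xs p of None \<Rightarrow> bot | Some d \<Rightarrow> at p within line p d)"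
  by (simp add: picture_def line_def split: option.split)

lemma mark_picture: "mark (picture ls xs vs) p = (case map_of vs p of None \<Rightarrow> bot
    | Some (d, e) \<Rightarrow> at p within {p + s *\<^sub>R d + t *\<^sub>R e |s t. s * t > 0})"
  by (simp add: picture_def)

lemma crossings_picture:
  assumes "\<forall>(p, d)\<in>set xs. d \<noteq> 0"
  shows "crossings (picture ls xs vs) = fst ` set xs"
proof -
  have "over (picture ls xs vs) p = bot \<longleftrightarrow> p \<notin> fst ` set xs" for p
  proof (cases "map_of xs p")
    case None
    moreover from None have "p \<notin> fst ` set xs" by (simp add: map_of_eq_None_iff)
    ultimately show ?thesis by (simp add: over_picture)
  next
    case (Some d)
    then have *: "(p, d) \<in> set xs" by (rule map_of_SomeD)
    then have "d \<noteq> 0" using assms by auto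
    moreover have "p \<in> fst ` set xs" using * by force
    ultimately show ?thesis using Some by (simp add: over_picture line_germ_neq_bot)
  qed
  then show ?thesis unfolding crossings_def by auto
qed

lemma vertices_picture:
  assumes "\<forall>(p, d, e)\<in>set vs. indep d e"
  shows "vertices (picture ls xs vs) = fst ` set vs"
proof -
  have "mark (picture ls xs vs) p = bot \<longleftrightarrow> p \<notin> fst ` set vs" for p
  proof (cases "map_of vs p")
    case None
    moreover from None have "p \<notin> fst ` set vs" by (simp add: map_of_eq_None_iff)
    ultimately show ?thesis by (simp add: mark_picture)
  next
    case (Some v)
    then have *: "(p, v) \<in> set vs" by (rule map_of_SomeD)
    then have "indep (fst v) (snd v)" using assms by auto
    moreover have "p \<in> fst ` set vs" using * by force
    ultimately show ?thesis using Some by (simp add: mark_picture cone_germ_neq_bot case_prod_beta)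
  qed
  then show ?thesis unfolding vertices_def by auto
qed

section \<open>Diagrams presented by finite lists\<close>

definition over_piece :: "(plane \<times> plane \<times> nat \<times> nat) list \<Rightarrow> plane \<Rightarrow> nat" where
  "over_piece X p = fst (snd (the (map_of X p)))"

definition under_piece :: "(plane \<times> plane \<times> nat \<times> nat) list \<Rightarrow> plane \<Rightarrow> nat" where
  "under_piece X p = snd (snd (the (map_of X p)))"

definition end_piece :: "(plane \<times> plane \<times> plane \<times> nat list) list \<Rightarrow> plane \<Rightarrow> plane \<Rightarrow> nat" where
  "end_piece V p d = snd (snd (the (map_of V p))) !
     (if d = (1, 0) then 0 else if d = (-1, 0) then 1 else if d = (0, 1) then 2 else 3)"

text \<open>Reduces the locale to finitely many conditions on explicit lists. The chart at a vertex
  is the linear one given by \<open>coords\<close>: the four pieces there have germs of half-lines,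
  which together form the germ of two crossing lines.\<close>

lemma picture_tangle:
  assumes xs: "xs = map (\<lambda>(p, v). (p, fst v)) X"
    and vs: "vs = map (\<lambda>(p, v). (p, fst v, fst (snd v))) V"
    and curve: "(\<Union>l\<in>set ls. polyline l) = (\<Union>l\<in>set ps. polyline l)"
    and proper: "\<forall>l\<in>set ps. \<exists>a b l'. l = a # b # l' \<and> a \<noteq> b"
    and meet: "\<forall>i<length ps. \<forall>j<i. polyline (ps ! i) \<inter> polyline (ps ! j) \<subseteq> set N"
    and special: "fst ` set X \<union> fst ` set V \<subseteq> set N" "distinct (map fst X @ map fst V)"
    and X: "\<forall>(p, d, i, j)\<in>set X. d \<noteq> 0 \<and> i < length ps \<and> j < length ps \<and> i \<noteq> j \<and>
      (\<forall>m<length ps. p \<in> polyline (ps ! m) \<longleftrightarrow> m = i \<or> m = j) \<and>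
      at p within polyline (ps ! i) = at p within line p d"
    and V: "\<forall>(p, d, e, l)\<in>set V. indep d e \<and> length l = 4 \<and> (\<forall>i\<in>set l. i < length ps) \<and>
      (\<forall>m<length ps. p \<in> polyline (ps ! m) \<longleftrightarrow> m \<in> set l) \<and>
      at p within polyline (ps ! (l ! 0)) = at p within half_line p d \<and>
      at p within polyline (ps ! (l ! 1)) = at p within half_line p (- d) \<and>
      at p within polyline (ps ! (l ! 2)) = at p within half_line p e \<and>
      at p within polyline (ps ! (l ! 3)) = at p within half_line p (- e)"
  shows "tangle (picture ls xs vs) ps (set N) (over_piece X) (under_piece X) (end_piece V)"
    and "crossings (picture ls xs vs) = fst ` set X"
    and "vertices (picture ls xs vs) = fst ` set V"
proof -
  define T where "T = picture ls xs vs"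
  have fxs: "fst ` set xs = fst ` set X" "fst ` set vs = fst ` set V"
    by (auto simp: xs vs image_image case_prod_beta)
  have cr: "crossings T = fst ` set X"
    unfolding T_def fxs(1)[symmetric] by (rule crossings_picture) (use X xs in fastforce)
  have vt: "vertices T = fst ` set V"
    unfolding T_def fxs(2)[symmetric] by (rule vertices_picture) (use V vs in fastforce)
  show "crossings (picture ls xs vs) = fst ` set X" "vertices (picture ls xs vs) = fst ` set V"
    using cr vt T_def by auto
  have cT: "curve T = (\<Union>i<length ps. polyline (ps ! i))"
  proof -
    have "curve T = (\<Union>l\<in>set ps. polyline l)" by (simp add: T_def curve)
    also have "set ps = (!) ps ` {..<length ps}" by (auto simp: set_conv_nth)
    finally show ?thesis by simp
  qed
  have mx: "map_of xs p = map_option fst (map_of X p)" for p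
    unfolding xs by (induction X) auto
  have "tangle T ps (set N) (over_piece X) (under_piece X) (end_piece V)"
  proof
    show "curve T = (\<Union>i<length ps. polyline (ps ! i))" by (rule cT)
    show "\<exists>a b l. ps ! i = a # b # l \<and> a \<noteq> b" if "i < length ps" for i
      using proper nth_mem[OF that] by blast
    show "polyline (ps ! i) \<inter> polyline (ps ! j) \<subseteq> set N" if "i < length ps" "j < i" for i j
      using meet that by blast
    show "crossings T \<subseteq> set N" "vertices T \<subseteq> set N" "crossings T \<inter> vertices T = {}"
      using special unfolding cr vt by auto
  next
    fix p assume "p \<in> crossings T"
    then obtain v where v: "map_of X p = Some v"
      unfolding cr by (metis map_of_eq_None_iff not_Some_eq)
    obtain d i j where [simp]: "v = (d, i, j)" by (cases v) auto
    have "(p, d, i, j) \<in> set X" using map_of_SomeD[OF v] by simp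
    note * = bspec[OF X this, unfolded prod.case]
    have "over T p = at p within line p d" using v by (simp add: T_def over_picture mx)
    with * show "over_piece X p < length ps \<and> under_piece X p < length ps \<and> over_piece X p \<noteq> under_piece X p \<and>
        (\<forall>i<length ps. p \<in> polyline (ps ! i) \<longleftrightarrow> i = over_piece X p \<or> i = under_piece X p) \<and>
        over T p = at p within polyline (ps ! over_piece X p)"
      using v by (simp add: over_piece_def under_piece_def)
  next
    fix p assume "p \<in> vertices T"
    then obtain v where v: "map_of V p = Some v"
      unfolding vt by (metis map_of_eq_None_iff not_Some_eq)
    obtain d e l where [simp]: "v = (d, e, l)" by (cases v) auto
    have "(p, d, e, l) \<in> set V" using map_of_SomeD[OF v] by simp
    note * = bspec[OF V this, unfolded prod.case]
    have l: "indep d e" "length l = 4" "\<forall>i\<in>set l. i < length ps"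
      "\<forall>m<length ps. p \<in> polyline (ps ! m) \<longleftrightarrow> m \<in> set l"
      and germs: "at p within polyline (ps ! (l ! 0)) = at p within half_line p d"
      "at p within polyline (ps ! (l ! 1)) = at p within half_line p (- d)"
      "at p within polyline (ps ! (l ! 2)) = at p within half_line p e"
      "at p within polyline (ps ! (l ! 3)) = at p within half_line p (- e)"
      using * by - (elim conjE, assumption)+
    have set_l: "set l = {l ! 0, l ! 1, l ! 2, l ! 3}"
    proof -
      obtain i1 i2 i3 i4 where "l = [i1, i2, i3, i4]"
        using l(2) by (auto simp: length_Suc_conv numeral_eq_Suc)
      then show ?thesis by simp
    qed
    have ep: "end_piece V p (1, 0) = l ! 0" "end_piece V p (-1, 0) = l ! 1"
      "end_piece V p (0, 1) = l ! 2" "end_piece V p (0, -1) = l ! 3"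
      using v by (simp_all add: end_piece_def)
    have im: "end_piece V p ` axes = set l" by (simp add: axes_def ep set_l)
    have pC: "p \<in> curve T"
      unfolding cT using l(3,4) set_l by blast
    \<comment> \<open>The germ of the curve is the join of the germs of its pieces, and the closed
      pieces that miss \<open>p\<close> contribute \<open>bot\<close>.\<close>
    have "eventually P (at p within curve T) \<longleftrightarrow> eventually P (at p within (line p d \<union> line p e))" for P
    proof -
      have "eventually P (at p within curve T) \<longleftrightarrow> (\<forall>i<length ps. eventually P (at p within polyline (ps ! i)))"
        unfolding cT by (auto simp: eventually_at_within_UN)
      also have "\<dots> \<longleftrightarrow> (\<forall>i\<in>set l. eventually P (at p within polyline (ps ! i)))"
        using l(3,4) at_within_eq_bot[OF closed_polyline] by (metis eventually_bot)
      also have "\<dots> \<longleftrightarrow> eventually P (at p within (line p d \<union> line p e))"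
        using germs unfolding set_l
        by (simp add: at_within_union eventually_sup line_germ_split)
      finally show ?thesis .
    qed
    then have "at p within curve T = at p within (line p d \<union> line p e)" by (simp add: filter_eq_iff)
    then obtain M where M: "cross_chart p (curve T) M (coords p d e ` M) (coords p d e)
        (\<lambda>(x, y). p + x *\<^sub>R d + y *\<^sub>R e)"
      using germ_cross_chart[OF l(1) pC] by metis
    have ev: "\<forall>\<^sub>F q in at p within A. q \<in> B" if "at p within A = at p within B" for A B
      unfolding that by (rule eventually_in_at_within)
    have "\<forall>a\<in>axes. \<forall>\<^sub>F q in at p within polyline (ps ! end_piece V p a). coords p d e q \<in> ray a"
      using germs by (simp add: axes_def ep coords_half_line[OF l(1)] ev)
    with M have "\<exists>U W h g. cross_chart p (curve T) U W h g \<and>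
        (\<forall>a\<in>axes. \<forall>\<^sub>F q in at p within polyline (ps ! end_piece V p a). h q \<in> ray a)" by blast
    then show "(\<forall>a\<in>axes. end_piece V p a < length ps) \<and>
        (\<forall>i<length ps. p \<in> polyline (ps ! i) \<longleftrightarrow> i \<in> end_piece V p ` axes) \<and>
        (\<exists>U W h g. cross_chart p (curve T) U W h g \<and>
          (\<forall>a\<in>axes. \<forall>\<^sub>F q in at p within polyline (ps ! end_piece V p a). h q \<in> ray a))"
      using l(3,4) im by (metis image_eqI)
  qed auto
  then show "tangle (picture ls xs vs) ps (set N) (over_piece X) (under_piece X) (end_piece V)"
    by (simp add: T_def)
qed

lemma at_within_insert: "at p within insert a A = at p within A" for a :: "'a::t1_space"
proof (cases "p = a")
  case True
  then show ?thesis by (intro germ_eqI always_eventually) auto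
next
  case False
  then have "at p within {a} = bot" by (intro at_within_eq_bot) auto
  then show ?thesis using at_within_union[of p "{a}" A] by simp
qed

lemma half_line_germ_eq:
  assumes "a * d = b * c" "a * c + b * d > 0"
  shows "at p within half_line p (a, b) = at p within half_line p (c, d)"
  using half_line_eq[OF assms] by simp

lemma mem_frontier_square:
  "(x, y) \<in> frontier square \<longleftrightarrow>
     -4 \<le> x \<and> x \<le> 4 \<and> -4 \<le> y \<and> y \<le> 4 \<and> (x = -4 \<or> x = 4 \<or> y = -4 \<or> y = 4)"
  using closed_square by (auto simp: frontier_def interior_square) (auto simp: square_def)

text \<open>
  The curve is cut into the pieces \<open>ps\<close>, which meet each other only in points of \<open>N\<close>. An entry \<open>(p, d, i, j)\<close>
  of \<open>X\<close> is a crossing of the over piece \<open>i\<close>, of direction \<open>d\<close>, and the under piece \<open>j\<close>. An entry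
  \<open>(p, d, e, l)\<close> of \<open>V\<close> is a vertex from which the pieces in \<open>l\<close> leave in the directions
  \<open>d\<close>, \<open>- d\<close>, \<open>e\<close>, \<open>- e\<close>.
\<close>

definition presents ::
  "plane list list \<Rightarrow> plane list \<Rightarrow> (plane \<times> plane \<times> nat \<times> nat) list \<Rightarrow>
    (plane \<times> plane \<times> plane \<times> nat list) list \<Rightarrow> diagram \<Rightarrow> bool" where
  "presents ps N X V T \<longleftrightarrow>
     tangle T ps (set N) (over_piece X) (under_piece X) (end_piece V) \<and>
     crossings T = fst ` set X \<and> vertices T = fst ` set V \<and> distinct (map fst X) \<and> distinct (map fst V)"

text \<open>The condition of \<open>balanced_iff\<close> on the four ends in the order
  \<open>d\<close>, \<open>- d\<close>, \<open>e\<close>, \<open>- e\<close>; an even sum of four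
  bits is an equality of two equalities.\<close>

definition balanced4 :: "colour \<Rightarrow> colour \<Rightarrow> colour \<Rightarrow> colour \<Rightarrow> bool" where
  "balanced4 a b c d \<longleftrightarrow> fst b = fst a \<and> fst c = fst a \<and> fst d = fst a \<and>
     ((snd a = snd b) = (snd c = snd d))"

definition edge_colouring ::
  "plane list list \<Rightarrow> plane list \<Rightarrow> (plane \<times> plane \<times> nat \<times> nat) list \<Rightarrow>
    (plane \<times> plane \<times> plane \<times> nat list) list \<Rightarrow> (nat \<Rightarrow> colour) \<Rightarrow> bool" where
  "edge_colouring ps N X V k \<longleftrightarrow>
     (\<forall>p\<in>set N. p \<notin> fst ` set X \<longrightarrow> p \<notin> fst ` set V \<longrightarrow>
       (\<forall>i<length ps. p \<in> polyline (ps ! i) \<longrightarrow>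
         (\<forall>j<i. p \<in> polyline (ps ! j) \<longrightarrow> k i = k j))) \<and>
     (\<forall>(p, d, e, l)\<in>set V. balanced4 (k (l ! 0)) (k (l ! 1)) (k (l ! 2)) (k (l ! 3)))"

text \<open>A list instead of a set lets rewriting compute the count; by
  \<open>presents_weight\<close> its length is the cardinality because the crossings are listed
  without repetition.\<close>

definition linking_list :: "(plane \<times> plane \<times> nat \<times> nat) list \<Rightarrow> (nat \<Rightarrow> colour) \<Rightarrow> (plane \<times> plane \<times> nat \<times> nat) list" where
  "linking_list X k = filter (\<lambda>(p, d, i, j). k i = (True, True) \<and> k j = (False, True)) X"

lemma presents_consistent:
  assumes "presents ps N X V T"
  shows "tangle.consistent T ps (set N) (end_piece V) k \<longleftrightarrow> edge_colouring ps N X V k"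
proof -
  interpret tangle T ps "set N" "over_piece X" "under_piece X" "end_piece V"
    using assms by (simp add: presents_def)
  have cr: "crossings T = fst ` set X" "vertices T = fst ` set V" "distinct (map fst V)"
    using assms by (auto simp: presents_def)
  have "balanced (\<lambda>d. k (end_piece V (fst v) d)) \<longleftrightarrow>
      (case v of (p, d, e, l) \<Rightarrow> balanced4 (k (l ! 0)) (k (l ! 1)) (k (l ! 2)) (k (l ! 3)))"
    if v: "v \<in> set V" for v
  proof -
    obtain p d e l where [simp]: "v = (p, d, e, l)" by (cases v) auto
    have "map_of V p = Some (d, e, l)" using map_of_is_SomeI[OF cr(3)] v by simp
    then show ?thesis by (simp add: balanced_iff balanced4_def end_piece_def)
  qed
  then have "(\<forall>p\<in>vertices T. balanced (\<lambda>d. k (end_piece V p d))) \<longleftrightarrow>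
      (\<forall>(p, d, e, l)\<in>set V. balanced4 (k (l ! 0)) (k (l ! 1)) (k (l ! 2)) (k (l ! 3)))"
    unfolding cr(2) by fastforce
  moreover have "(\<forall>i<length ps. \<forall>j<length ps. P i \<longrightarrow> P j \<longrightarrow> k i = k j) \<longleftrightarrow>
      (\<forall>i<length ps. P i \<longrightarrow> (\<forall>j<i. P j \<longrightarrow> k i = k j))" for P
    by (metis less_trans linorder_neqE_nat)
  ultimately show ?thesis
    unfolding consistent_def edge_colouring_def cr(1,2) by (simp add: Ball_def imp_conjL)
qed

lemma presents_weight:
  assumes "presents ps N X V T"
  shows "tangle.weight T (over_piece X) (under_piece X) k = length (linking_list X k)"
proof -
  interpret tangle T ps "set N" "over_piece X" "under_piece X" "end_piece V"
    using assms by (simp add: presents_def)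
  have cr: "crossings T = fst ` set X" "distinct (map fst X)"
    using assms by (auto simp: presents_def)
  have look: "over_piece X p = i \<and> under_piece X p = j" if "(p, d, i, j) \<in> set X" for p d i j
    using map_of_is_SomeI[OF cr(2) that] by (simp add: over_piece_def under_piece_def)
  have "{p \<in> crossings T. k (over_piece X p) = (True, True) \<and> k (under_piece X p) = (False, True)}
      = fst ` set (linking_list X k)"
    unfolding cr(1) linking_list_def using look by (force simp: image_iff)
  then have "weight k = card (fst ` set (linking_list X k))" by (simp add: weight_def)
  also have "\<dots> = card (set (map fst (linking_list X k)))" by simp
  also have "\<dots> = length (map fst (linking_list X k))"
    by (rule distinct_card) (use cr(2) in \<open>simp add: linking_list_def distinct_map_filter\<close>)
  finally show ?thesis by simp
qed

lemma presents_linked_iff: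
  assumes "presents ps N X V T"
  shows "linked T \<longleftrightarrow> (\<exists>k. edge_colouring ps N X V k \<and> odd (length (linking_list X k)))"
  using tangle.linked_iff[of T ps "set N" "over_piece X" "under_piece X" "end_piece V"] assms
  by (simp add: presents_consistent[OF assms] presents_weight[OF assms]) (simp add: presents_def)

text \<open>The map \<open>F\<close> recolours the pieces of the first picture for the second, and
  \<open>B ! i\<close> lists the frontier points of the new piece \<open>i\<close>, so that the
  boundary clause is a finite check.\<close>

lemma presents_transfers:
  assumes T: "presents ps N X V T" and T': "presents ps' N' X' V' T'"
    and int: "\<forall>p\<in>fst ` set X \<union> fst ` set V \<union> fst ` set X' \<union> fst ` set V'. p \<in> interior square"
    and bd: "\<forall>i<length ps'. polyline (ps' ! i) \<inter> frontier square \<subseteq> set (B ! i)"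
    and k: "\<And>k. edge_colouring ps N X V k \<Longrightarrow> edge_colouring ps' N' X' V' (F k) \<and>
      (even (length (linking_list X' (F k))) \<longleftrightarrow> even (length (linking_list X k))) \<and>
      (\<forall>i<length ps'. \<forall>p\<in>set (B ! i). \<exists>j<length ps. p \<in> polyline (ps ! j) \<and> F k i = k j)"
  shows "transfers T T'"
proof (rule transfersI)
  show "tangle T ps (set N) (over_piece X) (under_piece X) (end_piece V)"
    "tangle T' ps' (set N') (over_piece X') (under_piece X') (end_piece V')"
    using T T' by (auto simp: presents_def)
  show "crossings T \<union> vertices T \<union> crossings T' \<union> vertices T' \<subseteq> interior square"
    using T T' int by (auto simp: presents_def)
  fix \<kappa>
  assume "tangle.consistent T ps (set N) (end_piece V) \<kappa>"
  then have "edge_colouring ps N X V \<kappa>" by (simp add: presents_consistent[OF T])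
  note F = k[OF this]
  have "\<forall>i<length ps'. \<forall>p\<in>polyline (ps' ! i) \<inter> frontier square.
      \<exists>j<length ps. p \<in> polyline (ps ! j) \<and> F \<kappa> i = \<kappa> j"
    using F bd by blast
  then show "\<exists>k'. tangle.consistent T' ps' (set N') (end_piece V') k' \<and>
      (even (tangle.weight T' (over_piece X') (under_piece X') k') \<longleftrightarrow>
       even (tangle.weight T (over_piece X) (under_piece X) \<kappa>)) \<and>
      (\<forall>i<length ps'. \<forall>p\<in>polyline (ps' ! i) \<inter> frontier square.
          \<exists>j<length ps. p \<in> polyline (ps ! j) \<and> k' i = \<kappa> j)"
    using F by (intro exI[of _ "F \<kappa>"])
      (simp add: presents_consistent[OF T'] presents_weight[OF T] presents_weight[OF T'])
qed

text \<open>For moves whose two sides have matching pieces, numbered so that corresponding pieces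
  have the same frontier points. The colours of the pieces can then be kept unchanged.\<close>

lemma presents_transfers_both:
  assumes T: "presents ps N X V T" "presents ps' N' X' V' T'" "length ps = length ps'"
    and int: "\<forall>p\<in>fst ` set X \<union> fst ` set V \<union> fst ` set X' \<union> fst ` set V'. p \<in> interior square"
    and bd: "\<forall>i<length ps'. polyline (ps ! i) \<inter> frontier square = set (B ! i) \<and>
      polyline (ps' ! i) \<inter> frontier square = set (B ! i)"
    and k: "\<And>k. (edge_colouring ps N X V k \<longleftrightarrow> edge_colouring ps' N' X' V' k) \<and>
      (edge_colouring ps N X V k \<longrightarrow>
        (even (length (linking_list X k)) \<longleftrightarrow> even (length (linking_list X' k))))"
  shows "transfers T T' \<and> transfers T' T"
proof
  have bd': "\<forall>i<length ps'. \<forall>p\<in>set (B ! i). p \<in> polyline (ps ! i) \<and> p \<in> polyline (ps' ! i)"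
    using bd by blast
  show "transfers T T'"
  proof (rule presents_transfers[OF T(1,2) int, where F = "\<lambda>k. k"])
    show "\<forall>i<length ps'. polyline (ps' ! i) \<inter> frontier square \<subseteq> set (B ! i)" using bd by simp
  next
    fix k assume "edge_colouring ps N X V k"
    with k[of k] bd' T(3) show "edge_colouring ps' N' X' V' k \<and>
      (even (length (linking_list X' k)) \<longleftrightarrow> even (length (linking_list X k))) \<and>
      (\<forall>i<length ps'. \<forall>p\<in>set (B ! i). \<exists>j<length ps. p \<in> polyline (ps ! j) \<and> k i = k j)" by auto
  qed
  show "transfers T' T"
  proof (rule presents_transfers[OF T(2,1), where F = "\<lambda>k. k"])
    show "\<forall>p\<in>fst ` set X' \<union> fst ` set V' \<union> fst ` set X \<union> fst ` set V. p \<in> interior square"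
      using int by blast
    show "\<forall>i<length ps. polyline (ps ! i) \<inter> frontier square \<subseteq> set (B ! i)" using bd T(3) by simp
  next
    fix k assume "edge_colouring ps' N' X' V' k"
    with k[of k] bd' T(3) show "edge_colouring ps N X V k \<and>
      (even (length (linking_list X k)) \<longleftrightarrow> even (length (linking_list X' k))) \<and>
      (\<forall>i<length ps. \<forall>p\<in>set (B ! i). \<exists>j<length ps'. p \<in> polyline (ps' ! j) \<and> k i = k j)" by auto
  qed
qed

lemma presents_pictureI:
  assumes "xs = map (\<lambda>(p, v). (p, fst v)) X"
    and "vs = map (\<lambda>(p, v). (p, fst v, fst (snd v))) V"
    and "(\<Union>l\<in>set ls. polyline l) = (\<Union>l\<in>set ps. polyline l)"
    and "\<forall>l\<in>set ps. \<exists>a b l'. l = a # b # l' \<and> a \<noteq> b"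
    and "\<forall>i<length ps. \<forall>j<i. polyline (ps ! i) \<inter> polyline (ps ! j) \<subseteq> set N"
    and "fst ` set X \<union> fst ` set V \<subseteq> set N" "distinct (map fst X @ map fst V)"
    and "\<forall>(p, d, i, j)\<in>set X. d \<noteq> 0 \<and> i < length ps \<and> j < length ps \<and> i \<noteq> j \<and>
      (\<forall>m<length ps. p \<in> polyline (ps ! m) \<longleftrightarrow> m = i \<or> m = j) \<and>
      at p within polyline (ps ! i) = at p within line p d"
    and "\<forall>(p, d, e, l)\<in>set V. indep d e \<and> length l = 4 \<and> (\<forall>i\<in>set l. i < length ps) \<and>
      (\<forall>m<length ps. p \<in> polyline (ps ! m) \<longleftrightarrow> m \<in> set l) \<and>
      at p within polyline (ps ! (l ! 0)) = at p within half_line p d \<and>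
      at p within polyline (ps ! (l ! 1)) = at p within half_line p (- d) \<and>
      at p within polyline (ps ! (l ! 2)) = at p within half_line p e \<and>
      at p within polyline (ps ! (l ! 3)) = at p within half_line p (- e)"
  shows "presents ps N X V (picture ls xs vs)"
  unfolding presents_def using picture_tangle[OF assms] assms(7) by auto

lemma presents_cong:
  assumes "presents ps N X V T" "curve T = curve T'" "over T = over T'" "vertices T = vertices T'"
  shows "presents ps N X V T'"
proof -
  have "crossings T = crossings T'" using assms(3) by (simp add: crossings_def)
  note eq = assms(2,4) this fun_cong[OF assms(3)]
  show ?thesis
    using assms(1) unfolding presents_def tangle_def eq .
qed

text \<open>Negating \<open>e\<close> selects the other pair of regions at the same vertex, while
  the curve, the crossings and the set of vertices stay the same.\<close>

lemma presents_opposite_marker: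
  assumes "presents ps N X V (picture ls xs [(p, d, e)])" "indep d e"
  shows "presents ps N X V (picture ls xs [(p, d, - e)])"
proof (rule presents_cong[OF assms(1)])
  have "indep d (- e)" using assms(2) by (simp add: indep_def)
  then show "vertices (picture ls xs [(p, d, e)]) = vertices (picture ls xs [(p, d, - e)])"
    using assms(2) by (simp add: vertices_picture)
qed (simp_all add: picture_def)

section \<open>The nine moves\<close>

lemmas piece_simps = split_paired_All split_paired_Ex all_conj_distrib subset_iff set_eq_iff
  mem_closed_segment_plane All_less_Suc Ex_less_Suc

lemmas germ_simps = at_within_insert at_within_union segment_germ

text \<open>The curl is cut at \<open>(2, 2)\<close>, since the two strands at a crossing, and the
  four ends at a vertex, must belong to different pieces. The cut point is a joint and forces equal
  colours on both sides of it.\<close>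

lemma kink_arc:
    "presents [[(-4, -4), (0, 0), (4, -4)]]
      [] [] [] (picture [[(-4, -4), (0, 0), (4, -4)]] [] [])"
  and kink_pos:
    "presents [[(-4, -4), (2, 2)], [(2, 2), (-2, 2), (4, -4)]]
      [(0, 0), (2, 2)] [((0, 0), (1, 1), 0, 1)] []
      (picture [[(-4, -4), (2, 2), (-2, 2), (4, -4)]]
        [((0, 0), (1, 1))] [])"
  and kink_neg:
    "presents [[(-4, -4), (2, 2)], [(2, 2), (-2, 2), (4, -4)]]
      [(0, 0), (2, 2)] [((0, 0), (1, -1), 1, 0)] []
      (picture [[(-4, -4), (2, 2), (-2, 2), (4, -4)]]
        [((0, 0), (1, -1))] [])"
  and kink_vertex:
    "presents [[(-4, -4), (0, 0)], [(0, 0), (2, 2)], [(2, 2), (-2, 2), (0, 0)], [(0, 0), (4, -4)]]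
      [(0, 0), (2, 2)] [] [((0, 0), (1, 1), (1, -1), [1, 0, 3, 2])]
      (picture [[(-4, -4), (2, 2), (-2, 2), (4, -4)]]
        [] [((0, 0), (1, 1), (1, -1))])"
  by (rule presents_pictureI; (simp add: piece_simps germ_simps indep_def zero_prod_def)?;
    ((intro conjI allI; argo) | (intro conjI line_germ_eq half_line_germ_eq; simp add: zero_prod_def))?)+

lemma omega2_apart:
    "presents [[(-2, -4), (-2, 4)], [(2, -4), (2, 4)]]
      [] [] [] (picture [[(-2, -4), (-2, 4)], [(2, -4), (2, 4)]] [] [])"
  and omega2_crossed:
    "presents [[(-2, -4), (2, 0), (-2, 4)], [(2, -4), (-2, 0), (2, 4)]]
      [(0, -2), (0, 2)] [((0, -2), (1, 1), 0, 1), ((0, 2), (-1, 1), 0, 1)] []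
      (picture [[(-2, -4), (2, 0), (-2, 4)], [(2, -4), (-2, 0), (2, 4)]]
        [((0, -2), (1, 1)), ((0, 2), (-1, 1))] [])"
  by (rule presents_pictureI; (simp add: piece_simps germ_simps indep_def zero_prod_def)?;
    ((intro conjI allI; argo) | (intro conjI line_germ_eq half_line_germ_eq; simp add: zero_prod_def))?)+

lemma omega3_above_pos:
    "presents [[(-4, -4), (4, 4)], [(-4, 4), (4, -4)], [(-4, 0), (-3, 2), (3, 2), (4, 0)]]
      [(0, 0), (-2, 2), (2, 2)] [((0, 0), (1, 1), 0, 1), ((-2, 2), (1, 0), 2, 1), ((2, 2), (1, 0), 2, 0)] []
      (picture [[(-4, -4), (4, 4)], [(-4, 4), (4, -4)], [(-4, 0), (-3, 2), (3, 2), (4, 0)]]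
        [((0, 0), (1, 1)), ((-2, 2), (1, 0)), ((2, 2), (1, 0))] [])"
  and omega3_below_pos:
    "presents [[(-4, -4), (4, 4)], [(-4, 4), (4, -4)], [(-4, 0), (-3, -2), (3, -2), (4, 0)]]
      [(0, 0), (-2, -2), (2, -2)] [((0, 0), (1, 1), 0, 1), ((-2, -2), (1, 0), 2, 0), ((2, -2), (1, 0), 2, 1)] []
      (picture [[(-4, -4), (4, 4)], [(-4, 4), (4, -4)], [(-4, 0), (-3, -2), (3, -2), (4, 0)]]
        [((0, 0), (1, 1)), ((-2, -2), (1, 0)), ((2, -2), (1, 0))] [])"
  and omega3_above_neg:
    "presents [[(-4, -4), (4, 4)], [(-4, 4), (4, -4)], [(-4, 0), (-3, 2), (3, 2), (4, 0)]]
      [(0, 0), (-2, 2), (2, 2)] [((0, 0), (1, -1), 1, 0), ((-2, 2), (1, 0), 2, 1), ((2, 2), (1, 0), 2, 0)] []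
      (picture [[(-4, -4), (4, 4)], [(-4, 4), (4, -4)], [(-4, 0), (-3, 2), (3, 2), (4, 0)]]
        [((0, 0), (1, -1)), ((-2, 2), (1, 0)), ((2, 2), (1, 0))] [])"
  and omega3_below_neg:
    "presents [[(-4, -4), (4, 4)], [(-4, 4), (4, -4)], [(-4, 0), (-3, -2), (3, -2), (4, 0)]]
      [(0, 0), (-2, -2), (2, -2)] [((0, 0), (1, -1), 1, 0), ((-2, -2), (1, 0), 2, 0), ((2, -2), (1, 0), 2, 1)] []
      (picture [[(-4, -4), (4, 4)], [(-4, 4), (4, -4)], [(-4, 0), (-3, -2), (3, -2), (4, 0)]]
        [((0, 0), (1, -1)), ((-2, -2), (1, 0)), ((2, -2), (1, 0))] [])"
  by (rule presents_pictureI; (simp add: piece_simps germ_simps indep_def zero_prod_def)?;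
    ((intro conjI allI; argo) | (intro conjI line_germ_eq half_line_germ_eq; simp add: zero_prod_def))?)+

lemma omega4_above:
    "presents [[(-4, -4), (0, 0)], [(0, 0), (4, 4)], [(-4, 4), (0, 0)], [(0, 0), (4, -4)],
       [(-4, 0), (-3, 2), (3, 2), (4, 0)]]
      [(0, 0), (-2, 2), (2, 2)] [((-2, 2), (1, 0), 4, 2), ((2, 2), (1, 0), 4, 1)]
      [((0, 0), (1, 1), (1, -1), [1, 0, 3, 2])]
      (picture [[(-4, -4), (4, 4)], [(-4, 4), (4, -4)], [(-4, 0), (-3, 2), (3, 2), (4, 0)]]
        [((-2, 2), (1, 0)), ((2, 2), (1, 0))] [((0, 0), (1, 1), (1, -1))])"
  and omega4_below:
    "presents [[(-4, -4), (0, 0)], [(0, 0), (4, 4)], [(-4, 4), (0, 0)], [(0, 0), (4, -4)],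
       [(-4, 0), (-3, -2), (3, -2), (4, 0)]]
      [(0, 0), (-2, -2), (2, -2)] [((-2, -2), (1, 0), 4, 0), ((2, -2), (1, 0), 4, 3)]
      [((0, 0), (1, 1), (1, -1), [1, 0, 3, 2])]
      (picture [[(-4, -4), (4, 4)], [(-4, 4), (4, -4)], [(-4, 0), (-3, -2), (3, -2), (4, 0)]]
        [((-2, -2), (1, 0)), ((2, -2), (1, 0))] [((0, 0), (1, 1), (1, -1))])"
  and omega4'_above:
    "presents [[(-4, -4), (0, 0)], [(0, 0), (4, 4)], [(-4, 4), (0, 0)], [(0, 0), (4, -4)],
       [(-4, 0), (-3, 2), (3, 2), (4, 0)]]
      [(0, 0), (-2, 2), (2, 2)] [((-2, 2), (1, -1), 2, 4), ((2, 2), (1, 1), 1, 4)]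
      [((0, 0), (1, 1), (1, -1), [1, 0, 3, 2])]
      (picture [[(-4, -4), (4, 4)], [(-4, 4), (4, -4)], [(-4, 0), (-3, 2), (3, 2), (4, 0)]]
        [((-2, 2), (1, -1)), ((2, 2), (1, 1))] [((0, 0), (1, 1), (1, -1))])"
  and omega4'_below:
    "presents [[(-4, -4), (0, 0)], [(0, 0), (4, 4)], [(-4, 4), (0, 0)], [(0, 0), (4, -4)],
       [(-4, 0), (-3, -2), (3, -2), (4, 0)]]
      [(0, 0), (-2, -2), (2, -2)] [((-2, -2), (1, 1), 0, 4), ((2, -2), (1, -1), 3, 4)]
      [((0, 0), (1, 1), (1, -1), [1, 0, 3, 2])]
      (picture [[(-4, -4), (4, 4)], [(-4, 4), (4, -4)], [(-4, 0), (-3, -2), (3, -2), (4, 0)]]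
        [((-2, -2), (1, 1)), ((2, -2), (1, -1))] [((0, 0), (1, 1), (1, -1))])"
  by (rule presents_pictureI; (simp add: piece_simps germ_simps indep_def zero_prod_def)?;
    ((intro conjI allI; argo) | (intro conjI line_germ_eq half_line_germ_eq; simp add: zero_prod_def))?)+

lemma omega5_left_pos:
    "presents [[(-4, 2), (0, -2), (2, 0)], [(2, 0), (4, 2)], [(-4, -2), (0, 2), (2, 0)],
       [(2, 0), (4, -2)]]
      [(-2, 0), (2, 0)] [((-2, 0), (1, 1), 2, 0)] [((2, 0), (1, 1), (1, -1), [1, 0, 3, 2])]
      (picture [[(-4, 2), (0, -2), (4, 2)], [(-4, -2), (0, 2), (4, -2)]]
        [((-2, 0), (1, 1))] [((2, 0), (1, 1), (1, -1))])"
  and omega5_right_pos: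
    "presents [[(-4, 2), (-2, 0)], [(-2, 0), (0, -2), (4, 2)], [(-4, -2), (-2, 0)],
       [(-2, 0), (0, 2), (4, -2)]]
      [(-2, 0), (2, 0)] [((2, 0), (1, 1), 1, 3)] [((-2, 0), (1, 1), (1, -1), [3, 2, 1, 0])]
      (picture [[(-4, 2), (0, -2), (4, 2)], [(-4, -2), (0, 2), (4, -2)]]
        [((2, 0), (1, 1))] [((-2, 0), (1, 1), (1, -1))])"
  and omega5_left_neg:
    "presents [[(-4, 2), (0, -2), (2, 0)], [(2, 0), (4, 2)], [(-4, -2), (0, 2), (2, 0)],
       [(2, 0), (4, -2)]]
      [(-2, 0), (2, 0)] [((-2, 0), (1, -1), 0, 2)]
      [((2, 0), (1, 1), (1, -1), [1, 0, 3, 2])]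
      (picture [[(-4, 2), (0, -2), (4, 2)], [(-4, -2), (0, 2), (4, -2)]]
        [((-2, 0), (1, -1))] [((2, 0), (1, 1), (1, -1))])"
  and omega5_right_neg:
    "presents [[(-4, 2), (-2, 0)], [(-2, 0), (0, -2), (4, 2)], [(-4, -2), (-2, 0)],
       [(-2, 0), (0, 2), (4, -2)]]
      [(-2, 0), (2, 0)] [((2, 0), (1, -1), 3, 1)]
      [((-2, 0), (1, 1), (1, -1), [3, 2, 1, 0])]
      (picture [[(-4, 2), (0, -2), (4, 2)], [(-4, -2), (0, 2), (4, -2)]]
        [((2, 0), (1, -1))] [((-2, 0), (1, 1), (1, -1))])"
  by (rule presents_pictureI; (simp add: piece_simps germ_simps indep_def zero_prod_def)?;
    ((intro conjI allI; argo) | (intro conjI line_germ_eq half_line_germ_eq; simp add: zero_prod_def))?)+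

lemma omega7_left:
    "presents [[(-4, 0), (-2, 0)], [(-2, 0), (2, 0)], [(2, 0), (4, 0)], [(-2, -4), (-2, 0)],
       [(-2, 0), (-2, 4)], [(2, -4), (2, 0)], [(2, 0), (2, 4)]]
      [(-2, 0), (2, 0)] []
      [((-2, 0), (1, 0), (0, 1), [1, 0, 4, 3]), ((2, 0), (-1, 0), (0, 1), [1, 2, 6, 5])]
      (picture [[(-4, 0), (4, 0)], [(-2, -4), (-2, 4)], [(2, -4), (2, 4)]]
        [] [((-2, 0), (1, 0), (0, 1)), ((2, 0), (-1, 0), (0, 1))])"
  and omega7_right:
    "presents [[(-4, 0), (-1, -2)], [(-1, -2), (1, 2)], [(1, 2), (4, 0)], [(-2, -4), (-1, -2)],
       [(-2, 4), (1, 2)], [(-1, -2), (2, -4)], [(1, 2), (2, 4)]]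
      [(1, 2), (-1, -2)] []
      [((1, 2), (1, 2), (-3, 2), [6, 1, 4, 2]), ((-1, -2), (1, 2), (3, -2), [1, 3, 5, 0])]
      (picture [[(-2, -4), (2, 4)], [(-2, 4), (4, 0)], [(-4, 0), (2, -4)]]
        [] [((1, 2), (1, 2), (-3, 2)), ((-1, -2), (1, 2), (3, -2))])"
  by (rule presents_pictureI; (simp add: piece_simps germ_simps indep_def zero_prod_def)?;
    ((intro conjI allI; argo) | (intro conjI line_germ_eq half_line_germ_eq; simp add: zero_prod_def))?)+

lemma either_marker:
  assumes "presents ps N X V (picture ls xs [(p, (1, 1), (1, -1))])" "e \<in> {(1, -1), (-1, 1)}"
  shows "presents ps N X V (picture ls xs [(p, (1, 1), e)])"
  using presents_opposite_marker[OF assms(1)] assms by (auto simp: indep_def)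

text \<open>Both ends of the loop at the origin have the same colour, so the cycle condition gives
  the two outer ends the same colour and the straight arc can inherit it. A self-crossing of one
  colour is never counted, as a counted crossing joins different first bits.\<close>

lemma transfers_kink:
  "(T, T') \<in> sides Omega1 \<union> sides Omega6 \<union> sides Omega6' \<Longrightarrow> transfers T T' \<and> transfers T' T"
  unfolding sides.simps
  by (elim UnE CollectE exE conjE insertE emptyE Pair_inject; hypsubst; intro conjI; rule
    presents_transfers[OF kink_arc kink_pos,
      where F = "\<lambda>k _. k 0" and B = "[[(-4, -4)], [(4, -4)]]"]
    presents_transfers[OF kink_pos kink_arc,
      where F = "\<lambda>k _. k 0" and B = "[[(-4, -4), (4, -4)]]"]
    presents_transfers[OF kink_arc kink_neg,
      where F = "\<lambda>k _. k 0" and B = "[[(-4, -4)], [(4, -4)]]"]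
    presents_transfers[OF kink_neg kink_arc,
      where F = "\<lambda>k _. k 0" and B = "[[(-4, -4), (4, -4)]]"]
    presents_transfers[OF kink_arc either_marker[OF kink_vertex],
      where F = "\<lambda>k _. k 0" and B = "[[(-4, -4)], [], [], [(4, -4)]]"]
    presents_transfers[OF either_marker[OF kink_vertex] kink_arc,
      where F = "\<lambda>k _. k 0" and B = "[[(-4, -4), (4, -4)]]"];
      ((simp only: edge_colouring_def linking_list_def balanced4_def,
         auto simp: piece_simps numeral_eq_Suc prod_eq_iff) |
        (simp add: interior_square piece_simps mem_frontier_square; (intro conjI allI; argo)?)))

text \<open>The two new crossings have the same over piece and the same under piece, so they are
  counted together or not at all.\<close>

lemma transfers_Omega2:
  "(T, T') \<in> sides Omega2 \<Longrightarrow> transfers T T' \<and> transfers T' T"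
  unfolding sides.simps
  by (elim CollectE exE conjE insertE emptyE Pair_inject; hypsubst; rule
    presents_transfers_both[OF omega2_apart omega2_crossed,
      where B = "[[(-2, -4), (-2, 4)], [(2, -4), (2, 4)]]"];
      ((simp only: edge_colouring_def linking_list_def balanced4_def,
         auto simp: piece_simps numeral_eq_Suc prod_eq_iff) |
        (simp add: interior_square piece_simps mem_frontier_square; (intro conjI allI; argo)?)))

text \<open>Every pair of pieces crosses once before and once after the move, with the same piece on
  top.\<close>

lemma transfers_Omega3:
  "(T, T') \<in> sides Omega3 \<Longrightarrow> transfers T T' \<and> transfers T' T"
  unfolding sides.simps
  by (elim CollectE exE conjE insertE emptyE Pair_inject; hypsubst; rule
    presents_transfers_both[OF omega3_above_pos omega3_below_pos,
      where B = "[[(-4, -4), (4, 4)], [(-4, 4), (4, -4)], [(-4, 0), (4, 0)]]"]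
    presents_transfers_both[OF omega3_above_neg omega3_below_neg,
      where B = "[[(-4, -4), (4, 4)], [(-4, 4), (4, -4)], [(-4, 0), (4, 0)]]"];
      ((simp only: edge_colouring_def linking_list_def balanced4_def,
         auto simp: piece_simps numeral_eq_Suc prod_eq_iff) |
        (simp add: interior_square piece_simps mem_frontier_square; (intro conjI allI; argo)?)))

text \<open>The arc exchanges its crossings with two edges at the vertex for crossings with the
  other two. All four edges have the same first bit and their second bits have even sum, so the
  parity of the counted crossings is unchanged.\<close>

lemma transfers_Omega4:
  "(T, T') \<in> sides Omega4 \<union> sides Omega4' \<Longrightarrow> transfers T T' \<and> transfers T' T"
  unfolding sides.simps
  by (elim UnE CollectE exE conjE insertE emptyE Pair_inject; hypsubst; rule
    presents_transfers_both[OF either_marker[OF omega4_above] either_marker[OF omega4_below],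
      where B = "[[(-4, -4)], [(4, 4)], [(-4, 4)], [(4, -4)], [(-4, 0), (4, 0)]]"]
    presents_transfers_both[OF either_marker[OF omega4'_above] either_marker[OF omega4'_below],
      where B = "[[(-4, -4)], [(4, 4)], [(-4, 4)], [(4, -4)], [(-4, 0), (4, 0)]]"];
      ((simp only: edge_colouring_def linking_list_def balanced4_def,
         auto simp: piece_simps numeral_eq_Suc prod_eq_iff) |
        (simp add: interior_square piece_simps mem_frontier_square; (intro conjI allI; argo)?)))

text \<open>The flyped crossing joins two edges at one vertex. They have the same first bit, so the
  crossing is counted on neither side.\<close>

lemma transfers_Omega5:
  "(T, T') \<in> sides Omega5 \<Longrightarrow> transfers T T' \<and> transfers T' T"
  unfolding sides.simps
  by (elim CollectE exE conjE insertE emptyE Pair_inject; hypsubst; rule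
    presents_transfers_both[OF either_marker[OF omega5_left_pos] either_marker[OF omega5_right_pos],
      where B = "[[(-4, 2)], [(4, 2)], [(-4, -2)], [(4, -2)]]"]
    presents_transfers_both[OF either_marker[OF omega5_left_neg] either_marker[OF omega5_right_neg],
      where B = "[[(-4, 2)], [(4, 2)], [(-4, -2)], [(4, -2)]]"];
      ((simp only: edge_colouring_def linking_list_def balanced4_def,
         auto simp: piece_simps numeral_eq_Suc prod_eq_iff) |
        (simp add: interior_square piece_simps mem_frontier_square; (intro conjI allI; argo)?)))

text \<open>In both pictures piece 1 joins the two vertices; its bit is forced by the cycle condition there.\<close>

lemma transfers_Omega7:
  "(T, T') \<in> sides Omega7 \<Longrightarrow> transfers T T' \<and> transfers T' T"
  unfolding sides.simps
  by (elim CollectE exE conjE insertE emptyE Pair_inject; hypsubst; intro conjI; rule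
    presents_transfers[OF omega7_left omega7_right,
      where F = "\<lambda>k :: nat \<Rightarrow> colour. k(1 := (fst (k 0), snd (k 6) = (snd (k 4) = snd (k 2))))"
        and B = "[[(-4, 0)], [], [(4, 0)], [(-2, -4)], [(-2, 4)], [(2, -4)], [(2, 4)]]"]
    presents_transfers[OF omega7_right omega7_left,
      where F = "\<lambda>k :: nat \<Rightarrow> colour. k(1 := (fst (k 0), snd (k 0) = (snd (k 4) = snd (k 3))))"
        and B = "[[(-4, 0)], [], [(4, 0)], [(-2, -4)], [(-2, 4)], [(2, -4)], [(2, 4)]]"];
      ((simp only: edge_colouring_def linking_list_def balanced4_def,
         auto simp: piece_simps numeral_eq_Suc prod_eq_iff) |
        (simp add: interior_square piece_simps mem_frontier_square; (intro conjI allI; argo)?)))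

lemma sides_transfers:
  assumes "m \<noteq> Omega8" "(T, T') \<in> sides m"
  shows "transfers T T' \<and> transfers T' T"
  using assms transfers_kink transfers_Omega2 transfers_Omega3 transfers_Omega4 transfers_Omega5 transfers_Omega7
  by (cases m) (simp_all del: sides.simps)

lemma yoshikawa_move_linked:
  assumes "yoshikawa_move m D D'" "m \<noteq> Omega8"
  shows "linked D' \<longleftrightarrow> linked D"
proof -
  have D: "marked_graph_diagram D" "marked_graph_diagram D'"
    using assms(1) by (auto simp: yoshikawa_move_def)
  obtain T T' where T: "(T, T') \<in> sides m" "local_move T T' D D' \<or> local_move T' T D D'"
    using assms(1) by (auto simp: yoshikawa_move_def)
  have "transfers T T'" "transfers T' T" using sides_transfers[OF assms(2) T(1)] by auto
  with T(2) D show ?thesis using transfers_move by metis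
qed

lemma transformable_linked:
  assumes "transformable M D D'" "Omega8 \<notin> M"
  shows "linked D' \<longleftrightarrow> linked D"
  using assms(1) unfolding transformable_def
proof (induction rule: rtranclp_induct)
  case (step D' D'')
  then show ?case using isotopic_linked yoshikawa_move_linked assms(2) by metis
qed simp

section \<open>Local flatness of polygonal diagrams\<close>

lemma homeomorphism_restrict_open:
  fixes h :: "plane \<Rightarrow> plane"
  assumes "homeomorphism UNIV UNIV h g" "open N"
  shows "open (h ` N)" "homeomorphism N (h ` N) h g"
proof -
  show "open (h ` N)"
    using homeomorphism_imp_open_map[OF assms(1), of N] assms(2) by simp
  show "homeomorphism N (h ` N) h g"
    by (rule homeomorphism_of_subsets[OF assms(1)]) auto
qed

lemma pair_filter: "{(x, y) \<in> A. P x y} = {v \<in> A. P (fst v) (snd v)}"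
  by auto

lemma germ_open_eq:
  assumes "at p within C = at p within K" "p \<in> C" "p \<in> K"
  obtains N where "open N" "p \<in> N" "C \<inter> N = K \<inter> N"
proof -
  obtain N where N: "open N" "p \<in> N" "\<And>q. q \<in> N \<Longrightarrow> q \<noteq> p \<Longrightarrow> q \<in> C \<longleftrightarrow> q \<in> K"
    using germ_eqD[OF assms(1)] unfolding eventually_nhds by blast
  then have "C \<inter> N = K \<inter> N" using assms by blast
  with N show thesis using that by blast
qed

text \<open>A homeomorphism of the whole plane may be used: its restriction to a neighbourhood on
  which the curve coincides with the zero set is the required chart.\<close>

lemma arc_pointI:
  fixes h g :: "plane \<Rightarrow> plane"
  assumes "homeomorphism UNIV UNIV h g" "h p = (0, 0)"
    and "at p within curve D = at p within {q. snd (h q) = 0}" "p \<in> curve D"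
    and "over D p = bot" "mark D p = bot"
  shows "arc_point D p"
proof -
  obtain N where N: "open N" "p \<in> N" "curve D \<inter> N = {q. snd (h q) = 0} \<inter> N"
    using germ_open_eq[OF assms(3,4)] assms(2) by auto
  have "h ` (curve D \<inter> N) = {(x, y) \<in> h ` N. y = 0}"
  proof -
    have "{(x, y) \<in> h ` N. y = 0} = {r \<in> h ` N. snd r = 0}" by (rule pair_filter)
    also have "\<dots> = h ` ({q. snd (h q) = 0} \<inter> N)" by blast
    finally show ?thesis unfolding N(3) by simp
  qed
  then show ?thesis
    using homeomorphism_restrict_open[OF assms(1) N(1)] N assms
    unfolding arc_point_def chart_at_def by blast
qed

lemma arc_point_line:
  assumes "at p within curve D = at p within line p d" "d \<noteq> 0" "p \<in> curve D"
    and "over D p = bot" "mark D p = bot"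
  shows "arc_point D p"
proof -
  define e :: plane where "e = (- snd d, fst d)"
  have "fst d * fst d + snd d * snd d \<noteq> 0"
    using assms(2) by (cases d) (auto simp: zero_prod_def sum_squares_eq_zero_iff)
  then have ind: "indep d e" by (simp add: indep_def e_def eq_neg_iff_add_eq_0)
  show ?thesis
  proof (rule arc_pointI[OF coords_homeomorphism[OF ind] _ _ assms(3-)])
    show "coords p d e p = (0, 0)" using coords_linear(1)[OF ind, of p 0 0] by simp
    have "line p d = {q. snd (coords p d e q) = 0}"
    proof (intro set_eqI iffI)
      fix q assume "q \<in> line p d"
      then show "q \<in> {q. snd (coords p d e q) = 0}"
        using coords_linear(1)[OF ind, of p _ 0] by (auto simp: line_def)
    next
      fix q assume "q \<in> {q. snd (coords p d e q) = 0}"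
      then have "q = p + fst (coords p d e q) *\<^sub>R d" using coords_linear(2)[OF ind, of q p] by simp
      then show "q \<in> line p d" unfolding line_def by blast
    qed
    then show "at p within curve D = at p within {q. snd (coords p d e q) = 0}"
      using assms(1) by simp
  qed
qed

lemma arc_point_corner:
  assumes germ: "at p within curve D = at p within (half_line p d \<union> half_line p e)" and ind: "indep d e"
    and "p \<in> curve D" "over D p = bot" "mark D p = bot"
  shows "arc_point D p"
proof -
  \<comment> \<open>A piecewise linear homeomorphism that straightens a right angle: the boundary of
    the first quadrant is where the minimum of the coordinates vanishes, and the difference of the
    coordinates is a parameter on it.\<close>
  define b :: "plane \<Rightarrow> plane" where "b v = (fst v - snd v, min (fst v) (snd v))" for v
  define b' :: "plane \<Rightarrow> plane" where "b' v = (snd v + max (fst v) 0, snd v + max (- fst v) 0)" for v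
  have "continuous_on UNIV b" "continuous_on UNIV b'"
    unfolding b_def b'_def by (intro continuous_intros)+
  then have "homeomorphism UNIV UNIV b b'"
    by (intro homeomorphismI) (auto simp: b_def b'_def min_def max_def)
  then have hom: "homeomorphism UNIV UNIV (b \<circ> coords p d e) ((\<lambda>(x, y). p + x *\<^sub>R d + y *\<^sub>R e) \<circ> b')"
    by (rule homeomorphism_compose[OF coords_homeomorphism[OF ind]])
  show ?thesis
  proof (rule arc_pointI[OF hom _ _ assms(3-)])
    have p0: "coords p d e p = (0, 0)" using coords_linear(1)[OF ind, of p 0 0] by simp
    then show "(b \<circ> coords p d e) p = (0, 0)" by (simp add: b_def)
    have "q \<in> half_line p d \<union> half_line p e \<longleftrightarrow> snd ((b \<circ> coords p d e) q) = 0" if "q \<noteq> p" for q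
    proof -
      obtain x y where xy: "coords p d e q = (x, y)" by fastforce
      have "q \<in> half_line p d \<longleftrightarrow> 0 < x \<and> y = 0" "q \<in> half_line p e \<longleftrightarrow> 0 < y \<and> x = 0"
        by (auto simp: coords_half_line(1,3)[OF ind, symmetric] xy ray_def)
      moreover have "(x, y) \<noteq> (0, 0)"
        using that coords_linear(2)[OF ind, of q p] xy by auto
      ultimately show ?thesis by (auto simp: b_def xy min_def)
    qed
    then show "at p within curve D = at p within {q. snd ((b \<circ> coords p d e) q) = 0}"
      unfolding germ by (intro germ_eqI always_eventually) auto
  qed
qed

lemma crossing_point_germ:
  assumes "indep d e" "at p within curve D = at p within (line p d \<union> line p e)" "p \<in> curve D"
    and "over D p = at p within line p d" "mark D p = bot"
  shows "crossing_point D p"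
proof -
  obtain N where N: "open N" "p \<in> N"
    "cross_chart p (curve D) N (coords p d e ` N) (coords p d e) (\<lambda>(x, y). p + x *\<^sub>R d + y *\<^sub>R e)"
    "curve D \<inter> N = (line p d \<union> line p e) \<inter> N"
    using germ_cross_chart[OF assms(1,3,2)] by metis
  have "(\<lambda>(x, y). p + x *\<^sub>R d + y *\<^sub>R e) ` {(x, y) \<in> coords p d e ` N. y = 0} = line p d \<inter> N" (is "?L = _")
  proof (intro set_eqI iffI)
    fix q assume "q \<in> ?L"
    then have "q \<in> (\<lambda>v. p + fst v *\<^sub>R d + snd v *\<^sub>R e) ` {v \<in> coords p d e ` N. snd v = 0}"
      by (simp add: case_prod_beta pair_filter)
    then obtain v where v: "v \<in> coords p d e ` N" "snd v = 0" "q = p + fst v *\<^sub>R d + snd v *\<^sub>R e"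
      by blast
    define x where "x = fst v"
    have x: "(x, 0) \<in> coords p d e ` N" "q = p + x *\<^sub>R d" using v by (metis prod.collapse x_def, simp add: x_def)
    then obtain r where r: "r \<in> N" "(x, 0) = coords p d e r" by blast
    then have "q = r" using coords_linear(2)[OF assms(1), of r p] x by (simp flip: r(2))
    with r x show "q \<in> line p d \<inter> N" by (auto simp: line_def)
  next
    fix q assume q: "q \<in> line p d \<inter> N"
    then obtain t where t: "q = p + t *\<^sub>R d" by (auto simp: line_def)
    then have c: "coords p d e q = (t, 0)" using coords_linear(1)[OF assms(1), of p t 0] by simp
    have "(t, 0) \<in> coords p d e ` N" using imageI[of q N "coords p d e"] q c by simp
    then have "(t, 0) \<in> {(x, y) \<in> coords p d e ` N. y = 0}" by simp
    then show "q \<in> ?L" by (rule image_eqI[rotated]) (simp add: t)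
  qed
  moreover have "at p within line p d = at p within (line p d \<inter> N)"
    using N by (intro germ_local[of N]) auto
  ultimately have "over D p =
      at p within (\<lambda>(x, y). p + x *\<^sub>R d + y *\<^sub>R e) ` {(x, y) \<in> coords p d e ` N. y = 0}"
    using assms(4) by simp
  then show ?thesis
    using N(3) assms(5) unfolding crossing_point_def cross_chart_def by blast
qed

lemma vertex_point_germ:
  assumes "indep d e" "at p within curve D = at p within (line p d \<union> line p e)" "p \<in> curve D"
    and "over D p = bot" "mark D p = at p within {p + s *\<^sub>R d + t *\<^sub>R e |s t. s * t > 0}" (is "_ = at p within ?K")
  shows "vertex_point D p"
proof -
  obtain N where N: "open N" "p \<in> N"
    "cross_chart p (curve D) N (coords p d e ` N) (coords p d e) (\<lambda>(x, y). p + x *\<^sub>R d + y *\<^sub>R e)"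
    "curve D \<inter> N = (line p d \<union> line p e) \<inter> N"
    using germ_cross_chart[OF assms(1,3,2)] by metis
  have "(\<lambda>(x, y). p + x *\<^sub>R d + y *\<^sub>R e) ` {(x, y) \<in> coords p d e ` N. x * y > 0} = ?K \<inter> N" (is "?L = _")
  proof (intro set_eqI iffI)
    fix q assume "q \<in> ?L"
    then obtain x y where x: "(x, y) \<in> coords p d e ` N" "x * y > 0" "q = p + x *\<^sub>R d + y *\<^sub>R e" by auto
    then obtain r where r: "r \<in> N" "(x, y) = coords p d e r" by blast
    then have "q = r" using coords_linear(2)[OF assms(1), of r p] x by (simp flip: r(2))
    with r x show "q \<in> ?K \<inter> N" by blast
  next
    fix q assume q: "q \<in> ?K \<inter> N"
    then obtain s t where t: "q = p + s *\<^sub>R d + t *\<^sub>R e" "s * t > 0" by auto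
    then have c: "coords p d e q = (s, t)" using coords_linear(1)[OF assms(1)] by simp
    have "(s, t) \<in> coords p d e ` N" using imageI[of q N "coords p d e"] q c by simp
    then have "(s, t) \<in> {(x, y) \<in> coords p d e ` N. x * y > 0}" using t(2) by simp
    then show "q \<in> ?L" by (rule image_eqI[rotated]) (simp add: t)
  qed
  moreover have "at p within ?K = at p within (?K \<inter> N)"
    using N by (intro germ_local[of N]) auto
  ultimately have "mark D p =
      at p within (\<lambda>(x, y). p + x *\<^sub>R d + y *\<^sub>R e) ` {(x, y) \<in> coords p d e ` N. x * y > 0}"
    using assms(5) by simp
  then show ?thesis
    using N(3) assms(4) unfolding vertex_point_def cross_chart_def by blast
qed

text \<open>Independence of consecutive directions rules out backtracking and makes each interior
  corner genuine, so every inner point of the line has the germ either of a line or of a proper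
  corner.\<close>

fun simple_polyline :: "plane list \<Rightarrow> bool" where
  "simple_polyline (a # b # c # l) \<longleftrightarrow> a \<noteq> b \<and> closed_segment a b \<inter> polyline (b # c # l) \<subseteq> {b} \<and>
     indep (a - b) (c - b) \<and> simple_polyline (b # c # l)"
| "simple_polyline [a, b] \<longleftrightarrow> a \<noteq> b"
| "simple_polyline _ \<longleftrightarrow> False"

lemma simple_polyline_germ_hd:
  "simple_polyline (a # b # l) \<Longrightarrow> at a within polyline (a # b # l) = at a within half_line a (b - a)"
proof (cases l)
  case Nil
  assume "simple_polyline (a # b # l)"
  then show ?thesis using Nil by (simp add: at_within_insert segment_germ_left)
next
  case (Cons c l')
  assume "simple_polyline (a # b # l)"
  then have *: "a \<noteq> b" "closed_segment a b \<inter> polyline (b # c # l') \<subseteq> {b}" using Cons by auto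
  then have "a \<notin> polyline (b # c # l')" by auto
  then have "at a within polyline (b # c # l') = bot" by (intro at_within_eq_bot closed_polyline)
  moreover have "polyline (a # b # l) = closed_segment a b \<union> polyline (b # c # l')" by (simp add: Cons)
  ultimately show ?thesis by (simp only: at_within_union segment_germ_left[OF *(1)] sup_bot_right)
qed

lemma simple_polyline_germ:
  assumes "simple_polyline l" "p \<in> polyline l" "p \<noteq> hd l" "p \<noteq> last l"
  shows "(\<exists>d. d \<noteq> 0 \<and> at p within polyline l = at p within line p d) \<or>
    (\<exists>d e. indep d e \<and> at p within polyline l = at p within (half_line p d \<union> half_line p e))"
  using assms
proof (induction l rule: simple_polyline.induct)
  case (1 a b c l)
  let ?P = "polyline (b # c # l)"
  have *: "a \<noteq> b" "closed_segment a b \<inter> ?P \<subseteq> {b}" "indep (a - b) (c - b)" "simple_polyline (b # c # l)"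
    using 1(2) by auto
  have split: "at p within polyline (a # b # c # l) = sup (at p within closed_segment a b) (at p within ?P)"
    by (simp add: at_within_union)
  consider "p = b" | "p \<noteq> b" "p \<in> closed_segment a b" "p \<notin> ?P" | "p \<noteq> b" "p \<notin> closed_segment a b" "p \<in> ?P"
    using *(2) 1(3) by auto
  then show ?case
  proof cases
    case 1
    have "at p within polyline (a # b # c # l) = at p within (half_line p (a - b) \<union> half_line p (c - b))"
      unfolding split using 1 simple_polyline_germ_hd[OF *(4)] *(1)
      by (simp add: at_within_union segment_germ)
    with *(3) show ?thesis by blast
  next
    case 2
    then have "at p within ?P = bot" by (intro at_within_eq_bot closed_polyline)
    then have "at p within polyline (a # b # c # l) = at p within line p (b - a)"
      unfolding split using 2 * 1(4) by (simp add: segment_germ)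
    with *(1) show ?thesis by (intro disjI1 exI[of _ "b - a"]) simp
  next
    case 3
    then have "at p within closed_segment a b = bot" by (intro at_within_eq_bot) auto
    then have "at p within polyline (a # b # c # l) = at p within ?P" unfolding split by simp
    with 1(1)[OF *(4)] 3 1(5) show ?thesis by auto
  qed
next
  case (2 a b)
  then have "at p within polyline [a, b] = at p within line p (b - a)"
    by (auto simp: at_within_insert segment_germ)
  with 2 show ?case by (intro disjI1 exI[of _ "b - a"]) auto
qed auto

lemma compact_polyline: "compact (polyline l)"
  by (induction l rule: polyline.induct) auto

text \<open>Off \<open>N\<close> only one piece passes through a point, and the point is not an end
  of it, so the germ of the curve is that of a simple polygonal line. The finitely many points of
  \<open>N\<close> are covered by the hypotheses on joints, crossings and vertices.\<close>

lemma presents_marked_graph_diagram: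
  assumes pr: "presents ps N X V D"
    and simple: "\<forall>l\<in>set ps. simple_polyline l \<and> hd l \<in> set N \<and> last l \<in> set N"
    and joints: "\<forall>p\<in>set N. p \<notin> fst ` set X \<longrightarrow> p \<notin> fst ` set V \<longrightarrow> p \<in> curve D \<longrightarrow>
      (\<exists>d e. indep d e \<and> at p within curve D = at p within (half_line p d \<union> half_line p e))"
    and cr: "\<forall>(p, d, i, j)\<in>set X. over D p = at p within line p d \<and>
      (\<exists>e. indep d e \<and> at p within curve D = at p within (line p d \<union> line p e))"
    and vt: "\<forall>(p, d, e, l)\<in>set V. indep d e \<and> mark D p = at p within {p + s *\<^sub>R d + t *\<^sub>R e |s t. s * t > 0} \<and>
      at p within curve D = at p within (line p d \<union> line p e)"
  shows "marked_graph_diagram D"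
proof -
  interpret tangle D ps "set N" "over_piece X" "under_piece X" "end_piece V"
    using pr by (simp add: presents_def)
  have spec: "crossings D = fst ` set X" "vertices D = fst ` set V"
    using pr by (auto simp: presents_def)
  have bot: "over D p = bot" if "p \<notin> crossings D" for p using that by (simp add: crossings_def)
  have bot': "mark D p = bot" if "p \<notin> vertices D" for p using that by (simp add: vertices_def)
  have sub: "crossings D \<subseteq> curve D" "vertices D \<subseteq> curve D"
  proof -
    show "crossings D \<subseteq> curve D"
    proof
      fix p assume "p \<in> crossings D"
      then show "p \<in> curve D" unfolding curve_eq using crossing[of p] by blast
    qed
    show "vertices D \<subseteq> curve D"
    proof
      fix p assume "p \<in> vertices D"
      moreover have "(1, 0) \<in> axes" by (simp add: axes_def)
      ultimately show "p \<in> curve D" unfolding curve_eq using vertex[of p] by blast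
    qed
  qed
  have "arc_point D p" if p: "p \<in> curve D" "p \<notin> crossings D" "p \<notin> vertices D" for p
  proof (cases "p \<in> set N")
    case True
    then obtain d e where "indep d e" "at p within curve D = at p within (half_line p d \<union> half_line p e)"
      using joints p spec by auto
    then show ?thesis using arc_point_corner p bot bot' by blast
  next
    case False
    obtain i where i: "i < length ps" "p \<in> polyline (ps ! i)" using p(1) unfolding curve_eq by auto
    have other: "at p within polyline (ps ! j) = bot" if "j < length ps" "j \<noteq> i" for j
    proof -
      have "p \<notin> polyline (ps ! j)"
        using meet[of i j] meet[of j i] i that False by (cases i j rule: linorder_cases) auto
      then show ?thesis by (intro at_within_eq_bot closed_polyline)
    qed
    have "eventually P (at p within curve D) \<longleftrightarrow> eventually P (at p within polyline (ps ! i))" for P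
    proof -
      have "eventually P (at p within curve D) \<longleftrightarrow> (\<forall>j<length ps. eventually P (at p within polyline (ps ! j)))"
        unfolding curve_eq by (auto simp: eventually_at_within_UN)
      also have "\<dots> \<longleftrightarrow> eventually P (at p within polyline (ps ! i))"
        using i(1) other by (metis eventually_bot)
      finally show ?thesis .
    qed
    then have germ: "at p within curve D = at p within polyline (ps ! i)" by (simp add: filter_eq_iff)
    have "ps ! i \<in> set ps" using i by simp
    then have "simple_polyline (ps ! i)" "p \<noteq> hd (ps ! i)" "p \<noteq> last (ps ! i)"
      using simple False by auto
    from simple_polyline_germ[OF this(1) i(2) this(2,3)] show ?thesis
      unfolding germ[symmetric]
    proof (elim disjE exE conjE)
      fix d assume "d \<noteq> 0" "at p within curve D = at p within line p d"
      then show ?thesis using arc_point_line p bot bot' by blast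
    next
      fix d e assume "indep d e" "at p within curve D = at p within (half_line p d \<union> half_line p e)"
      then show ?thesis using arc_point_corner p bot bot' by blast
    qed
  qed
  moreover have "crossing_point D p" if p: "p \<in> crossings D" for p
  proof -
    obtain d i j where x: "(p, d, i, j) \<in> set X" using p spec by auto
    have "mark D p = bot" using p special bot' by blast
    then show ?thesis using bspec[OF cr x, unfolded prod.case] sub p crossing_point_germ by blast
  qed
  moreover have "vertex_point D p" if p: "p \<in> vertices D" for p
  proof -
    obtain d e l where x: "(p, d, e, l) \<in> set V" using p spec by auto
    have "over D p = bot" using p special bot by blast
    then show ?thesis using bspec[OF vt x, unfolded prod.case] sub p vertex_point_germ by blast
  qed
  moreover have "compact (curve D)"
    unfolding curve_eq by (intro compact_UN) (auto simp: compact_polyline)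
  moreover have "finite (crossings D)" "finite (vertices D)" using spec by auto
  ultimately show ?thesis
    unfolding marked_graph_diagram_def using sub bot bot' by blast
qed

section \<open>Two diagrams related by the eighth move\<close>

text \<open>The first four lines are the strands of \<open>Omega8\<close>, and \<open>d\<close> is
  the over direction at its four crossings. The other four lines close both bands to figure eights.
  Each closing arc of the horizontal band meets each closing arc of the vertical band once, at a
  point \<open>(\<plusminus>5, \<plusminus>5)\<close>, and the listed direction there, of slope 4 or
  -4, puts the horizontal band on top.\<close>

definition crossing_bands :: "plane \<Rightarrow> diagram" where
  "crossing_bands d = picture
     [[(-4, 1), (2, 1), (4, -1)], [(-4, -1), (2, -1), (4, 1)],
      [(-1, -4), (-1, 2), (1, 4)], [(1, -4), (1, 2), (-1, 4)],
      [(4, 1), (6, 9), (-6, 9), (-4, 1)], [(4, -1), (6, -9), (-6, -9), (-4, -1)],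
      [(1, 4), (9, 6), (9, -6), (1, -4)], [(-1, 4), (-9, 6), (-9, -6), (-1, -4)]]
     [((-1, -1), d), ((-1, 1), d), ((1, -1), d), ((1, 1), d),
      ((5, 5), (1, 4)), ((-5, 5), (-1, 4)), ((5, -5), (1, -4)), ((-5, -5), (-1, -4))]
     [((3, 0), (1, 1), (1, -1)), ((0, 3), (1, 1), (1, -1))]"

text \<open>Pieces 0, 2 and pieces 1, 3 form the two loops of the horizontal band; pieces 5, 6 and
  pieces 4, 7 form those of the vertical band.\<close>

definition band_pieces :: "plane list list" where
  "band_pieces =
     [[(-4, 1), (2, 1), (3, 0)], [(-4, -1), (2, -1), (3, 0)],
      [(3, 0), (4, 1), (6, 9), (-6, 9), (-4, 1)], [(3, 0), (4, -1), (6, -9), (-6, -9), (-4, -1)],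
      [(-1, -4), (-1, 2), (0, 3)], [(1, -4), (1, 2), (0, 3)],
      [(0, 3), (1, 4), (9, 6), (9, -6), (1, -4)], [(0, 3), (-1, 4), (-9, 6), (-9, -6), (-1, -4)]]"

definition band_points :: "plane list" where
  "band_points = [(-1, -1), (-1, 1), (1, -1), (1, 1), (5, 5), (-5, 5), (5, -5), (-5, -5), (3, 0), (0, 3),
     (-4, 1), (-4, -1), (-1, -4), (1, -4)]"

definition band_vertices :: "(plane \<times> plane \<times> plane \<times> nat list) list" where
  "band_vertices = [((3, 0), (1, 1), (1, -1), [2, 1, 3, 0]), ((0, 3), (1, 1), (1, -1), [6, 4, 5, 7])]"

definition outer_crossings :: "(plane \<times> plane \<times> nat \<times> nat) list" where
  "outer_crossings = [((5, 5), (1, 4), 2, 6), ((-5, 5), (-1, 4), 2, 7),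
     ((5, -5), (1, -4), 3, 6), ((-5, -5), (-1, -4), 3, 7)]"

definition inner_crossings :: "plane \<Rightarrow> (plane \<times> plane \<times> nat \<times> nat) list" where
  "inner_crossings d = map (\<lambda>(p, i, j). (p, d, if d = (1, 0) then (i, j) else (j, i)))
     [((-1, -1), 1, 4), ((-1, 1), 0, 4), ((1, -1), 1, 5), ((1, 1), 0, 5)]"

lemma crossing_bands_presents:
  assumes "d \<in> {(1, 0), (0, 1)}"
  shows "presents band_pieces band_points (inner_crossings d @ outer_crossings) band_vertices (crossing_bands d)"
  unfolding crossing_bands_def
proof (rule presents_pictureI, goal_cases)
  case 1 then show ?case using assms by (auto simp: inner_crossings_def outer_crossings_def)
next
  case 2 then show ?case by (simp add: band_vertices_def)
next
  case 3 then show ?case unfolding band_pieces_def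
    by (simp add: piece_simps) (intro conjI allI; argo)
next
  case 4 then show ?case by (simp add: band_pieces_def)
next
  case 5 then show ?case unfolding band_pieces_def band_points_def
    by (simp add: piece_simps) (intro conjI allI; argo)
next
  case 6 then show ?case using assms
    by (auto simp: inner_crossings_def outer_crossings_def band_vertices_def band_points_def)
next
  case 7 then show ?case using assms
    by (auto simp: inner_crossings_def outer_crossings_def band_vertices_def)
next
  case 8 then show ?case using assms unfolding inner_crossings_def outer_crossings_def band_pieces_def
    by (elim insertE emptyE; simp add: piece_simps germ_simps zero_prod_def; auto intro!: line_germ_eq simp: zero_prod_def)
next
  case 9 then show ?case unfolding band_vertices_def band_pieces_def
    by (simp add: piece_simps germ_simps indep_def; auto intro!: half_line_germ_eq simp: zero_prod_def)
qed

text \<open>Brings the differences of end points produced by \<open>segment_germ\<close> to the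
  directions used in the pictures.\<close>

lemma line_germ_scale:
  "at p within line p (6, 0) = at p within line p (1, 0)"
  "at p within line p (0, 6) = at p within line p (0, 1)"
  "at p within line p (2, 8) = at p within line p (1, 4)"
  "at p within line p (-1, -4) = at p within line p (1, 4)"
  "at p within line p (2, -8) = at p within line p (1, -4)"
  "at p within line p (-1, 4) = at p within line p (1, -4)"
  "at p within line p (8, 2) = at p within line p (4, 1)"
  "at p within line p (-8, 2) = at p within line p (4, -1)"
  "at p within line p (2, 2) = at p within line p (1, 1)"
  "at p within line p (2, -2) = at p within line p (1, -1)"
  "at p within line p (-2, 2) = at p within line p (1, -1)"
  by (auto intro!: line_germ_eq simp: zero_prod_def)

lemmas crossing_bands_simps = crossing_bands_def at_within_insert at_within_union segment_germ
  mem_closed_segment_plane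

lemma crossing_bands_joint_germ:
  "at (-4, 1) within curve (crossing_bands d) =
    at (-4, 1) within (half_line (-4, 1) (6, 0) \<union> half_line (-4, 1) (-2, 8))"
  "at (-4, -1) within curve (crossing_bands d) =
    at (-4, -1) within (half_line (-4, -1) (6, 0) \<union> half_line (-4, -1) (-2, -8))"
  "at (-1, -4) within curve (crossing_bands d) =
    at (-1, -4) within (half_line (-1, -4) (0, 6) \<union> half_line (-1, -4) (-8, -2))"
  "at (1, -4) within curve (crossing_bands d) =
    at (1, -4) within (half_line (1, -4) (0, 6) \<union> half_line (1, -4) (8, -2))"
  by (simp_all add: crossing_bands_simps sup_commute)

lemma crossing_bands_inner_germ:
  "p \<in> {(1, 1), (1, -1), (-1, 1), (-1, -1)} \<Longrightarrow>
    at p within curve (crossing_bands d) = at p within (line p (1, 0) \<union> line p (0, 1))"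
  by (elim insertE emptyE; simp add: crossing_bands_simps; simp add: line_germ_scale sup_commute)+

lemma crossing_bands_outer_germ:
  "p \<in> {(5, 5), (-5, -5)} \<Longrightarrow>
    at p within curve (crossing_bands d) = at p within (line p (1, 4) \<union> line p (4, 1))"
  "p \<in> {(5, -5), (-5, 5)} \<Longrightarrow>
    at p within curve (crossing_bands d) = at p within (line p (1, -4) \<union> line p (4, -1))"
  by (elim insertE emptyE; simp add: crossing_bands_simps; simp add: line_germ_scale sup_commute)+

lemma crossing_bands_vertex_germ:
  "p \<in> {(3, 0), (0, 3)} \<Longrightarrow>
    at p within curve (crossing_bands d) = at p within (line p (1, 1) \<union> line p (1, -1))"
  by (elim insertE emptyE; simp add: crossing_bands_simps; simp add: line_germ_scale sup_commute)+

lemma crossing_bands_marked_graph_diagram: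
  assumes "d \<in> {(1, 0), (0, 1)}"
  shows "marked_graph_diagram (crossing_bands d)"
proof (rule presents_marked_graph_diagram[OF crossing_bands_presents[OF assms]], goal_cases)
  case 1 then show ?case unfolding band_pieces_def band_points_def
    by (simp add: piece_simps indep_def) (intro conjI allI; argo)
next
  case 2
  have "indep (6, 0) (-2, 8)" "indep (6, 0) (-2, -8)" "indep (0, 6) (-8, -2)" "indep (0, 6) (8, -2)"
    by (simp_all add: indep_def)
  note ind = this
  show ?case
  proof (intro ballI impI)
    fix p
    assume "p \<in> set band_points" "p \<notin> fst ` set (inner_crossings d @ outer_crossings)"
      "p \<notin> fst ` set band_vertices"
    moreover have "fst ` set (inner_crossings d @ outer_crossings) =
        {(-1, -1), (-1, 1), (1, -1), (1, 1), (5, 5), (-5, 5), (5, -5), (-5, -5)}"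
      unfolding inner_crossings_def outer_crossings_def by simp
    moreover have "fst ` set band_vertices = {(3, 0), (0, 3)}" unfolding band_vertices_def by simp
    ultimately consider "p = (-4, 1)" | "p = (-4, -1)" | "p = (-1, -4)" | "p = (1, -4)"
      unfolding band_points_def by (simp only: list.set) blast
    then show "\<exists>d' e. indep d' e \<and>
        at p within curve (crossing_bands d) = at p within (half_line p d' \<union> half_line p e)"
    proof cases
      case 1
      show ?thesis using ind(1) crossing_bands_joint_germ(1)[of d] unfolding 1 by blast
    next
      case 2
      show ?thesis using ind(2) crossing_bands_joint_germ(2)[of d] unfolding 2 by blast
    next
      case 3
      show ?thesis using ind(3) crossing_bands_joint_germ(3)[of d] unfolding 3 by blast
    next
      case 4
      show ?thesis using ind(4) crossing_bands_joint_germ(4)[of d] unfolding 4 by blast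
    qed
  qed
next
  case 3
  have ind: "indep (1, 0) (0, 1)" "indep (0, 1) (1, 0)" "indep (1, 4) (4, 1)" "indep (-1, 4) (4, -1)"
    "indep (1, -4) (4, -1)" "indep (-1, -4) (4, 1)"
    by (simp_all add: indep_def)
  show ?case
  proof (intro ballI, clarify, intro conjI)
    fix p e i j
    assume "(p, e, i, j) \<in> set (inner_crossings d @ outer_crossings)"
    then have *: "p \<in> {(1, 1), (1, -1), (-1, 1), (-1, -1)} \<and> e = d \<or> p = (5, 5) \<and> e = (1, 4) \<or>
      p = (-5, 5) \<and> e = (-1, 4) \<or> p = (5, -5) \<and> e = (1, -4) \<or> p = (-5, -5) \<and> e = (-1, -4)"
      by (auto simp: inner_crossings_def outer_crossings_def)
    then show "over (crossing_bands d) p = at p within line p e"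
      by (elim disjE conjE insertE emptyE; simp add: crossing_bands_def over_picture)
    consider "p \<in> {(1, 1), (1, -1), (-1, 1), (-1, -1)}" "e = (1, 0) \<or> e = (0, 1)"
      | "p \<in> {(5, 5), (-5, -5)}" "e = (1, 4) \<or> e = (-1, -4)"
      | "p \<in> {(5, -5), (-5, 5)}" "e = (1, -4) \<or> e = (-1, 4)"
      using * assms by blast
    then show "\<exists>e'. indep e e' \<and>
        at p within curve (crossing_bands d) = at p within (line p e \<union> line p e')"
    proof cases
      case 1
      have "at p within curve (crossing_bands d) = at p within (line p (0, 1) \<union> line p (1, 0))"
        using crossing_bands_inner_germ[OF 1(1), of d] by (simp only: Un_commute)
      with crossing_bands_inner_germ[OF 1(1), of d] 1(2) ind(1,2) show ?thesis by blast
    next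
      case 2
      have "at p within curve (crossing_bands d) = at p within (line p (-1, -4) \<union> line p (4, 1))"
        using crossing_bands_outer_germ(1)[OF 2(1), of d] by (simp add: at_within_union line_germ_scale)
      with crossing_bands_outer_germ(1)[OF 2(1), of d] 2(2) ind(3,6) show ?thesis by blast
    next
      case 3
      have "at p within curve (crossing_bands d) = at p within (line p (-1, 4) \<union> line p (4, -1))"
        using crossing_bands_outer_germ(2)[OF 3(1), of d] by (simp add: at_within_union line_germ_scale)
      with crossing_bands_outer_germ(2)[OF 3(1), of d] 3(2) ind(4,5) show ?thesis by blast
    qed
  qed
next
  case 4
  show ?case
  proof (intro ballI, clarify, intro conjI)
    fix p e e' l
    assume "(p, e, e', l) \<in> set band_vertices"
    then have *: "p = (3, 0) \<or> p = (0, 3)" "e = (1, 1)" "e' = (1, -1)"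
      by (auto simp: band_vertices_def)
    show "indep e e'" using * by (simp add: indep_def)
    show "mark (crossing_bands d) p = at p within {p + s *\<^sub>R e + t *\<^sub>R e' |s t. 0 < s * t}"
      using * by (elim disjE; simp add: crossing_bands_def mark_picture)
    show "at p within curve (crossing_bands d) = at p within (line p e \<union> line p e')"
      using * crossing_bands_vertex_germ[of p d] by blast
  qed
qed

text \<open>A loop of the horizontal band and a loop of the vertical band meet in one inner and one
  outer crossing. Here the horizontal band is on top in both, so the two are counted together;
  crossings inside one band do not occur.\<close>

lemma crossing_bands_not_linked: "\<not> linked (crossing_bands (1, 0))"
  unfolding presents_linked_iff[OF crossing_bands_presents[OF insertI1]]
  apply (simp add: edge_colouring_def linking_list_def balanced4_def piece_simps
      inner_crossings_def outer_crossings_def band_vertices_def band_pieces_def band_points_def numeral_eq_Suc)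
  apply (auto simp flip: numeral_2_eq_2)
  done

lemma crossing_bands_linked: "linked (crossing_bands (0, 1))"
proof -
  have d: "(0, 1) \<in> {(1, 0), (0, 1::real)}" by simp
  show ?thesis
    unfolding presents_linked_iff[OF crossing_bands_presents[OF d]]
    \<comment> \<open>The cycles are the loop of pieces 0, 2 and the loop of pieces 5, 6. They meet
      at \<open>(1, 1)\<close>, where the second one is now on top, and at \<open>(5, 5)\<close>,
      which is the only crossing counted.\<close>
    apply (intro exI[of _ "\<lambda>i. [(True, True), (True, False), (True, True), (True, False),
       (False, False), (False, True), (False, True), (False, False)] ! i"])
    apply (simp add: edge_colouring_def linking_list_def balanced4_def piece_simps
        inner_crossings_def outer_crossings_def band_vertices_def band_pieces_def band_points_def)
    done
qed

text \<open>Both diagrams already have the standard pictures in the square, so the constant isotopy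
  serves.\<close>

lemma local_move_identity:
  assumes "restrict_to square D = T" "restrict_to square D' = T'"
    "restrict_to (- square) D = restrict_to (- square) D'"
  shows "local_move T T' D D'"
proof -
  have "homeomorphism UNIV UNIV (\<lambda>x. x) (\<lambda>x::plane. x)" by (rule homeomorphism_ident)
  then have "ambient_isotopy (\<lambda>t x::plane. x)"
    by (auto simp: ambient_isotopy_def case_prod_beta intro!: continuous_intros)
  moreover have "transform (\<lambda>x. x) E = E" for E
    by (cases E) (simp add: transform_def inv_id[unfolded id_def] filtermap_ident)
  ultimately show ?thesis
    using assms unfolding local_move_def replaced_via_def by (intro exI[of _ "\<lambda>t x. x"]) simp
qed

lemma restrict_picture_inside:
  assumes "(\<Union>l\<in>set (ls @ ls'). polyline l) \<inter> A = (\<Union>l\<in>set ls. polyline l)"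
    and "fst ` set xs \<subseteq> A" "fst ` set vs \<subseteq> A" "fst ` set xs' \<inter> A = {}"
  shows "restrict_to A (picture (ls @ ls') (xs @ xs') vs) = picture ls xs vs"
proof -
  have 1: "map_of xs' p = None" if "p \<in> A" for p
    using assms(4) that by (metis disjoint_iff map_of_eq_None_iff)
  have 2: "map_of xs p = None" "map_of vs p = None" if "p \<notin> A" for p
    using assms(2,3) that by (auto simp: map_of_eq_None_iff)
  show ?thesis
    using assms(1) 1 2
    by (simp add: restrict_to_def picture_def fun_eq_iff map_add_def split: option.split)
qed

lemma restrict_picture_outside:
  assumes "fst ` set xs \<subseteq> A" "fst ` set ys \<subseteq> A"
  shows "restrict_to (- A) (picture ls (xs @ xs') vs) = restrict_to (- A) (picture ls (ys @ xs') vs)"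
proof -
  have "map_of xs p = None" "map_of ys p = None" if "p \<notin> A" for p
    using assms that by (auto simp: map_of_eq_None_iff)
  then show ?thesis
    by (simp add: restrict_to_def picture_def fun_eq_iff map_add_def)
qed

lemma crossing_bands_move: "yoshikawa_move Omega8 (crossing_bands (1, 0)) (crossing_bands (0, 1))"
proof -
  let ?ls = "[[(-4, 1), (2, 1), (4, -1)], [(-4, -1), (2, -1), (4, 1)],
      [(-1, -4), (-1, 2), (1, 4)], [(1, -4), (1, 2), (-1, 4)]] :: plane list list"
  let ?ls' = "[[(4, 1), (6, 9), (-6, 9), (-4, 1)], [(4, -1), (6, -9), (-6, -9), (-4, -1)],
      [(1, 4), (9, 6), (9, -6), (1, -4)], [(-1, 4), (-9, 6), (-9, -6), (-1, -4)]] :: plane list list"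
  let ?xs = "\<lambda>d. [((-1, -1), d), ((-1, 1), d), ((1, -1), d), ((1, 1), d)] :: (plane \<times> plane) list"
  let ?xs' = "[((5, 5), (1, 4)), ((-5, 5), (-1, 4)), ((5, -5), (1, -4)), ((-5, -5), (-1, -4))]
      :: (plane \<times> plane) list"
  let ?vs = "[((3, 0), (1, 1), (1, -1)), ((0, 3), (1, 1), (1, -1))] :: (plane \<times> plane \<times> plane) list"
  have eq: "crossing_bands d = picture (?ls @ ?ls') (?xs d @ ?xs') ?vs" for d
    by (simp add: crossing_bands_def)
  have "restrict_to square (crossing_bands d) = picture ?ls (?xs d) ?vs" for d
    unfolding eq
  proof (rule restrict_picture_inside)
    show "(\<Union>l\<in>set (?ls @ ?ls'). polyline l) \<inter> square = (\<Union>l\<in>set ?ls. polyline l)"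
      by (simp add: piece_simps square_def) (intro conjI allI; argo)
  qed (simp_all add: square_def)
  moreover have "restrict_to (- square) (crossing_bands (1, 0)) = restrict_to (- square) (crossing_bands (0, 1))"
    unfolding eq by (rule restrict_picture_outside) (simp_all add: square_def)
  ultimately have "local_move (picture ?ls (?xs (1, 0)) ?vs) (picture ?ls (?xs (0, 1)) ?vs)
      (crossing_bands (1, 0)) (crossing_bands (0, 1))"
    by (intro local_move_identity)
  then show ?thesis
    using crossing_bands_marked_graph_diagram by (simp add: yoshikawa_move_def)
qed

section \<open>Trivial links\<close>

lemma ambient_isotopyI:
  fixes H G :: "real \<Rightarrow> 'a \<Rightarrow> 'a::topological_space"
  assumes "continuous_on ({0..1} \<times> UNIV) (\<lambda>(t, x). H t x)"
    and "\<And>t. t \<in> {0..1} \<Longrightarrow> continuous_on UNIV (G t)"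
    and "\<And>t x. t \<in> {0..1} \<Longrightarrow> G t (H t x) = x" "\<And>t x. t \<in> {0..1} \<Longrightarrow> H t (G t x) = x"
    and "\<And>x. H 0 x = x"
  shows "ambient_isotopy H"
  unfolding ambient_isotopy_def
proof (intro conjI ballI allI)
  fix t :: real assume t: "t \<in> {0..1}"
  have "continuous_on UNIV (\<lambda>x. (\<lambda>(t, x). H t x) (t, x))"
    by (rule continuous_on_compose2[OF assms(1)]) (use t in \<open>auto intro!: continuous_intros\<close>)
  then have "homeomorphism UNIV UNIV (H t) (G t)"
    using assms(2-4) t by (intro homeomorphismI) auto
  then show "\<exists>g. homeomorphism UNIV UNIV (H t) g" by blast
qed (use assms in auto)

lemma ambient_isotopy_compose:
  assumes "ambient_isotopy H" "ambient_isotopy H'"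
  shows "ambient_isotopy (\<lambda>t x. H' t (H t x))"
  unfolding ambient_isotopy_def
proof (intro conjI ballI allI)
  have c: "continuous_on ({0..1} \<times> UNIV) (\<lambda>(t, x). H t x)" "continuous_on ({0..1} \<times> UNIV) (\<lambda>(t, x). H' t x)"
    using assms by (auto simp: ambient_isotopy_def)
  have "continuous_on ({0..1} \<times> UNIV) (\<lambda>z. (\<lambda>(t, x). H' t x) (fst z, (\<lambda>(t, x). H t x) z))"
    by (rule continuous_on_compose2[OF c(2)]) (auto intro!: continuous_intros c(1))
  then show "continuous_on ({0..1} \<times> UNIV) (\<lambda>(t, x). H' t (H t x))"
    by (simp add: case_prod_beta)
  show "H' 0 (H 0 x) = x" for x using assms by (simp add: ambient_isotopy_def)
  fix t :: real assume "t \<in> {0..1}"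
  then obtain g g' where "homeomorphism UNIV UNIV (H t) g" "homeomorphism UNIV UNIV (H' t) g'"
    using assms unfolding ambient_isotopy_def by blast
  then have "homeomorphism UNIV UNIV (H' t \<circ> H t) (g \<circ> g')" by (rule homeomorphism_compose)
  then show "\<exists>g. homeomorphism UNIV UNIV (\<lambda>x. H' t (H t x)) g" by (auto simp: o_def)
qed

lemma trivial_link_isotopic:
  assumes "ambient_isotopy H" "trivial_link (H 1 ` S)"
  shows "trivial_link S"
proof -
  obtain H' where "ambient_isotopy H'" "H' 1 ` H 1 ` S \<subseteq> UNIV \<times> {0}"
    using assms(2) by (auto simp: trivial_link_def)
  with ambient_isotopy_compose[OF assms(1)] show ?thesis
    unfolding trivial_link_def by (intro exI[of _ "\<lambda>t x. H' t (H t x)"]) (auto simp: image_image)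
qed

lemma ambient_isotopy_lift:
  fixes \<psi> :: "plane \<Rightarrow> real"
  assumes "continuous_on UNIV \<psi>"
  shows "ambient_isotopy (\<lambda>t v. (fst v, snd v + t * \<psi> (fst v)))"
proof (rule ambient_isotopyI[where G = "\<lambda>t v. (fst v, snd v - t * \<psi> (fst v))"])
  have c: "continuous_on A (\<lambda>x. \<psi> (f x))" if "continuous_on A f" for A :: "'x::topological_space set" and f
    using continuous_on_compose2[OF assms that] by auto
  show "continuous_on ({0..1} \<times> UNIV) (\<lambda>(t, v). (fst v, snd v + t * \<psi> (fst v)))"
    unfolding case_prod_beta by (intro continuous_intros c)
  show "continuous_on UNIV (\<lambda>v. (fst v, snd v - t * \<psi> (fst v)))" for t
    by (intro continuous_intros c)
qed auto

lemma ambient_isotopy_shear: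
  fixes \<phi> :: "real \<Rightarrow> plane"
  assumes "continuous_on UNIV \<phi>"
  shows "ambient_isotopy (\<lambda>t v. (fst v + t *\<^sub>R \<phi> (snd v), snd v))"
proof (rule ambient_isotopyI[where G = "\<lambda>t v. (fst v - t *\<^sub>R \<phi> (snd v), snd v)"])
  have c: "continuous_on A (\<lambda>x. \<phi> (f x))" if "continuous_on A f" for A :: "'x::topological_space set" and f
    using continuous_on_compose2[OF assms that] by auto
  show "continuous_on ({0..1} \<times> UNIV) (\<lambda>(t, v). (fst v + t *\<^sub>R \<phi> (snd v), snd v))"
    unfolding case_prod_beta by (intro continuous_intros c)
  show "continuous_on UNIV (\<lambda>v. (fst v - t *\<^sub>R \<phi> (snd v), snd v))" for t
    by (intro continuous_intros c)
qed auto

text \<open>The height function extends to the whole plane by Tietze's theorem, and subtracting the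
  extension gradually is an isotopy of space that flattens the graph.\<close>

lemma trivial_link_graph:
  fixes u :: "plane \<Rightarrow> real"
  assumes "closed K" "continuous_on K u"
  shows "trivial_link ((\<lambda>p. (p, u p)) ` K)"
proof -
  have "closedin (top_of_set UNIV) K" using assms(1) by simp
  then obtain \<psi> where \<psi>: "continuous_on UNIV \<psi>" "\<And>p. p \<in> K \<Longrightarrow> \<psi> p = u p"
    using Tietze_unbounded[OF assms(2)] by blast
  have "continuous_on UNIV (\<lambda>p. - \<psi> p)" by (intro continuous_intros \<psi>(1))
  from ambient_isotopy_lift[OF this] show ?thesis
    unfolding trivial_link_def
    by (intro exI[of _ "\<lambda>t v. (fst v, snd v + t * - \<psi> (fst v))"]) (auto simp: \<psi>(2))
qed

lemma layer_eq: "K \<times> {c} = (\<lambda>p. (p, c)) ` K"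
  by auto

text \<open>A lift brings the upper layer to constant height 1, a shear then moves it sideways until
  its projection is disjoint from that of the lower layer, and what remains is the graph of a
  continuous function.\<close>

lemma trivial_link_layers:
  assumes K: "compact K" "compact K'" and a: "continuous_on K a" "\<And>p. p \<in> K \<inter> K' \<Longrightarrow> a p = 1"
  shows "trivial_link ((\<lambda>p. (p, a p)) ` K \<union> K' \<times> {0})"
proof -
  have cl: "closed K" "closed K'" using K compact_imp_closed by auto
  \<comment> \<open>A lift moves all points over \<open>p\<close> by the same amount. As
    \<open>a\<close> equals 1 over the common points of the projections, the correction vanishes
    there and leaves the lower layer fixed.\<close>
  have "continuous_on (K \<union> K') (\<lambda>p. if p \<in> K then 1 - a p else 0)"
    by (rule continuous_on_If) (use cl a in \<open>auto intro!: continuous_intros\<close>)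
  moreover have "closedin (top_of_set UNIV) (K \<union> K')" using cl by (simp add: closed_Un)
  ultimately obtain \<psi> where \<psi>: "continuous_on UNIV \<psi>"
      "\<And>p. p \<in> K \<union> K' \<Longrightarrow> \<psi> p = (if p \<in> K then 1 - a p else 0)"
    using Tietze_unbounded by blast
  have 1: "(\<lambda>v. (fst v, snd v + 1 * \<psi> (fst v))) ` ((\<lambda>p. (p, a p)) ` K \<union> K' \<times> {0}) = K \<times> {1} \<union> K' \<times> {0}"
  proof -
    have "\<psi> p = 1 - a p" if "p \<in> K" for p using \<psi>(2) that by simp
    moreover have "\<psi> p = 0" if "p \<in> K'" for p using \<psi>(2) a(2) that by simp
    ultimately show ?thesis by (simp add: layer_eq image_Un image_image cong: image_cong)
  qed
  obtain B where B: "\<And>p. p \<in> K \<Longrightarrow> norm p \<le> B" "\<And>p. p \<in> K' \<Longrightarrow> norm p \<le> B"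
  proof -
    have "bounded (K \<union> K')" using K compact_imp_bounded by auto
    then obtain B where "\<forall>p\<in>K \<union> K'. norm p \<le> B" unfolding bounded_iff by blast
    with that show thesis by blast
  qed
  \<comment> \<open>Longer than twice the bound on both projections, so the translate of
    \<open>K\<close> by \<open>w\<close> misses \<open>K'\<close>.\<close>
  define w :: plane where "w = (2 * \<bar>B\<bar> + 1, 0)"
  have w: "norm w = 2 * \<bar>B\<bar> + 1" by (simp add: w_def norm_Pair)
  define \<phi> where "\<phi> z = max 0 (min 1 z) *\<^sub>R w" for z :: real
  have \<phi>: "continuous_on UNIV \<phi>" unfolding \<phi>_def by (intro continuous_intros)
  define M where "M = (\<lambda>p. p + w) ` K"
  have 2: "(\<lambda>v. (fst v + 1 *\<^sub>R \<phi> (snd v), snd v)) ` (K \<times> {1} \<union> K' \<times> {0}) = M \<times> {1} \<union> K' \<times> {0}"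
    by (simp add: layer_eq image_Un image_image \<phi>_def M_def)
  have disj: "p \<notin> K'" if pM: "p \<in> M" for p
  proof
    assume "p \<in> K'"
    obtain q where q: "q \<in> K" "p = q + w" using pM unfolding M_def by blast
    have "norm w \<le> norm p + norm q" using norm_triangle_ineq4[of p q] q by simp
    then show False using B(1)[OF q(1)] B(2)[OF \<open>p \<in> K'\<close>] w by linarith
  qed
  have clM: "closed M" unfolding M_def using cl(1) by (simp add: closed_translation add.commute[of _ w])
  have "continuous_on (M \<union> K') (\<lambda>p. if p \<in> M then 1 else 0 :: real)"
    by (rule continuous_on_If) (use clM cl disj in \<open>auto intro!: continuous_intros\<close>)
  then have "trivial_link ((\<lambda>p. (p, if p \<in> M then 1 else 0)) ` (M \<union> K'))"
    using clM cl by (intro trivial_link_graph) auto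
  moreover have "(\<lambda>p. (p, if p \<in> M then 1 else 0)) ` (M \<union> K') = M \<times> {1::real} \<union> K' \<times> {0}"
  proof -
    have "p \<in> K' \<Longrightarrow> p \<notin> M" for p using disj by blast
    then show ?thesis by (simp add: layer_eq image_Un cong: image_cong)
  qed
  ultimately have "trivial_link (M \<times> {1} \<union> K' \<times> {0})" by (simp only:)
  then have "trivial_link (K \<times> {1} \<union> K' \<times> {0})"
    by - (rule trivial_link_isotopic[OF ambient_isotopy_shear[OF \<phi>]], simp only: 2)
  then show ?thesis
    by - (rule trivial_link_isotopic[OF ambient_isotopy_lift[OF \<psi>(1)]], simp only: 1)
qed

text \<open>The map is a half turn of space about the diagonal of the projection plane. It preserves
  that plane, so conjugating the isotopy by it works.\<close>

lemma trivial_link_swap: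
  assumes "trivial_link S"
  shows "trivial_link ((\<lambda>v. (prod.swap (fst v), - snd v)) ` S)"
proof -
  define \<rho> :: "plane \<times> real \<Rightarrow> plane \<times> real" where "\<rho> v = (prod.swap (fst v), - snd v)" for v
  have \<rho>\<rho>: "\<rho> (\<rho> v) = v" for v by (simp add: \<rho>_def)
  have c\<rho>: "continuous_on A \<rho>" for A
    unfolding \<rho>_def prod.swap_def by (intro continuous_intros)
  obtain H where H: "ambient_isotopy H" "H 1 ` S \<subseteq> UNIV \<times> {0}"
    using assms by (auto simp: trivial_link_def)
  have "ambient_isotopy (\<lambda>t v. \<rho> (H t (\<rho> v)))"
    unfolding ambient_isotopy_def
  proof (intro conjI ballI allI)
    have c: "continuous_on ({0..1} \<times> UNIV) (\<lambda>(t, x). H t x)"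
      using H(1) by (simp add: ambient_isotopy_def)
    have "continuous_on ({0..1} \<times> UNIV) (\<lambda>z. (\<lambda>(t, x). H t x) (fst z, \<rho> (snd z)))"
      by (rule continuous_on_compose2[OF c]) (auto intro!: continuous_intros continuous_on_compose2[OF c\<rho>])
    then show "continuous_on ({0..1} \<times> UNIV) (\<lambda>(t, v). \<rho> (H t (\<rho> v)))"
      by (auto simp: case_prod_beta intro!: continuous_on_compose2[OF c\<rho>])
    show "\<rho> (H 0 (\<rho> v)) = v" for v using H(1) by (simp add: ambient_isotopy_def \<rho>\<rho>)
    fix t :: real assume "t \<in> {0..1}"
    then obtain g where g: "homeomorphism UNIV UNIV (H t) g" using H(1) unfolding ambient_isotopy_def by blast
    have r: "homeomorphism UNIV UNIV \<rho> \<rho>" using c\<rho> \<rho>\<rho> by (intro homeomorphismI) auto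
    have "homeomorphism UNIV UNIV (\<rho> \<circ> (H t \<circ> \<rho>)) ((\<rho> \<circ> g) \<circ> \<rho>)"
      by (intro homeomorphism_compose[OF homeomorphism_compose[OF r g] r])
    then show "\<exists>g. homeomorphism UNIV UNIV (\<lambda>v. \<rho> (H t (\<rho> v))) g" by (auto simp: o_def)
  qed
  moreover have "(\<lambda>v. \<rho> (H 1 (\<rho> v))) ` (\<rho> ` S) \<subseteq> UNIV \<times> {0}"
    using H(2) by (auto simp: \<rho>\<rho>) (auto simp: \<rho>_def)
  ultimately show ?thesis unfolding trivial_link_def \<rho>_def[abs_def, symmetric] by blast
qed

text \<open>At a crossing the upper and the lower height are the maximum and the minimum of
  \<open>a\<close> and \<open>b\<close>. Elsewhere \<open>h\<close> follows the layer to which the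
  point belongs; since the crossings are finite in number, the exceptional values do not affect
  limits along either layer.\<close>

lemma link_over_layers:
  assumes cl: "closed K" "closed K'" and L: "curve L = K \<union> K'" "crossings L = K \<inter> K'" "finite (crossings L)"
    and ab: "continuous_on UNIV a" "continuous_on UNIV b"
    and cr: "\<And>p. p \<in> crossings L \<Longrightarrow> (b p < a p \<and> over L p = at p within K) \<or> (a p < b p \<and> over L p = at p within K')"
  shows "link_over L ((\<lambda>p. (p, a p)) ` K \<union> (\<lambda>p. (p, b p)) ` K')"
proof -
  define h where "h p = (if p \<in> crossings L then max (a p) (b p) else if p \<in> K then a p else b p)" for p
  define l where "l p = min (a p) (b p)" for p
  have ab': "(a \<longlongrightarrow> a p) (at p within A)" "(b \<longlongrightarrow> b p) (at p within A)" for p A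
    using ab by (auto simp: continuous_on_def intro: tendsto_within_subset)
  have notX: "\<forall>\<^sub>F q in at p within A. q \<notin> crossings L" for p A
  proof -
    have "\<forall>\<^sub>F q in at p within A. q \<notin> crossings L - {p}"
      using L(3) finite_imp_closed[of "crossings L - {p}"]
      by (intro eventually_at_topological[THEN iffD2] exI[of _ "- (crossings L - {p})"])
        (auto simp del: Compl_Diff_eq simp: open_Compl)
    moreover have "\<forall>\<^sub>F q in at p within A. q \<noteq> p" by (simp add: eventually_at_filter)
    ultimately show ?thesis by eventually_elim auto
  qed
  have hK: "(h \<longlongrightarrow> a p) (at p within A)" if "\<forall>\<^sub>F q in at p within A. q \<in> K" for p A
  proof (rule tendsto_cong[THEN iffD2, OF _ ab'(1)])
    show "\<forall>\<^sub>F q in at p within A. h q = a q" using that notX[of p A] by eventually_elim (simp add: h_def)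
  qed
  have hK': "(h \<longlongrightarrow> b p) (at p within A)" if "\<forall>\<^sub>F q in at p within A. q \<in> K'" for p A
  proof (rule tendsto_cong[THEN iffD2, OF _ ab'(2)])
    show "\<forall>\<^sub>F q in at p within A. h q = b q"
      using that notX[of p A] by eventually_elim (use L in \<open>auto simp: h_def\<close>)
  qed
  have ev: "\<forall>\<^sub>F q in at p within A. q \<in> B" if "A \<subseteq> B \<union> C" "closed C" "p \<notin> C" for p A B and C :: "plane set"
  proof -
    have "\<forall>\<^sub>F q in at p within A. q \<notin> C"
      using that(2,3) by (intro eventually_at_topological[THEN iffD2] exI[of _ "- C"]) auto
    then show ?thesis using eventually_in_at_within[of A p] by eventually_elim (use that(1) in auto)
  qed
  have 1: "(\<lambda>p. (p, a p)) ` K \<union> (\<lambda>p. (p, b p)) ` K' =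
      {(p, h p) |p. p \<in> curve L} \<union> {(p, l p) |p. p \<in> crossings L}" (is "?S = ?R")
  proof
    show "?S \<subseteq> ?R"
    proof
      fix v assume "v \<in> ?S"
      then obtain p where "p \<in> K \<and> v = (p, a p) \<or> p \<in> K' \<and> v = (p, b p)" by blast
      then show "v \<in> ?R"
        using L by (cases "a p \<le> b p") (auto simp: h_def l_def max_def min_def)
    qed
    show "?R \<subseteq> ?S" using L by (auto simp: h_def l_def max_def min_def)
  qed
  have 2: "continuous_on (curve L - crossings L) h"
    unfolding continuous_on_def
  proof
    fix p assume p: "p \<in> curve L - crossings L"
    show "(h \<longlongrightarrow> h p) (at p within curve L - crossings L)"
    proof (cases "p \<in> K")
      case True
      then have "\<forall>\<^sub>F q in at p within curve L - crossings L. q \<in> K"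
        using p L cl by (intro ev[where C = K']) auto
      then show ?thesis using hK True p by (simp add: h_def)
    next
      case False
      then have "\<forall>\<^sub>F q in at p within curve L - crossings L. q \<in> K'"
        using p L cl by (intro ev[where C = K]) auto
      then show ?thesis using hK' False p by (simp add: h_def)
    qed
  qed
  have 3: "l p < h p \<and> (h \<longlongrightarrow> h p) (over L p) \<and>
      (\<exists>A. over L p = at p within A \<and> (h \<longlongrightarrow> l p) (at p within (curve L - A)))"
    if p: "p \<in> crossings L" for p
    using cr[OF p]
  proof
    assume *: "b p < a p \<and> over L p = at p within K"
    have "(h \<longlongrightarrow> a p) (at p within K)" by (intro hK eventually_in_at_within)
    moreover have "(h \<longlongrightarrow> b p) (at p within (curve L - K))"
      by (intro hK' eventually_mono[OF eventually_in_at_within]) (use L in auto)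
    ultimately show ?thesis using * p by (auto simp: h_def l_def max_def min_def)
  next
    assume *: "a p < b p \<and> over L p = at p within K'"
    have "(h \<longlongrightarrow> b p) (at p within K')" by (intro hK' eventually_in_at_within)
    moreover have "(h \<longlongrightarrow> a p) (at p within (curve L - K'))"
      by (intro hK eventually_mono[OF eventually_in_at_within]) (use L in auto)
    ultimately show ?thesis using * p by (auto simp: h_def l_def max_def min_def)
  qed
  show ?thesis unfolding link_over_def using 1 2 3 by blast
qed

section \<open>Resolutions\<close>

lemma diagram_eqI:
  "curve D = curve D' \<Longrightarrow> over D = over D' \<Longrightarrow> mark D = mark D' \<Longrightarrow> D = D'" for D D' :: diagram
  by (cases D; cases D') simp

text \<open>The factor 8 magnifies a box of half-width 1/2 about \<open>v\<close> to
  \<open>square\<close>. In the example such boxes about the vertices contain no crossings and are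
  disjoint.\<close>

definition scale :: "plane \<Rightarrow> plane \<Rightarrow> plane" where
  "scale v q = 8 *\<^sub>R (q - v)"

definition unscale :: "plane \<Rightarrow> plane \<Rightarrow> plane" where
  "unscale v q = v + (1 / 8) *\<^sub>R q"

definition box_at :: "plane \<Rightarrow> plane set" where
  "box_at v = {q. scale v q \<in> square}"

definition cone :: "plane \<Rightarrow> plane set" where
  "cone v = {v + s *\<^sub>R (1, 1) + t *\<^sub>R (1, -1) |s t. s * t > 0}"

text \<open>A concrete representative of a smoothing, which is otherwise determined only up to a
  homeomorphism. The crossing data can be kept because the lemma below assumes a box without
  crossings.\<close>

definition smooth :: "resolution \<Rightarrow> plane \<Rightarrow> diagram \<Rightarrow> diagram" where
  "smooth r v D = \<lparr>curve = (curve D - box_at v) \<union> unscale v ` curve (smoothing_picture r),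
     over = over D, mark = (mark D)(v := bot)\<rparr>"

lemma mem_box_at: "(x, y) \<in> box_at (a, b) \<longleftrightarrow> a - 1/2 \<le> x \<and> x \<le> a + 1/2 \<and> b - 1/2 \<le> y \<and> y \<le> b + 1/2"
  by (auto simp: box_at_def scale_def square_def)

lemma scale_unscale [simp]: "scale v (unscale v q) = q" "unscale v (scale v q) = q"
  by (simp_all add: scale_def unscale_def)

lemma scale_homeomorphism: "homeomorphism UNIV UNIV (scale v) (unscale v)"
  by (rule homeomorphismI) (auto simp: scale_def[abs_def] unscale_def[abs_def] intro!: continuous_intros)

lemma unscale_closed_segment: "unscale v ` closed_segment a b = closed_segment (unscale v a) (unscale v b)"
proof -
  have "unscale v ` closed_segment a b = (\<lambda>q. v + q) ` (\<lambda>q. (1 / 8) *\<^sub>R q) ` closed_segment a b"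
    by (simp add: image_image unscale_def)
  also have "(\<lambda>q. (1 / 8) *\<^sub>R q) ` closed_segment a b = closed_segment ((1 / 8) *\<^sub>R a) ((1 / 8) *\<^sub>R b)"
    by (rule closed_segment_linear_image[symmetric]) (simp add: linear_scale_self)
  finally show ?thesis by (simp add: closed_segment_translation unscale_def)
qed

lemma unscale_polyline: "unscale v ` polyline l = polyline (map (unscale v) l)"
  by (induction l rule: polyline.induct) (simp_all add: image_Un unscale_closed_segment)

lemma cone_scale: "scale v ` cone v = cone 0"
proof (intro set_eqI iffI)
  fix q assume "q \<in> scale v ` cone v"
  then obtain s t where st: "s * t > 0" "q = scale v (v + s *\<^sub>R (1, 1) + t *\<^sub>R (1, -1))"
    by (auto simp: cone_def)
  then have "q = 0 + (8 * s) *\<^sub>R (1, 1) + (8 * t) *\<^sub>R (1, -1)" by (simp add: scale_def algebra_simps)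
  moreover have "(8 * s) * (8 * t) > 0" using st(1) by simp
  ultimately show "q \<in> cone 0" unfolding cone_def by blast
next
  fix q :: plane assume "q \<in> cone 0"
  then obtain s t where st: "s * t > 0" "q = 0 + s *\<^sub>R (1, 1) + t *\<^sub>R (1, -1)"
    unfolding cone_def by blast
  then have "unscale v q = v + (s / 8) *\<^sub>R (1, 1) + (t / 8) *\<^sub>R (1, -1)" by (simp add: unscale_def)
  moreover have "(s / 8) * (t / 8) > 0" using st(1) by simp
  ultimately have "unscale v q \<in> cone v" unfolding cone_def by blast
  then show "q \<in> scale v ` cone v" by (rule image_eqI[rotated]) simp
qed

lemma smoothing_in_box: "unscale v ` curve (smoothing_picture r) \<subseteq> box_at v"
  by (cases r) (auto simp: mem_closed_segment_plane square_def box_at_def)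

lemma smoothed_at_vertex_smooth:
  assumes curve: "curve D \<inter> box_at v = unscale v ` curve vertex_picture"
    and over: "\<And>p. p \<in> box_at v \<Longrightarrow> over D p = bot"
    and mark: "\<And>p. p \<in> box_at v \<Longrightarrow> mark D p = (if p = v then at v within cone v else bot)"
  shows "smoothed_at_vertex r D (smooth r v D)"
proof -
  have sq: "scale v ` A \<inter> square = scale v ` (A \<inter> box_at v)" for A by (auto simp: box_at_def)
  have box: "unscale v p \<in> box_at v \<longleftrightarrow> p \<in> square" for p by (simp add: box_at_def)
  have inv: "inv (scale v) = unscale v" by (rule homeo_simps(3)[OF scale_homeomorphism])
  have sc: "scale v ` unscale v ` A = A" for A by (simp add: image_image)
  have un: "unscale v p = v \<longleftrightarrow> p = 0" for p by (simp add: unscale_def)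
  have "restrict_to square (transform (scale v) D) = vertex_picture"
  proof (rule diagram_eqI)
    show "curve (restrict_to square (transform (scale v) D)) = curve vertex_picture"
      by (simp add: sq curve sc)
    show "over (restrict_to square (transform (scale v) D)) = over vertex_picture"
      by (rule ext) (auto simp: over_restrict_to over_transform inv over box vertex_picture_def over_picture filtermap_bot)
    show "mark (restrict_to square (transform (scale v) D)) = mark vertex_picture"
    proof
      fix p
      have "filtermap (scale v) (at v within cone v) = at 0 within cone 0"
        unfolding filtermap_at_within_homeomorphism[OF scale_homeomorphism] cone_scale by (simp add: scale_def)
      moreover have "(0 :: plane) \<in> square" by (simp add: zero_prod_def square_def)
      ultimately show "mark (restrict_to square (transform (scale v) D)) p = mark vertex_picture p"
        by (auto simp: mark_restrict_to mark_transform inv mark box un vertex_picture_def mark_picture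
            filtermap_bot cone_def zero_prod_def)
    qed
  qed
  moreover have "restrict_to square (transform (scale v) (smooth r v D)) = smoothing_picture r"
  proof (rule diagram_eqI)
    have inner: "curve (smooth r v D) \<inter> box_at v = unscale v ` curve (smoothing_picture r)"
      using smoothing_in_box[of v r] by (auto simp: smooth_def)
    show "curve (restrict_to square (transform (scale v) (smooth r v D))) = curve (smoothing_picture r)"
      unfolding curve_restrict_to curve_transform sq using inner sc by simp
    show "over (restrict_to square (transform (scale v) (smooth r v D))) = over (smoothing_picture r)"
      by (rule ext, cases r)
        (auto simp: over_restrict_to over_transform inv over box smooth_def over_picture filtermap_bot)
    show "mark (restrict_to square (transform (scale v) (smooth r v D))) = mark (smoothing_picture r)"
      by (rule ext, cases r)
        (auto simp: mark_restrict_to mark_transform inv mark box smooth_def mark_picture filtermap_bot)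
  qed
  moreover have "restrict_to (- square) (transform (scale v) D) =
      restrict_to (- square) (transform (scale v) (smooth r v D))"
  proof (rule diagram_eqI)
    show "curve (restrict_to (- square) (transform (scale v) D)) =
        curve (restrict_to (- square) (transform (scale v) (smooth r v D)))"
      using smoothing_in_box[of v r] by (auto simp: smooth_def box_at_def)
    show "over (restrict_to (- square) (transform (scale v) D)) =
        over (restrict_to (- square) (transform (scale v) (smooth r v D)))"
      by (rule ext) (simp add: over_restrict_to over_transform smooth_def)
    have "p \<in> square" if "unscale v p = v" for p using that by (simp add: un zero_prod_def square_def)
    then show "mark (restrict_to (- square) (transform (scale v) D)) =
        mark (restrict_to (- square) (transform (scale v) (smooth r v D)))"
      by (intro ext) (auto simp: mark_restrict_to mark_transform smooth_def inv)
  qed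
  ultimately show ?thesis
    unfolding smoothed_at_vertex_def replaced_via_def using scale_homeomorphism by blast
qed

definition resolved_bands :: "resolution \<Rightarrow> plane \<Rightarrow> diagram" where
  "resolved_bands r d = smooth r (0, 3) (smooth r (3, 0) (crossing_bands d))"

lemma over_resolved_bands [simp]: "over (resolved_bands r d) = over (crossing_bands d)"
  by (simp add: resolved_bands_def smooth_def)

lemma crossings_resolved_bands [simp]: "crossings (resolved_bands r d) = crossings (crossing_bands d)"
  by (simp add: crossings_def)

lemma over_crossing_bands_neq_bot:
  assumes "over (crossing_bands d) p \<noteq> bot"
  shows "p \<in> {(-1, -1), (-1, 1), (1, -1), (1, 1), (5, 5), (-5, 5), (5, -5), (-5, -5)}"
proof (rule ccontr)
  assume "\<not> ?thesis"
  then have "over (crossing_bands d) p = bot" by (simp add: crossing_bands_def over_picture)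
  then show False using assms by simp
qed

lemma mark_crossing_bands:
  "mark (crossing_bands d) p = (if p = (3, 0) \<or> p = (0, 3) then at p within cone p else bot)"
  by (simp add: crossing_bands_def mark_picture cone_def)

lemma vertex_picture_unscaled:
  "unscale v ` curve vertex_picture =
     closed_segment (unscale v (-4, -4)) (unscale v (4, 4)) \<union> closed_segment (unscale v (-4, 4)) (unscale v (4, -4))"
  by (simp add: vertex_picture_def image_Un unscale_closed_segment insert_absorb)

lemma smoothing_picture_unscaled:
  "unscale v ` curve (smoothing_picture Positive) =
     polyline (map (unscale v) [(-4, 4), (0, 2), (4, 4)]) \<union> polyline (map (unscale v) [(-4, -4), (0, -2), (4, -4)])"
  "unscale v ` curve (smoothing_picture Negative) =
     polyline (map (unscale v) [(-4, 4), (-2, 0), (-4, -4)]) \<union> polyline (map (unscale v) [(4, 4), (2, 0), (4, -4)])"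
  by (simp_all only: unscale_polyline[symmetric]) (simp_all add: image_Un)

lemma vertices_resolved_bands: "vertices (resolved_bands r d) = {}"
  by (auto simp: vertices_def resolved_bands_def smooth_def mark_crossing_bands)

lemma resolves_to_resolved_bands: "resolves_to r (crossing_bands d) (resolved_bands r d)"
proof -
  have box: "p \<notin> box_at (3, 0)" "p \<notin> box_at (0, 3)" if "over (crossing_bands d) p \<noteq> bot" for p
    using over_crossing_bands_neq_bot[OF that] by (auto simp: mem_box_at)
  have disj: "box_at (3, 0) \<inter> box_at (0, 3) = {}" by (auto simp: mem_box_at)
  have "curve (crossing_bands d) \<inter> box_at (3, 0) = unscale (3, 0) ` curve vertex_picture"
    unfolding vertex_picture_unscaled
    by (simp add: crossing_bands_def unscale_def set_eq_iff split_paired_All mem_closed_segment_plane mem_box_at)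
      (intro allI; argo)
  then have 1: "smoothed_at_vertex r (crossing_bands d) (smooth r (3, 0) (crossing_bands d))"
  proof (rule smoothed_at_vertex_smooth)
    fix p assume p: "p \<in> box_at (3, 0)"
    show "over (crossing_bands d) p = bot" using box(1)[of p] p by blast
    have "p \<noteq> (0, 3)" using p mem_box_at[of 0 3 3 0] by force
    then show "mark (crossing_bands d) p = (if p = (3, 0) then at (3, 0) within cone (3, 0) else bot)"
      by (simp add: mark_crossing_bands)
  qed
  have "curve (crossing_bands d) \<inter> box_at (0, 3) = unscale (0, 3) ` curve vertex_picture"
    unfolding vertex_picture_unscaled
    by (simp add: crossing_bands_def unscale_def set_eq_iff split_paired_All mem_closed_segment_plane mem_box_at)
      (intro allI; argo)
  then have "curve (smooth r (3, 0) (crossing_bands d)) \<inter> box_at (0, 3) = unscale (0, 3) ` curve vertex_picture"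
    using smoothing_in_box[of "(3, 0)" r] disj by (auto simp: smooth_def)
  then have 2: "smoothed_at_vertex r (smooth r (3, 0) (crossing_bands d)) (resolved_bands r d)"
    unfolding resolved_bands_def
  proof (rule smoothed_at_vertex_smooth)
    fix p assume p: "p \<in> box_at (0, 3)"
    show "over (smooth r (3, 0) (crossing_bands d)) p = bot"
      using box(2)[of p] p unfolding smooth_def diagram.simps by blast
    have "p \<noteq> (3, 0)" using p mem_box_at[of 3 0 0 3] by force
    then show "mark (smooth r (3, 0) (crossing_bands d)) p =
        (if p = (0, 3) then at (0, 3) within cone (0, 3) else bot)"
      by (simp add: mark_crossing_bands smooth_def)
  qed
  show ?thesis
    by (rule resolves_to.intros(2)[OF 1 resolves_to.intros(2)[OF 2 resolves_to.intros(1)]])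
      (rule vertices_resolved_bands)
qed

section \<open>The two sublinks of a resolved diagram\<close>

definition strands :: "plane list list \<Rightarrow> plane set" where
  "strands ls = (\<Union>l\<in>set ls. polyline l)"

text \<open>The abscissas 11/4 and 13/4 and the ordinates 1/4 and -1/4 come from the corners of
  \<open>smoothing_picture\<close> at distance 2 from the vertex, scaled down by 8. The negative
  resolution gives a finger with tip at 11/4 and a cap at 13/4.\<close>

fun horizontal_strands :: "resolution \<Rightarrow> plane list list" where
  "horizontal_strands Negative =
     [[(-4, 1), (2, 1), (5/2, 1/2), (11/4, 0), (5/2, -1/2), (2, -1), (-4, -1)],
      [(4, -1), (7/2, -1/2), (13/4, 0), (7/2, 1/2), (4, 1)]]"
| "horizontal_strands Positive =
     [[(-4, 1), (2, 1), (5/2, 1/2), (3, 1/4), (7/2, 1/2), (4, 1)],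
      [(-4, -1), (2, -1), (5/2, -1/2), (3, -1/4), (7/2, -1/2), (4, -1)]]"

definition horizontal_closure :: "plane list list" where
  "horizontal_closure = [[(4, 1), (6, 9), (-6, 9), (-4, 1)], [(4, -1), (6, -9), (-6, -9), (-4, -1)]]"

fun opposite :: "resolution \<Rightarrow> resolution" where
  "opposite Positive = Negative"
| "opposite Negative = Positive"

definition horizontal_link :: "resolution \<Rightarrow> plane set" where
  "horizontal_link r = strands (horizontal_strands r @ horizontal_closure)"

text \<open>Reflection in the diagonal exchanges the two bands. It turns the west and east regions
  of a marker into the south and north regions and therefore exchanges the two resolutions as well,
  so every computation for one band serves for the other.\<close>

definition vertical_link :: "resolution \<Rightarrow> plane set" where
  "vertical_link r = strands (map (map prod.swap) (horizontal_strands (opposite r) @ horizontal_closure))"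

lemma swap_closed_segment: "prod.swap ` closed_segment a b = closed_segment (prod.swap a) (prod.swap b)"
  for a b :: plane
  by (rule closed_segment_linear_image[symmetric]) (auto intro!: linearI simp: prod_eq_iff)

lemma swap_polyline: "prod.swap ` polyline l = polyline (map prod.swap l)"
  by (induction l rule: polyline.induct) (simp_all add: image_Un swap_closed_segment)

lemma vertical_link_eq: "vertical_link r = prod.swap ` horizontal_link (opposite r)"
  by (simp add: vertical_link_def horizontal_link_def strands_def image_UN image_Un swap_polyline)

lemma opposite_opposite [simp]: "opposite (opposite r) = r"
  by (cases r) simp_all

lemma horizontal_link_eq: "horizontal_link r = prod.swap ` vertical_link (opposite r)"
  by (simp add: vertical_link_eq image_image)

lemma smooth_horizontal:
  "(strands [[(-4, 1), (2, 1), (4, -1)], [(-4, -1), (2, -1), (4, 1)]] - box_at (3, 0))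
     \<union> unscale (3, 0) ` curve (smoothing_picture r) = strands (horizontal_strands r)"
  by (cases r; simp only: smoothing_picture_unscaled;
    simp add: strands_def unscale_def set_eq_iff split_paired_All mem_closed_segment_plane mem_box_at;
    intro allI; argo)

lemma smooth_vertical:
  "(strands [[(-1, -4), (-1, 2), (1, 4)], [(1, -4), (1, 2), (-1, 4)]] - box_at (0, 3))
     \<union> unscale (0, 3) ` curve (smoothing_picture r) = strands (map (map prod.swap) (horizontal_strands (opposite r)))"
  by (cases r; simp only: smoothing_picture_unscaled opposite.simps;
    simp add: strands_def unscale_def set_eq_iff split_paired_All mem_closed_segment_plane mem_box_at;
    intro allI; argo)

lemma strands_append: "strands (ls @ ls') = strands ls \<union> strands ls'"
  by (simp add: strands_def)

lemma curve_resolved_bands: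
  "curve (resolved_bands r d) = horizontal_link r \<union> vertical_link r"
proof -
  let ?H = "strands [[(-4, 1), (2, 1), (4, -1)], [(-4, -1), (2, -1), (4, 1)]]"
  let ?V = "strands [[(-1, -4), (-1, 2), (1, 4)], [(1, -4), (1, 2), (-1, 4)]]"
  let ?O = "strands horizontal_closure" and ?O' = "strands (map (map prod.swap) horizontal_closure)"
  have "curve (crossing_bands d) = ?H \<union> ?V \<union> (?O \<union> ?O')"
    by (simp add: crossing_bands_def strands_def horizontal_closure_def Un_ac del: polyline.simps)
  moreover have "?V \<inter> box_at (3, 0) = {}" "?H \<inter> box_at (0, 3) = {}"
    "(?O \<union> ?O') \<inter> box_at (3, 0) = {}" "(?O \<union> ?O') \<inter> box_at (0, 3) = {}"
    by (simp add: strands_def horizontal_closure_def set_eq_iff split_paired_All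
        mem_closed_segment_plane mem_box_at; intro conjI allI; argo)+
  moreover have "box_at (3, 0) \<inter> box_at (0, 3) = {}" by (auto simp: mem_box_at)
  ultimately have "curve (resolved_bands r d) =
      ((?H - box_at (3, 0)) \<union> unscale (3, 0) ` curve (smoothing_picture r)) \<union>
      ((?V - box_at (0, 3)) \<union> unscale (0, 3) ` curve (smoothing_picture r)) \<union> (?O \<union> ?O')"
    using smoothing_in_box[of "(3, 0)" r] smoothing_in_box[of "(0, 3)" r]
    unfolding resolved_bands_def smooth_def diagram.simps by blast
  then show ?thesis
    unfolding smooth_horizontal smooth_vertical horizontal_link_def vertical_link_def map_append strands_append
    by blast
qed

lemma compact_strands: "compact (strands ls)"
  unfolding strands_def by (intro compact_UN) (auto simp: compact_polyline)

lemma compact_horizontal_link: "compact (horizontal_link r)"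
  and compact_vertical_link: "compact (vertical_link r)"
  by (simp_all add: horizontal_link_def vertical_link_def compact_strands)

definition inner_points :: "plane set" where
  "inner_points = {(-1, -1), (-1, 1), (1, -1), (1, 1)}"

definition outer_points :: "plane set" where
  "outer_points = {(5, 5), (-5, 5), (5, -5), (-5, -5)}"

lemma crossings_crossing_bands:
  assumes "d \<in> {(1, 0), (0, 1)}"
  shows "crossings (crossing_bands d) = inner_points \<union> outer_points"
  using crossing_bands_presents[OF assms]
  by (auto simp: presents_def inner_crossings_def outer_crossings_def inner_points_def outer_points_def)

lemma strands_Int_subset:
  assumes "\<forall>l\<in>set ls. \<forall>l'\<in>set ls'. polyline l \<inter> polyline l' \<subseteq> X"
  shows "strands ls \<inter> strands ls' \<subseteq> X"
  using assms unfolding strands_def by blast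

lemma links_Int_Negative: "horizontal_link Negative \<inter> vertical_link Negative = inner_points \<union> outer_points"
proof
  show "horizontal_link Negative \<inter> vertical_link Negative \<subseteq> inner_points \<union> outer_points"
    unfolding horizontal_link_def vertical_link_def
    by (rule strands_Int_subset, simp add: horizontal_closure_def inner_points_def outer_points_def piece_simps)
      (intro conjI allI; argo)
  show "inner_points \<union> outer_points \<subseteq> horizontal_link Negative \<inter> vertical_link Negative"
    by (simp add: horizontal_link_def vertical_link_def strands_def horizontal_closure_def
        inner_points_def outer_points_def mem_closed_segment_plane)
qed

lemma links_Int: "horizontal_link r \<inter> vertical_link r = inner_points \<union> outer_points"
proof (cases r)
  case Positive
  have "horizontal_link r \<inter> vertical_link r = prod.swap ` (horizontal_link Negative \<inter> vertical_link Negative)"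
    unfolding Positive vertical_link_eq[of Positive] horizontal_link_eq[of Positive] opposite.simps
    by (simp add: image_Int Int_commute)
  then show ?thesis by (auto simp: links_Int_Negative inner_points_def outer_points_def)
qed (simp add: links_Int_Negative)

lemma line_germ_scale2:
  "at p within line p (-6, 0) = at p within line p (1, 0)"
  "at p within line p (0, -6) = at p within line p (0, 1)"
  by (auto intro!: line_germ_eq simp: zero_prod_def)

lemma horizontal_link_germ_inner:
  assumes "p \<in> inner_points"
  shows "at p within horizontal_link r = at p within line p (1, 0)"
  using assms unfolding horizontal_link_def strands_def inner_points_def
  by (elim insertE emptyE; cases r; simp add: horizontal_closure_def germ_simps mem_closed_segment_plane line_germ_scale line_germ_scale2)

lemma horizontal_link_germ_diagonal:
  assumes "p \<in> {(5, 5), (-5, -5)}"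
  shows "at p within horizontal_link r = at p within line p (1, 4)"
  using assms unfolding horizontal_link_def strands_def
  by (elim insertE emptyE; cases r; simp add: horizontal_closure_def germ_simps mem_closed_segment_plane line_germ_scale line_germ_scale2)

lemma horizontal_link_germ_antidiagonal:
  assumes "p \<in> {(5, -5), (-5, 5)}"
  shows "at p within horizontal_link r = at p within line p (1, -4)"
  using assms unfolding horizontal_link_def strands_def
  by (elim insertE emptyE; cases r; simp add: horizontal_closure_def germ_simps mem_closed_segment_plane line_germ_scale line_germ_scale2)

lemma vertical_link_germ_inner:
  assumes "p \<in> inner_points"
  shows "at p within vertical_link r = at p within line p (0, 1)"
  using assms unfolding vertical_link_def strands_def inner_points_def
  by (elim insertE emptyE; cases r; simp add: horizontal_closure_def germ_simps mem_closed_segment_plane line_germ_scale line_germ_scale2)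

lemma over_crossing_bands_inner: "p \<in> inner_points \<Longrightarrow> over (crossing_bands d) p = at p within line p d"
  unfolding inner_points_def
  by (elim insertE emptyE; simp add: crossing_bands_def over_picture)

lemma over_crossing_bands_outer:
  "p \<in> outer_points \<Longrightarrow> over (crossing_bands d) p = at p within horizontal_link r"
  using horizontal_link_germ_diagonal[of p r] horizontal_link_germ_antidiagonal[of p r] unfolding outer_points_def
  by (elim insertE emptyE; simp add: crossing_bands_def over_picture line_germ_scale)

section \<open>Triviality of the resolved links\<close>

text \<open>With the horizontal band on top at all eight crossings the two sublinks lie in separate
  layers, for both resolutions.\<close>

lemma horizontal_over_trivial: "trivial_link_diagram (resolved_bands r (1, 0))"
proof -
  let ?S = "(\<lambda>p. (p, 1)) ` horizontal_link r \<union> (\<lambda>p. (p, 0 :: real)) ` vertical_link r"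
  have X: "crossings (resolved_bands r (1, 0)) = inner_points \<union> outer_points"
    by (simp add: crossings_crossing_bands)
  have link: "link_over (resolved_bands r (1, 0)) ?S"
  proof (rule link_over_layers)
    show "closed (horizontal_link r)" "closed (vertical_link r)"
      using compact_horizontal_link compact_vertical_link compact_imp_closed by auto
    show "finite (crossings (resolved_bands r (1, 0)))"
      unfolding X by (simp add: inner_points_def outer_points_def)
    fix p assume "p \<in> crossings (resolved_bands r (1, 0))"
    then have "over (crossing_bands (1, 0)) p = at p within horizontal_link r"
      unfolding X using over_crossing_bands_inner[of p] horizontal_link_germ_inner[of p] over_crossing_bands_outer[of p]
      by auto
    then show "0 < (1 :: real) \<and> over (resolved_bands r (1, 0)) p = at p within horizontal_link r \<or>
      (1 :: real) < 0 \<and> over (resolved_bands r (1, 0)) p = at p within vertical_link r" by simp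
  qed (simp_all only: curve_resolved_bands X links_Int continuous_on_const)
  have "trivial_link ((\<lambda>p. (p, 1)) ` horizontal_link r \<union> vertical_link r \<times> {0})"
    by (rule trivial_link_layers[where a = "\<lambda>_. 1"]) (auto simp: compact_horizontal_link compact_vertical_link)
  then have "trivial_link ?S" by (simp only: layer_eq)
  with link show ?thesis
    unfolding trivial_link_diagram_def using vertices_resolved_bands by blast
qed

text \<open>
  The negative resolution cuts the horizontal band at \<open>(3, 0)\<close>. Where the vertical band passes over it,
  the rest of the horizontal band is a finger, which lies at height \<open>- 1\<close> and can be pulled out to the west
  by contracting the half-space below the vertical link.
\<close>

definition dip :: "plane \<Rightarrow> real" where
  "dip p = 1 - 2 * max 0 (min 1 (min (fst p + 3) (min (2 * (13/4 - fst p)) (2 - \<bar>snd p\<bar>))))"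

text \<open>The fixed point -2 is west of the vertical strands at -1 and 1, and it is where
  \<open>dip\<close> has just reached its minimum along the finger.\<close>

definition squeeze :: "real \<Rightarrow> real \<Rightarrow> real" where
  "squeeze c x = x - c * max 0 (x + 2)"

definition stretch :: "real \<Rightarrow> real \<Rightarrow> real" where
  "stretch c x = x + c / (1 - c) * max 0 (x + 2)"

lemma squeeze_stretch:
  assumes "0 \<le> c" "c < 1"
  shows "stretch c (squeeze c x) = x" "squeeze c (stretch c x) = x"
proof -
  show "stretch c (squeeze c x) = x"
  proof (cases "x > -2")
    case True
    have "squeeze c x + 2 = (1 - c) * (x + 2)" using True by (simp add: squeeze_def algebra_simps)
    moreover have "(1 - c) * (x + 2) > 0" using True assms by simp
    ultimately have "stretch c (squeeze c x) = squeeze c x + c * (x + 2)"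
      using assms by (simp add: stretch_def)
    then show ?thesis using True by (simp add: squeeze_def)
  qed (simp add: squeeze_def stretch_def)
  show "squeeze c (stretch c x) = x"
  proof (cases "x > -2")
    case True
    have "stretch c x + 2 = (x + 2) / (1 - c)" using True assms by (simp add: stretch_def field_simps)
    moreover have "(x + 2) / (1 - c) > 0" using True assms by simp
    ultimately have "squeeze c (stretch c x) = stretch c x - c * ((x + 2) / (1 - c))"
      by (simp add: squeeze_def)
    then show ?thesis using True by (simp add: stretch_def)
  qed (simp add: squeeze_def stretch_def)
qed

text \<open>Vanishes at nonnegative heights, so the vertical link at height 0 is not moved. The
  factor 1 - 7/8 takes the finger between -2 and 11/4 to an interval ending at -2 + 19/32, which is
  less than -11/8 and so still west of the vertical strand at -1.\<close>

definition depth :: "real \<Rightarrow> real" where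
  "depth z = 7/8 * max 0 (min 1 (- z))"

lemma depth_bounds:
  assumes "t \<in> {0..1}"
  shows "0 \<le> t * depth z" "t * depth z < 1"
proof -
  have *: "0 \<le> depth z" "depth z \<le> 7/8" by (auto simp: depth_def)
  then show "0 \<le> t * depth z" using assms by simp
  have "t * depth z \<le> 1 * (7/8)" using assms * by (intro mult_mono) auto
  then show "t * depth z < 1" by simp
qed

lemma ambient_isotopy_squeeze:
  "ambient_isotopy (\<lambda>t v :: plane \<times> real. ((squeeze (t * depth (snd v)) (fst (fst v)), snd (fst v)), snd v))"
proof (rule ambient_isotopyI[where
      G = "\<lambda>t v. ((stretch (t * depth (snd v)) (fst (fst v)), snd (fst v)), snd v)"])
  show "continuous_on ({0..1} \<times> UNIV)
      (\<lambda>(t, v :: plane \<times> real). ((squeeze (t * depth (snd v)) (fst (fst v)), snd (fst v)), snd v))"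
    unfolding case_prod_beta squeeze_def depth_def by (intro continuous_intros)
  show "continuous_on UNIV (\<lambda>v :: plane \<times> real. ((stretch (t * depth (snd v)) (fst (fst v)), snd (fst v)), snd v))"
    if "t \<in> {0..1}" for t
  proof -
    have "1 - t * depth z \<noteq> 0" for z using depth_bounds[OF that, of z] by simp
    then show ?thesis unfolding stretch_def by (intro continuous_intros) (auto simp: depth_def intro!: continuous_intros)
  qed
qed (simp_all add: squeeze_stretch depth_bounds squeeze_def[of 0])

text \<open>East of -2 the link avoids the region where \<open>dip\<close> lies strictly between its
  extreme values: it is either in the finger, where \<open>dip\<close> is -1, or where
  \<open>dip\<close> is 1. West of -2 the squeezing is the identity.\<close>

lemma horizontal_link_Negative_cases:
  assumes "(x, y) \<in> horizontal_link Negative"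
  shows "x \<le> -2 \<or> 13/4 \<le> x \<or> 2 \<le> \<bar>y\<bar> \<or> (-2 \<le> x \<and> x \<le> 11/4 \<and> \<bar>y\<bar> \<le> 1)"
proof -
  have "x \<le> -2 \<or> 13/4 \<le> x \<or> 2 \<le> y \<or> y \<le> -2 \<or> (-2 \<le> x \<and> x \<le> 11/4 \<and> -1 \<le> y \<and> y \<le> 1)"
    using assms
    by (simp add: horizontal_link_def strands_def horizontal_closure_def mem_closed_segment_plane) argo
  then show ?thesis by (auto simp: abs_le_iff)
qed

text \<open>The excluded rectangle is the place into which the finger is withdrawn.\<close>

lemma vertical_link_Negative_avoids:
  assumes "(x, y) \<in> vertical_link Negative"
  shows "\<not> (-2 \<le> x \<and> x \<le> -11/8 \<and> \<bar>y\<bar> \<le> 1)"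
proof -
  have "\<not> (-2 \<le> x \<and> x \<le> -11/8 \<and> -1 \<le> y \<and> y \<le> 1)"
    using assms
    by (simp add: vertical_link_def strands_def horizontal_closure_def mem_closed_segment_plane) argo
  then show ?thesis by auto
qed

lemma dip_points: "p \<in> inner_points \<Longrightarrow> dip p = -1" "p \<in> outer_points \<Longrightarrow> dip p = 1"
  by (auto simp: inner_points_def outer_points_def dip_def)

lemma dip_finger: "-2 \<le> x \<Longrightarrow> x \<le> 11/4 \<Longrightarrow> \<bar>y\<bar> \<le> 1 \<Longrightarrow> dip (x, y) = -1"
  by (auto simp: dip_def min_def max_def)

lemma continuous_on_dip: "continuous_on A dip"
  unfolding dip_def[abs_def] by (intro continuous_intros)

lemma trivial_link_dip:
  "trivial_link ((\<lambda>p. (p, dip p)) ` horizontal_link Negative \<union> vertical_link Negative \<times> {0})"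
proof -
  \<comment> \<open>The effect of the squeezing on the projection of the horizontal link, each point
    being moved according to its own height.\<close>
  define \<kappa> where "\<kappa> p = (squeeze (depth (dip p)) (fst p), snd p)" for p
  have \<kappa>: "p = \<kappa> p \<and> (dip p = 1 \<or> fst p \<le> -2) \<or>
      (dip (\<kappa> p) = dip p \<and> -2 \<le> fst (\<kappa> p) \<and> fst (\<kappa> p) \<le> -11/8 \<and> \<bar>snd (\<kappa> p)\<bar> \<le> 1)"
    if p: "p \<in> horizontal_link Negative" for p
  proof -
    obtain x y where xy: "p = (x, y)" by fastforce
    consider "x \<le> -2" | "13/4 \<le> x \<or> 2 \<le> \<bar>y\<bar>" | "-2 \<le> x" "x \<le> 11/4" "\<bar>y\<bar> \<le> 1"
      using horizontal_link_Negative_cases p unfolding xy by blast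
    then show ?thesis
    proof cases
      case 1
      then show ?thesis by (simp add: xy \<kappa>_def squeeze_def)
    next
      case 2
      then have "dip p = 1" by (auto simp: dip_def xy)
      then show ?thesis by (simp add: xy \<kappa>_def squeeze_def depth_def)
    next
      case 3
      then have "dip p = -1" by (simp add: dip_finger xy)
      define x' where "x' = x - 7/8 * (x + 2)"
      have "-2 \<le> x'" "x' \<le> -11/8" using 3 by (simp_all add: x'_def field_simps)
      moreover from this have "dip (x', y) = -1" using 3(3) by (intro dip_finger) auto
      moreover have "\<kappa> p = (x', y)"
        using 3 \<open>dip p = -1\<close> by (simp add: xy \<kappa>_def squeeze_def depth_def x'_def)
      ultimately show ?thesis using 3(3) \<open>dip p = -1\<close> by simp
    qed
  qed
  have dip_\<kappa>: "dip (\<kappa> p) = dip p" if "p \<in> horizontal_link Negative" for p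
    using \<kappa>[OF that] by auto
  have "continuous_on A \<kappa>" for A
    unfolding \<kappa>_def squeeze_def depth_def by (intro continuous_intros continuous_on_dip)
  then have "compact (\<kappa> ` horizontal_link Negative)"
    by (intro compact_continuous_image compact_horizontal_link)
  moreover have "dip q = 1" if q: "q \<in> \<kappa> ` horizontal_link Negative \<inter> vertical_link Negative" for q
  proof -
    obtain p where p: "p \<in> horizontal_link Negative" "q = \<kappa> p" using q by blast
    have "\<not> (-2 \<le> fst q \<and> fst q \<le> -11/8 \<and> \<bar>snd q\<bar> \<le> 1)"
      using vertical_link_Negative_avoids[of "fst q" "snd q"] q by simp
    then have "p = \<kappa> p \<and> (dip p = 1 \<or> fst p \<le> -2)" using \<kappa>[OF p(1)] p(2) by blast
    \<comment> \<open>A common point after the squeezing is an unmoved one, hence an old crossing.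
      The inner crossings are excluded, since their height is -1 and they lie east of -2; only outer
      ones with height 1 remain.\<close>
    then have "q \<in> inner_points \<union> outer_points" "dip q = 1 \<or> fst q \<le> -2"
      using p q links_Int[of Negative] by auto
    then show ?thesis using dip_points(2)[of q] by (auto simp: inner_points_def)
  qed
  ultimately have "trivial_link ((\<lambda>p. (p, dip p)) ` \<kappa> ` horizontal_link Negative \<union> vertical_link Negative \<times> {0})"
    by (intro trivial_link_layers compact_vertical_link continuous_on_dip)
  moreover have "(\<lambda>v. ((squeeze (1 * depth (snd v)) (fst (fst v)), snd (fst v)), snd v)) `
      ((\<lambda>p. (p, dip p)) ` horizontal_link Negative \<union> vertical_link Negative \<times> {0}) =
    (\<lambda>p. (p, dip p)) ` \<kappa> ` horizontal_link Negative \<union> vertical_link Negative \<times> {0}"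
  proof -
    have "squeeze (depth 0) x = x" for x by (simp add: squeeze_def depth_def)
    then show ?thesis
      by (simp add: image_Un image_image layer_eq dip_\<kappa> \<kappa>_def[symmetric] cong: image_cong)
  qed
  ultimately show ?thesis
    by - (rule trivial_link_isotopic[OF ambient_isotopy_squeeze], simp only:)
qed

lemma vertical_over_Negative_trivial: "trivial_link_diagram (resolved_bands Negative (0, 1))"
proof -
  let ?S = "(\<lambda>p. (p, dip p)) ` horizontal_link Negative \<union> (\<lambda>p. (p, 0)) ` vertical_link Negative"
  have X: "crossings (resolved_bands Negative (0, 1)) = inner_points \<union> outer_points"
    by (simp add: crossings_crossing_bands)
  have "link_over (resolved_bands Negative (0, 1)) ?S"
  proof (rule link_over_layers)
    show "closed (horizontal_link Negative)" "closed (vertical_link Negative)"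
      using compact_horizontal_link compact_vertical_link compact_imp_closed by auto
    show "finite (crossings (resolved_bands Negative (0, 1)))"
      unfolding X by (simp add: inner_points_def outer_points_def)
    fix p assume "p \<in> crossings (resolved_bands Negative (0, 1))"
    then show "0 < dip p \<and> over (resolved_bands Negative (0, 1)) p = at p within horizontal_link Negative \<or>
      dip p < 0 \<and> over (resolved_bands Negative (0, 1)) p = at p within vertical_link Negative"
      unfolding X using over_crossing_bands_inner[of p] vertical_link_germ_inner[of p Negative]
        over_crossing_bands_outer[of p] dip_points[of p] by auto
  qed (simp_all only: curve_resolved_bands X links_Int continuous_on_const continuous_on_dip)
  moreover have "trivial_link ?S" using trivial_link_dip by (simp only: layer_eq)
  ultimately show ?thesis
    unfolding trivial_link_diagram_def using vertices_resolved_bands by blast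
qed

text \<open>The half turn of \<open>trivial_link_swap\<close> carries the link constructed for the
  negative resolution to this one: now the vertical band has the finger, and the finger lies above
  the horizontal strands instead of below.\<close>

lemma vertical_over_Positive_trivial: "trivial_link_diagram (resolved_bands Positive (0, 1))"
proof -
  \<comment> \<open>The half turn reverses heights, so \<open>?b\<close> is 1 at the inner crossings
    and -1 at the outer ones, as the crossing data demand against height 0.\<close>
  let ?b = "\<lambda>p. - dip (prod.swap p)"
  let ?S = "(\<lambda>p. (p, 0)) ` horizontal_link Positive \<union> (\<lambda>p. (p, ?b p)) ` vertical_link Positive"
  have X: "crossings (resolved_bands Positive (0, 1)) = inner_points \<union> outer_points"
    by (simp add: crossings_crossing_bands)
  have sw: "prod.swap p \<in> inner_points \<longleftrightarrow> p \<in> inner_points" "prod.swap p \<in> outer_points \<longleftrightarrow> p \<in> outer_points" for p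
    by (cases p; auto simp: inner_points_def outer_points_def)+
  have "link_over (resolved_bands Positive (0, 1)) ?S"
  proof (rule link_over_layers)
    show "closed (horizontal_link Positive)" "closed (vertical_link Positive)"
      using compact_horizontal_link compact_vertical_link compact_imp_closed by auto
    show "finite (crossings (resolved_bands Positive (0, 1)))"
      unfolding X by (simp add: inner_points_def outer_points_def)
    show "continuous_on UNIV ?b"
      unfolding dip_def prod.swap_def by (intro continuous_intros)
    fix p assume "p \<in> crossings (resolved_bands Positive (0, 1))"
    then show "?b p < 0 \<and> over (resolved_bands Positive (0, 1)) p = at p within horizontal_link Positive \<or>
      0 < ?b p \<and> over (resolved_bands Positive (0, 1)) p = at p within vertical_link Positive"
      unfolding X using over_crossing_bands_inner[of p] vertical_link_germ_inner[of p Positive]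
        over_crossing_bands_outer[of p] dip_points[of "prod.swap p"] sw[of p] by auto
  qed (simp_all only: curve_resolved_bands X links_Int continuous_on_const)
  moreover have "?S = (\<lambda>v. (prod.swap (fst v), - snd v)) `
      ((\<lambda>p. (p, dip p)) ` horizontal_link Negative \<union> vertical_link Negative \<times> {0})"
    unfolding vertical_link_eq[of Positive] horizontal_link_eq[of Positive] opposite.simps
    by (simp add: image_Un image_image layer_eq Un_commute)
  ultimately show ?thesis
    unfolding trivial_link_diagram_def using vertices_resolved_bands trivial_link_swap[OF trivial_link_dip] by metis
qed

lemma crossing_bands_admissible:
  assumes "d \<in> {(1, 0), (0, 1)}"
  shows "admissible (crossing_bands d)"
proof -
  have "trivial_link_diagram (resolved_bands r d)" for r
    using assms horizontal_over_trivial vertical_over_Negative_trivial vertical_over_Positive_trivial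
    by (cases r) auto
  then show ?thesis
    unfolding admissible_def using crossing_bands_marked_graph_diagram[OF assms] resolves_to_resolved_bands by blast
qed

theorem theorem1:
  shows "\<exists>D\<^sub>1 D\<^sub>2. admissible D\<^sub>1 \<and> admissible D\<^sub>2 \<and> yoshikawa_move Omega8 D\<^sub>1 D\<^sub>2 \<and>
    \<not> transformable {Omega1, Omega2, Omega3, Omega4, Omega4', Omega5, Omega6, Omega6', Omega7} D\<^sub>1 D\<^sub>2"
proof (intro exI conjI)
  show "admissible (crossing_bands (1, 0))" "admissible (crossing_bands (0, 1))"
    by (simp_all add: crossing_bands_admissible)
  show "yoshikawa_move Omega8 (crossing_bands (1, 0)) (crossing_bands (0, 1))"
    by (rule crossing_bands_move)
  show "\<not> transformable {Omega1, Omega2, Omega3, Omega4, Omega4', Omega5, Omega6, Omega6', Omega7}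
      (crossing_bands (1, 0)) (crossing_bands (0, 1))"
    using transformable_linked crossing_bands_linked crossing_bands_not_linked by blast
qed

end
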